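(* Let $X$ be a symmetric real-valued Lévy process with characteristic exponent $\psi$ satisfying $\int_0^\infty \frac{dx}{1+\psi(x)}<\infty$, and let $B\subset\mathbb{R}$ be a compact set with $0\in B$. (i) If $\psi$ is regularly varying at $0$ with index $\delta\in(1,2]$, then for every $x\in\mathbb{R}$, $$\lim_{t\to\infty}\left[t\,\psi^{-1}(1/t)\,\mathbb{P}^x(T_B>t)\right]=\frac{\delta\,\Gamma\left(1-\frac1\delta\right)\sin^2\frac{\pi}{\delta}}{\pi}\left[K(x)-\mathbb{E}^xK(X_{T_B})\right].$$ (ii) If $\psi$ is regularly varying at $0$ with index $1$, then there is a function $L(u)$, $u>0$, slowly varying at $0$, such that for every $x\in\mathbb{R}$, $$\lim_{t\to\infty}\left[L(1/t)\,\mathbb{P}^x(T_B>t)\right]=K(x)-\mathbb{E}^xK(X_{T_B}),$$ and one can take $L(u)=\frac1\pi\int_{\psi^{-1}(u)}^\infty\frac{dr}{\psi(r)}$, $u>0$.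
   Context: $X=(X_t)_{t\ge0}$ has $\mathbb{E}e^{i\xi X_t}=e^{-t\psi(\xi)}$, $\psi(\xi)=\sigma^2\xi^2+\int_{\mathbb{R}}(1-\cos \xi x)\,\nu(dx)$, with $\nu$ a symmetric Lévy measure. $\mathbb{P}^x,\mathbb{E}^x$ refer to the process $x+X$. The integrability assumption is equivalent to $0$ being regular for $\{0\}$. $T_B=\inf\{t>0: X_t\in B\}$, and $\mathbb{E}^xK(X_{T_B})$ denotes $\mathbb{E}^x[T_B<\infty;K(X_{T_B})]$. Compensated potential kernel: $K(x)=\frac1\pi\int_0^\infty(1-\cos xs)\frac{ds}{\psi(s)}$, $x\in\mathbb{R}$. $\psi^*(x)=\sup_{|u|\le x}\psi(u)$ for $x\ge0$, and $\psi^{-1}(u)=\inf\{s\ge0:\psi^*(s)\ge u\}$ for $u\ge 0$. Regular variation of $\psi$ at $0$ with index $\delta$ means $\lim_{r\to0^+}\psi(ar)/\psi(r)=a^\delta$ for all $a>0$; slow variation is the case of index $0$. *)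

theory Defs
  imports "HOL-Probability.Probability"
begin

section \<open>Levy processes\<close>

definition cadlag :: "(real \<Rightarrow> real) \<Rightarrow> bool" where
  "cadlag w \<longleftrightarrow>
     (\<forall>t\<ge>0. (w \<longlongrightarrow> w t) (at_right t)) \<and>
     (\<forall>t>0. \<exists>l. (w \<longlongrightarrow> l) (at_left t))"

text \<open>Time runs through \<open>t \<ge> 0\<close>; values of \<open>X\<close> at negative times are irrelevant. Continuity in
  probability is not listed, as it follows from stationarity of the increments and right-continuity.\<close>

locale levy_process = prob_space M for M :: "'a measure" +
  fixes X :: "real \<Rightarrow> 'a \<Rightarrow> real"
  assumes random_variable_X: "\<And>t. t \<ge> 0 \<Longrightarrow> X t \<in> borel_measurable M"
    and AE_start: "AE \<omega> in M. X 0 \<omega> = 0"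
    and indep_increments: "\<And>n (\<tau> :: nat \<Rightarrow> real). 0 \<le> \<tau> 0 \<Longrightarrow> (\<And>i. i < n \<Longrightarrow> \<tau> i \<le> \<tau> (Suc i)) \<Longrightarrow>
          indep_vars (\<lambda>_. borel) (\<lambda>i \<omega>. X (\<tau> (Suc i)) \<omega> - X (\<tau> i) \<omega>) {..<n}"
    and stationary_increments: "\<And>s h. 0 \<le> s \<Longrightarrow> 0 \<le> h \<Longrightarrow>
          distr M borel (\<lambda>\<omega>. X (s + h) \<omega> - X s \<omega>) = distr M borel (X h)"
    and AE_cadlag: "AE \<omega> in M. cadlag (\<lambda>t. X t \<omega>)"

definition levy_measure :: "real measure \<Rightarrow> bool" where
  "levy_measure \<nu> \<longleftrightarrow>
     sets \<nu> = sets borel \<and> emeasure \<nu> {0} = 0 \<and> integrable \<nu> (\<lambda>x. min 1 (x\<^sup>2))"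

definition symmetric_measure :: "real measure \<Rightarrow> bool" where
  "symmetric_measure \<nu> \<longleftrightarrow> distr \<nu> borel uminus = \<nu>"

locale symmetric_levy_process = levy_process M X
  for M :: "'a measure" and X :: "real \<Rightarrow> 'a \<Rightarrow> real" +
  fixes \<sigma> :: real and \<nu> :: "real measure" and \<psi> :: "real \<Rightarrow> real"
  assumes levy_measure: "levy_measure \<nu>"
    and symmetric_measure: "symmetric_measure \<nu>"
    and levy_khintchine: "\<And>\<xi>. \<psi> \<xi> = \<sigma>\<^sup>2 * \<xi>\<^sup>2 + (\<integral>x. (1 - cos (\<xi> * x)) \<partial>\<nu>)"
    and char_exponent: "\<And>t \<xi>. 0 \<le> t \<Longrightarrow>
          char (distr M borel (X t)) \<xi> = complex_of_real (exp (- t * \<psi> \<xi>))"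

section \<open>Hitting times\<close>

definition hitting_time :: "real set \<Rightarrow> (real \<Rightarrow> real) \<Rightarrow> ereal" where
  "hitting_time B w = Inf {ereal t |t. 0 < t \<and> w t \<in> B}"

text \<open>Under \<open>P^x\<close> the process is \<open>x + X\<close>. Hitting times of closed sets are in general only
  measurable with respect to the completed sigma-algebra (debut theorem), so probabilities and
  expectations are taken in \<open>completion M\<close>, which is \<open>M\<close> itself if \<open>M\<close> is complete.\<close>

definition prob_hitting_time_gt ::
    "'a measure \<Rightarrow> (real \<Rightarrow> 'a \<Rightarrow> real) \<Rightarrow> real set \<Rightarrow> real \<Rightarrow> real \<Rightarrow> real" where
  "prob_hitting_time_gt M X B x t =
     measure (completion M) {\<omega> \<in> space M. hitting_time B (\<lambda>s. x + X s \<omega>) > ereal t}"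

definition expectation_at_hitting ::
    "'a measure \<Rightarrow> (real \<Rightarrow> 'a \<Rightarrow> real) \<Rightarrow> real set \<Rightarrow> (real \<Rightarrow> real) \<Rightarrow> real \<Rightarrow> real" where
  "expectation_at_hitting M X B f x =
     (\<integral>\<omega>. (let T = hitting_time B (\<lambda>s. x + X s \<omega>)
           in if T < \<infinity> then f (x + X (real_of_ereal T) \<omega>) else 0) \<partial>completion M)"

section \<open>Functionals of the characteristic exponent\<close>

definition compensated_kernel :: "(real \<Rightarrow> real) \<Rightarrow> real \<Rightarrow> real" where
  "compensated_kernel \<psi> x = 1 / pi * (LBINT s:{0<..}. (1 - cos (x * s)) / \<psi> s)"

definition sup_exponent :: "(real \<Rightarrow> real) \<Rightarrow> real \<Rightarrow> real" where
  "sup_exponent \<psi> x = (SUP u\<in>{u. \<bar>u\<bar> \<le> x}. \<psi> u)"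

definition inv_exponent :: "(real \<Rightarrow> real) \<Rightarrow> real \<Rightarrow> real" where
  "inv_exponent \<psi> u = Inf {s. 0 \<le> s \<and> sup_exponent \<psi> s \<ge> u}"

definition regularly_varying_at_0 :: "(real \<Rightarrow> real) \<Rightarrow> real \<Rightarrow> bool" where
  "regularly_varying_at_0 f \<rho> \<longleftrightarrow>
     (\<forall>a>0. ((\<lambda>r. f (a * r) / f r) \<longlongrightarrow> a powr \<rho>) (at_right 0))"

abbreviation slowly_varying_at_0 :: "(real \<Rightarrow> real) \<Rightarrow> bool" where
  "slowly_varying_at_0 f \<equiv> regularly_varying_at_0 f 0"

end

theory Submission
  imports Defs
begin

text \<open>
  Put \<open>G\<^sub>l y = \<integral>\<^sub>0\<^sup>\<infinity> cos (s y) / (l + \<psi> s) ds\<close>, a multiple of the resolvent density. Since \<open>0 \<in> B\<close>,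
  optional stopping gives \<open>G\<^sub>l x = E\<^sup>x [exp (- l T) G\<^sub>l (X\<^sub>T)]\<close> with \<open>T = T\<^sub>B\<close>. Subtracting from \<open>G\<^sub>l 0\<close> and letting
  \<open>l \<rightarrow> 0\<close> shows that \<open>G\<^sub>l 0 * (1 - E\<^sup>x exp (- l T))\<close> tends to \<open>\<pi> (K x - E\<^sup>x K (X\<^sub>T))\<close>. The second factor is
  \<open>l\<close> times the Laplace transform of \<open>P\<^sup>x (T > t)\<close>, so Karamata's Tauberian theorem yields the
  asymptotics of \<open>P\<^sup>x (T > t)\<close> from those of \<open>G\<^sub>l 0\<close>, which are regularly varying of index \<open>1 / \<delta> - 1\<close>.

  Optional stopping is proved without transition densities or a general strong Markov property:
  the indicator of a neighbourhood of \<open>0\<close> is replaced by a triangle function, whose cosine transform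
  is the integrable Fejer kernel, and hitting times are approximated along dyadic grids. Quasi-left
  continuity identifies the limit of the hitting times of shrinking neighbourhoods of \<open>B\<close> with \<open>T\<close>,
  which also gives the measurability of \<open>T\<close> with respect to the completion.
\<close>

section \<open>Karamata's Tauberian theorem\<close>

text \<open>The point \<open>0\<close> has to lie in \<open>B\<close> because the source of the
  resolvent sits at \<open>0\<close>: off \<open>B\<close> the function \<open>G\<^sub>l\<close> is
  then harmonic for the discounted process, and stopping gives an equality. As \<open>l\<close>
  tends to 0, \<open>G\<^sub>l 0\<close> may blow up while \<open>G\<^sub>l 0 - G\<^sub>l y\<close>
  stays bounded for \<open>y\<close> in a compact set; this is how \<open>K\<close> and the
  compactness of \<open>B\<close> enter. The obstacle on the analytic side is that regular variation
  is assumed pointwise in the scaling factor and \<open>\<psi>\<close> need not be monotone. The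
  missing uniformity is recovered from
  \<open>\<psi> (a + b) \<le> 2 * \<psi> a + 2 * \<psi> b\<close> and a category argument. On the
  probabilistic side, left limits exist at positive times only. Hitting is therefore counted from a
  time \<open>a > 0\<close> on, and \<open>a\<close> tends to 0 last. The constant in (i) combines
  the integral of \<open>1 / (1 + u powr \<delta>)\<close>, equal to
  \<open>pi / (\<delta> * sin (pi / \<delta>))\<close>, with the factor
  \<open>Gamma (1 / \<delta>)\<close> of the Tauberian theorem. For index 1 that integral diverges,
  and the tail integral of \<open>1 / \<psi>\<close> takes over.\<close>

lemma set_integrable_exp_neg: "set_integrable lborel {0<..} (\<lambda>t::real. exp (- t))"
  using integrable_I0i_exp_mscale[of 1] by simp

lemma set_integrable_exp_weighted:
  fixes f q :: "real \<Rightarrow> real"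
  assumes [measurable]: "f \<in> borel_measurable borel" "q \<in> borel_measurable borel"
    and f: "\<And>y. 0 \<le> y \<Longrightarrow> y \<le> 1 \<Longrightarrow> \<bar>f y\<bar> \<le> c" and q: "\<And>t. 0 < t \<Longrightarrow> \<bar>q t\<bar> \<le> d" and "0 \<le> c"
  shows "set_integrable lborel {0<..} (\<lambda>t. exp (- t) * f (exp (- t)) * q t)"
proof (rule set_integrable_bound[OF set_integrable_mult_right[OF set_integrable_exp_neg, of "c * d"]])
  show "set_borel_measurable lborel {0<..} (\<lambda>t. exp (- t) * f (exp (- t)) * q t)"
    unfolding set_borel_measurable_def by measurable
  have "norm (exp (- t) * f (exp (- t)) * q t) \<le> norm (c * d * exp (- t))" if "0 < t" for t
  proof -
    have "0 \<le> d" using q[OF that] by linarith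
    have "\<bar>f (exp (- t))\<bar> * \<bar>q t\<bar> \<le> c * d"
      using f[of "exp (- t)"] q[OF that] that \<open>0 \<le> c\<close> by (intro mult_mono) auto
    then have "exp (- t) * (\<bar>f (exp (- t))\<bar> * \<bar>q t\<bar>) \<le> exp (- t) * (c * d)"
      by (intro mult_left_mono) auto
    then show ?thesis using \<open>0 \<le> c\<close> \<open>0 \<le> d\<close> by (simp add: abs_mult mult_ac)
  qed
  then show "AE t in lborel. t \<in> {0<..} \<longrightarrow> norm (exp (- t) * f (exp (- t)) * q t) \<le> norm (c * d * exp (- t))"
    by auto
qed

lemma Gamma_lebesgue_integral:
  fixes \<rho> k :: real
  assumes "0 < \<rho>" "0 < k"
  shows "set_integrable lborel {0<..} (\<lambda>t. exp (- (k * t)) * t powr (\<rho> - 1))"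
    and "(LBINT t:{0<..}. exp (- (k * t)) * t powr (\<rho> - 1)) = Gamma \<rho> * k powr (- \<rho>)"
proof -
  have nn: "(\<integral>\<^sup>+t. ennreal (indicator {0..} t * t powr (\<rho> - 1) / exp t) \<partial>lborel) = ennreal (Gamma \<rho>)"
    using Gamma_conv_nn_integral_real[OF assms(1)] by simp
  have hb: "has_bochner_integral lborel (\<lambda>t. indicator {0..} t * t powr (\<rho> - 1) / exp t) (Gamma \<rho>)"
    by (rule has_bochner_integral_nn_integral[OF _ _ _ nn]) (use assms in \<open>auto intro: less_imp_le[OF Gamma_real_pos]\<close>)
  have "has_bochner_integral lborel (\<lambda>t. indicator {0..} (0 + k * t) * (0 + k * t) powr (\<rho> - 1) / exp (0 + k * t)) (Gamma \<rho> /\<^sub>R \<bar>k\<bar>)"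
    by (rule lborel_has_bochner_integral_real_affine_iff[THEN iffD1, OF _ hb]) (use assms in auto)
  \<comment> \<open>The factor \<open>k powr (1 - \<rho>)\<close> undoes the power of
    \<open>k\<close> that the substitution creates in
    \<open>(k * t) powr (\<rho> - 1)\<close>.\<close>
  then have hb2: "has_bochner_integral lborel (\<lambda>t. k powr (1 - \<rho>) * (indicator {0..} (0 + k * t) * (0 + k * t) powr (\<rho> - 1) / exp (0 + k * t))) (k powr (1 - \<rho>) * (Gamma \<rho> /\<^sub>R \<bar>k\<bar>))"
    by (intro has_bochner_integral_mult_right) auto
  have eq: "k powr (1 - \<rho>) * (indicator {0..} (0 + k * t) * (0 + k * t) powr (\<rho> - 1) / exp (0 + k * t))
     = indicator {0<..} t *\<^sub>R (exp (- (k * t)) * t powr (\<rho> - 1))" if "t \<noteq> 0" for t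
    using assms that
    by (auto simp: indicator_def powr_mult exp_minus field_simps zero_le_mult_iff powr_add[symmetric] powr_diff)
  have "k powr (1 - \<rho>) * (Gamma \<rho> /\<^sub>R \<bar>k\<bar>) = Gamma \<rho> * k powr (- \<rho>)"
    using assms by (simp add: powr_diff powr_minus divide_inverse)
  moreover have "has_bochner_integral lborel (\<lambda>t. indicator {0<..} t *\<^sub>R (exp (- (k * t)) * t powr (\<rho> - 1))) (k powr (1 - \<rho>) * (Gamma \<rho> /\<^sub>R \<bar>k\<bar>))"
  proof (rule has_bochner_integral_cong_AE[THEN iffD1, OF _ _ _ hb2])
    show "AE t in lborel. k powr (1 - \<rho>) * (indicator {0..} (0 + k * t) * (0 + k * t) powr (\<rho> - 1) / exp (0 + k * t))
     = indicator {0<..} t *\<^sub>R (exp (- (k * t)) * t powr (\<rho> - 1))"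
      using AE_lborel_singleton[of 0] by eventually_elim (rule eq)
  qed auto
  ultimately have "has_bochner_integral lborel (\<lambda>t. indicator {0<..} t *\<^sub>R (exp (- (k * t)) * t powr (\<rho> - 1))) (Gamma \<rho> * k powr (- \<rho>))"
    by (simp only:)
  then show "set_integrable lborel {0<..} (\<lambda>t. exp (- (k * t)) * t powr (\<rho> - 1))"
    and "(LBINT t:{0<..}. exp (- (k * t)) * t powr (\<rho> - 1)) = Gamma \<rho> * k powr (- \<rho>)"
    by (auto simp: has_bochner_integral_iff set_integrable_def set_lebesgue_integral_def)
qed

text \<open>Convergence on the powers of \<open>exp (- t)\<close> extends to all continuous functions of \<open>exp (- t)\<close>
  by the Weierstrass approximation theorem.\<close>

lemma laplace_weierstrass:
  fixes q :: "real \<Rightarrow> real \<Rightarrow> real" and q0 :: "real \<Rightarrow> real" and F :: "real filter"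
  assumes int: "\<And>l f. 0 < l \<Longrightarrow> continuous_on {0..1} f \<Longrightarrow>
                   set_integrable lborel {0<..} (\<lambda>t. exp (- t) * f (exp (- t)) * q l t)"
    and int0: "\<And>f. continuous_on {0..1} f \<Longrightarrow>
                   set_integrable lborel {0<..} (\<lambda>t. exp (- t) * f (exp (- t)) * q0 t)"
    and nonneg: "\<And>l t. 0 < l \<Longrightarrow> 0 < t \<Longrightarrow> 0 \<le> q l t" "\<And>t. 0 < t \<Longrightarrow> 0 \<le> q0 t"
    and lim: "\<And>k::nat. ((\<lambda>l. LBINT t:{0<..}. exp (- t) * exp (- t) ^ k * q l t) \<longlongrightarrow>
                    (LBINT t:{0<..}. exp (- t) * exp (- t) ^ k * q0 t)) (at_right 0)"
    and f: "continuous_on {0..1} f"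
  shows "((\<lambda>l. LBINT t:{0<..}. exp (- t) * f (exp (- t)) * q l t) \<longlongrightarrow>
                    (LBINT t:{0<..}. exp (- t) * f (exp (- t)) * q0 t)) (at_right 0)"
proof -
  define m where "m = (LBINT t:{0<..}. exp (- t) * q0 t)"
  have m0: "0 \<le> m"
    unfolding m_def set_lebesgue_integral_def by (rule Bochner_Integration.integral_nonneg) (auto simp: indicator_def nonneg)
  have l0: "((\<lambda>l. LBINT t:{0<..}. exp (- t) * q l t) \<longlongrightarrow> m) (at_right 0)"
    using lim[of 0] by (simp add: m_def)
  \<comment> \<open>Exchanging \<open>f\<close> for a function within \<open>e\<close> of it on the
    unit interval changes the integral by at most \<open>e\<close> times the total mass; the same
    bound serves every \<open>q l\<close> and the limit \<open>q0\<close>.\<close>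
  have bound: "\<bar>(LBINT t:{0<..}. exp (- t) * f (exp (- t)) * r t) - (LBINT t:{0<..}. exp (- t) * g (exp (- t)) * r t)\<bar>
       \<le> e * (LBINT t:{0<..}. exp (- t) * r t)"
    if I: "\<And>f. continuous_on {0..1} f \<Longrightarrow> set_integrable lborel {0<..} (\<lambda>t. exp (- t) * f (exp (- t)) * r t)"
      and r: "\<And>t. 0 < t \<Longrightarrow> 0 \<le> r t" and g: "continuous_on {0..1} g"
      and e: "\<And>x. 0 \<le> x \<Longrightarrow> x \<le> 1 \<Longrightarrow> \<bar>f x - g x\<bar> \<le> e" for r g :: "real \<Rightarrow> real" and e
  proof -
    have I1: "set_integrable lborel {0<..} (\<lambda>t. exp (- t) * r t)" using I[of "\<lambda>_. 1"] by simp
    have "(LBINT t:{0<..}. exp (- t) * f (exp (- t)) * r t) - (LBINT t:{0<..}. exp (- t) * g (exp (- t)) * r t)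
      = (LBINT t:{0<..}. exp (- t) * (f (exp (- t)) - g (exp (- t))) * r t)"
      by (subst set_integral_diff(2)[symmetric]) (use I f g in \<open>auto simp: algebra_simps\<close>)
    also have "\<bar>\<dots>\<bar> \<le> (LBINT t:{0<..}. e * (exp (- t) * r t))"
    proof -
      have J: "set_integrable lborel {0<..} (\<lambda>t. exp (- t) * (f (exp (- t)) - g (exp (- t))) * r t)"
        using I[of "\<lambda>x. f x - g x"] f g by (auto intro: continuous_intros)
      have "\<bar>exp (- t) * (f (exp (- t)) - g (exp (- t))) * r t\<bar> \<le> e * (exp (- t) * r t)" if "0 < t" for t
        using mult_right_mono[OF e[of "exp (- t)"], of "exp (- t) * r t"] r[OF that] that
        by (simp add: abs_mult mult_ac)
      moreover have "set_integrable lborel {0<..} (\<lambda>t. e * (exp (- t) * r t))" using I1 by simp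
      ultimately show ?thesis
        using J unfolding set_lebesgue_integral_def set_integrable_def
        by (intro integral_abs_bound_integral) (auto simp: indicator_def)
    qed
    also have "\<dots> = e * (LBINT t:{0<..}. exp (- t) * r t)"
      by (rule set_integral_mult_right) 
    finally show ?thesis .
  qed
  show ?thesis
  proof (rule tendstoI)
    fix e :: real assume "0 < e"
    \<comment> \<open>The budget \<open>e\<close> is spent three times: on replacing
      \<open>f\<close> by the polynomial under \<open>q l\<close>, whose mass is eventually below
      \<open>m + 1\<close>, on the same replacement under \<open>q0\<close>, whose mass is
      \<open>m\<close>, and on the convergence for the polynomial itself.\<close>
    define d where "d = e / (3 * (m + 1))"
    have "0 < d" using \<open>0 < e\<close> m0 by (auto simp: d_def)
    obtain g where "real_polynomial_function g" and gd: "\<And>x. x \<in> {0..1} \<Longrightarrow> \<bar>f x - g x\<bar> < d"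
      using Stone_Weierstrass_real_polynomial_function[OF compact_Icc f \<open>0 < d\<close>] by blast
    then obtain a n where g: "g = (\<lambda>x. \<Sum>i\<le>n. a i * x ^ i)"
      using real_polynomial_function_iff_sum by blast
    have contg: "continuous_on {0..1} g" unfolding g by (intro continuous_intros)
    have sum: "(LBINT t:{0<..}. exp (- t) * g (exp (- t)) * r t)
        = (\<Sum>i\<le>n. a i * (LBINT t:{0<..}. exp (- t) * exp (- t) ^ i * r t))"
      if I: "\<And>f. continuous_on {0..1} f \<Longrightarrow> set_integrable lborel {0<..} (\<lambda>t. exp (- t) * f (exp (- t)) * r t)"
      for r :: "real \<Rightarrow> real"
    proof -
      have "(LBINT t:{0<..}. exp (- t) * g (exp (- t)) * r t)
        = (LBINT t:{0<..}. \<Sum>i\<le>n. a i * (exp (- t) * exp (- t) ^ i * r t))"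
        by (simp add: g sum_distrib_left sum_distrib_right algebra_simps)
      also have "\<dots> = (\<Sum>i\<le>n. LBINT t:{0<..}. a i * (exp (- t) * exp (- t) ^ i * r t))"
        unfolding set_lebesgue_integral_def scaleR_sum_right
        by (rule Bochner_Integration.integral_sum)
           (intro set_integrable_mult_right[unfolded set_integrable_def] I[unfolded set_integrable_def] continuous_intros)
      finally show ?thesis by simp
    qed
    have "((\<lambda>l. \<Sum>i\<le>n. a i * (LBINT t:{0<..}. exp (- t) * exp (- t) ^ i * q l t)) \<longlongrightarrow>
        (\<Sum>i\<le>n. a i * (LBINT t:{0<..}. exp (- t) * exp (- t) ^ i * q0 t))) (at_right 0)"
      by (intro tendsto_intros lim)
    then have "\<forall>\<^sub>F l in at_right 0. dist (\<Sum>i\<le>n. a i * (LBINT t:{0<..}. exp (- t) * exp (- t) ^ i * q l t))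
        (\<Sum>i\<le>n. a i * (LBINT t:{0<..}. exp (- t) * exp (- t) ^ i * q0 t)) < d"
      by (rule tendstoD) fact
    moreover have "\<forall>\<^sub>F l in at_right 0. (LBINT t:{0<..}. exp (- t) * q l t) < m + 1"
      by (rule order_tendstoD(2)[OF l0]) simp
    moreover have "\<forall>\<^sub>F l in at_right (0::real). 0 < l" by (simp add: eventually_at_right_less)
    ultimately show "\<forall>\<^sub>F l in at_right 0. dist (LBINT t:{0<..}. exp (- t) * f (exp (- t)) * q l t)
       (LBINT t:{0<..}. exp (- t) * f (exp (- t)) * q0 t) < e"
    proof eventually_elim
      case (elim l)
      note s = sum[OF int[OF elim(3)]] sum[OF int0]
      have A: "\<bar>(LBINT t:{0<..}. exp (- t) * f (exp (- t)) * q l t) - (LBINT t:{0<..}. exp (- t) * g (exp (- t)) * q l t)\<bar>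
         \<le> d * (LBINT t:{0<..}. exp (- t) * q l t)"
        using gd by (intro bound int elim nonneg contg) (auto intro: less_imp_le)
      have B: "\<bar>(LBINT t:{0<..}. exp (- t) * f (exp (- t)) * q0 t) - (LBINT t:{0<..}. exp (- t) * g (exp (- t)) * q0 t)\<bar> \<le> d * m"
        unfolding m_def using gd by (intro bound int0 nonneg contg) (auto intro: less_imp_le)
      have "d * (LBINT t:{0<..}. exp (- t) * q l t) \<le> d * (m + 1)"
        using elim \<open>0 < d\<close> by (intro mult_left_mono) auto
      moreover have "d * m < d * (m + 1)" using \<open>0 < d\<close> by simp
      moreover have "d \<le> d * (m + 1)" using \<open>0 < d\<close> m0 by simp
      moreover have "3 * (d * (m + 1)) = e" using m0 by (simp add: d_def field_simps)
      ultimately show ?case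
        using A B elim(1) s unfolding dist_real_def by linarith
    qed
  qed
qed

text \<open>The measures with density \<open>H l * p (t / l)\<close> converge against functions of \<open>exp (- t)\<close>;
  monotonicity of \<open>p\<close> turns this into convergence of the density at \<open>t = 1\<close>.\<close>

theorem laplace_tauberian_monotone:
  fixes p H :: "real \<Rightarrow> real" and \<rho> C :: real
  assumes anti: "\<And>s t. 0 \<le> s \<Longrightarrow> s \<le> t \<Longrightarrow> p t \<le> p s"
    and p01: "\<And>t. 0 \<le> p t" "\<And>t. p t \<le> 1"
    and [measurable]: "p \<in> borel_measurable borel"
    and H: "\<And>l. 0 < l \<Longrightarrow> 0 < H l"
    and \<rho>: "0 < \<rho>" "\<rho> \<le> 1"
    and Hrv: "\<And>k::nat. (0::nat) < k \<Longrightarrow> ((\<lambda>l. H (real k * l) / H l) \<longlongrightarrow> real k powr (\<rho> - 1)) (at_right 0)"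
    and lim: "((\<lambda>l. H l * (l * (LBINT t:{0<..}. exp (- (l * t)) * p t))) \<longlongrightarrow> C) (at_right 0)"
  shows "((\<lambda>t. H (1 / t) * p t) \<longlongrightarrow> C / Gamma \<rho>) at_top"
proof -
  define c where "c = C / Gamma \<rho>"
  have "0 \<le> C"
  proof (rule tendsto_lowerbound[OF lim])
    show "\<forall>\<^sub>F l in at_right 0. 0 \<le> H l * (l * (LBINT t:{0<..}. exp (- (l * t)) * p t))"
      using eventually_at_right_less[of "0::real"]
    proof eventually_elim
      case (elim l)
      then show ?case
        by (intro mult_nonneg_nonneg less_imp_le[OF H])
           (auto simp: set_lebesgue_integral_def p01 intro!: Bochner_Integration.integral_nonneg)
    qed
  qed simp
  then have c0: "0 \<le> c" using \<rho> by (auto simp: c_def intro!: divide_nonneg_pos Gamma_real_pos)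
  \<comment> \<open>After the substitution \<open>t / l\<close> the hypothesis \<open>lim\<close>
    speaks of the integral of \<open>exp (- t)\<close> against the density \<open>q l\<close>; the
    candidate limit density is \<open>q0\<close>.\<close>
  define q where "q l t = H l * p (t / l)" for l t
  define q0 where "q0 t = c * t powr (\<rho> - 1)" for t
  \<comment> \<open>Test functions are continuous on the unit interval only, where
    \<open>exp (- t)\<close> takes its values; cutting them off outside gives a bounded Borel
    function with the same integrals.\<close>
  have f_ex: "\<exists>f' K. f' \<in> borel_measurable borel \<and> 0 \<le> K \<and> (\<forall>y. 0 \<le> y \<longrightarrow> y \<le> 1 \<longrightarrow> f' y = f y \<and> \<bar>f' y\<bar> \<le> K)"
    if f: "continuous_on {0..1} f" for f :: "real \<Rightarrow> real"
  proof -
    have "bounded (f ` {0..1})" by (intro compact_imp_bounded compact_continuous_image f compact_Icc)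
    then obtain K where K: "0 < K" "\<forall>y\<in>{0..1}. norm (f y) \<le> K" by (auto simp: bounded_pos)
    have "(\<lambda>y. indicator {0..1} y * f y) \<in> borel_measurable borel"
      using borel_measurable_continuous_on_indicator[OF _ f] by simp
    then show ?thesis using K by (intro exI[of _ "\<lambda>y. indicator {0..1} y * f y"] exI[of _ K]) auto
  qed
  have int: "set_integrable lborel {0<..} (\<lambda>t. exp (- t) * f (exp (- t)) * q l t)"
    if l: "0 < l" and f: "continuous_on {0..1} f" for l f
  proof -
    obtain f' K where [measurable]: "f' \<in> borel_measurable borel" and K: "0 \<le> K"
      and f': "\<And>y. 0 \<le> y \<Longrightarrow> y \<le> 1 \<Longrightarrow> f' y = f y \<and> \<bar>f' y\<bar> \<le> K" using f_ex[OF f] by blast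
    have "set_integrable lborel {0<..} (\<lambda>t. exp (- t) * f' (exp (- t)) * q l t)"
      by (rule set_integrable_exp_weighted[where c = K and d = "H l"])
         (use K H[OF l] p01 in \<open>auto simp: q_def abs_mult mult_le_cancel_left1 intro: f'[THEN conjunct2]\<close>)
    then show ?thesis
      by (rule set_integrable_cong[THEN iffD1, rotated -1]) (auto simp: f')
  qed
  have int0: "set_integrable lborel {0<..} (\<lambda>t. exp (- t) * f (exp (- t)) * q0 t)"
    if f: "continuous_on {0..1} f" for f
  proof -
    obtain f' K where [measurable]: "f' \<in> borel_measurable borel" and K: "0 \<le> K"
      and f': "\<And>y. 0 \<le> y \<Longrightarrow> y \<le> 1 \<Longrightarrow> f' y = f y \<and> \<bar>f' y\<bar> \<le> K" using f_ex[OF f] by blast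
    have "set_integrable lborel {0<..} (\<lambda>t. exp (- t) * f' (exp (- t)) * q0 t)"
    proof (rule set_integrable_bound[OF set_integrable_mult_right[OF Gamma_lebesgue_integral(1)[OF \<rho>(1), of 1], of "K * c"]])
      show "set_borel_measurable lborel {0<..} (\<lambda>t. exp (- t) * f' (exp (- t)) * q0 t)"
        unfolding set_borel_measurable_def q0_def by measurable
      have "norm (exp (- t) * f' (exp (- t)) * q0 t) \<le> norm (K * c * (exp (- (1 * t)) * t powr (\<rho> - 1)))"
        if "0 < t" for t
      proof -
        have "\<bar>f' (exp (- t))\<bar> * (exp (- t) * c * t powr (\<rho> - 1)) \<le> K * (exp (- t) * c * t powr (\<rho> - 1))"
          using f'[of "exp (- t)"] c0 that by (intro mult_right_mono) auto
        then show ?thesis using c0 K by (simp add: q0_def abs_mult mult_ac)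
      qed
      then show "AE t in lborel. t \<in> {0<..} \<longrightarrow> norm (exp (- t) * f' (exp (- t)) * q0 t)
          \<le> norm (K * c * (exp (- (1 * t)) * t powr (\<rho> - 1)))" by auto
    qed simp
    then show ?thesis
      by (rule set_integrable_cong[THEN iffD1, rotated -1]) (auto simp: f')
  qed
  \<comment> \<open>The power \<open>exp (- t) ^ k\<close> turns the weight into
    \<open>exp (- ((k + 1) * t))\<close>, so the integral is the Laplace transform at
    \<open>(k + 1) * l\<close>. This is why regular variation of \<open>H\<close> along integer
    factors suffices.\<close>
  have mono: "((\<lambda>l. LBINT t:{0<..}. exp (- t) * exp (- t) ^ k * q l t) \<longlongrightarrow>
                    (LBINT t:{0<..}. exp (- t) * exp (- t) ^ k * q0 t)) (at_right 0)" for k :: nat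
  proof -
    define G where "G l = H l * (l * (LBINT t:{0<..}. exp (- (l * t)) * p t))" for l
    let ?K = "real (Suc k)"
    have eq: "exp (- t) * exp (- t) ^ k = exp (- (?K * t))" for t :: real
      by (simp add: exp_of_nat_mult[symmetric] exp_add[symmetric] algebra_simps)
    have lhs: "(LBINT t:{0<..}. exp (- t) * exp (- t) ^ k * q l t) = G (?K * l) / (?K * (H (?K * l) / H l))"
      if l: "0 < l" for l
    proof -
      have "(LBINT t:{0<..}. exp (- t) * exp (- t) ^ k * q l t)
         = H l * (\<integral>t. indicator {0<..} t * (exp (- (?K * t)) * p (t / l)) \<partial>lborel)"
        unfolding eq q_def set_lebesgue_integral_def
        by (subst Bochner_Integration.integral_mult_right_zero[symmetric]) (simp add: mult_ac)
      also have "(\<integral>t. indicator {0<..} t * (exp (- (?K * t)) * p (t / l)) \<partial>lborel)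
         = l * (\<integral>t. indicator {0<..} t * (exp (- (?K * l * t)) * p t) \<partial>lborel)"
        by (subst lborel_integral_real_affine[where c = l and t = 0])
           (use l in \<open>auto simp: indicator_def zero_less_mult_iff mult_ac intro!: Bochner_Integration.integral_cong\<close>)
      finally show ?thesis
        using l H[of "?K * l"] H[OF l] unfolding G_def set_lebesgue_integral_def
        by (simp add: field_simps del: of_nat_Suc)
    qed
    have "filterlim (\<lambda>l. ?K * l) (at_right 0) (at_right 0)"
      by (rule filterlim_times_pos[of "\<lambda>x. x" 0 _ ?K 0]) (auto simp: filterlim_ident)
    then have GK: "((\<lambda>l. G (?K * l)) \<longlongrightarrow> C) (at_right 0)"
      using filterlim_compose[OF lim[folded G_def]] by blast
    have "((\<lambda>l. G (?K * l) / (?K * (H (?K * l) / H l))) \<longlongrightarrow> C / (?K * ?K powr (\<rho> - 1))) (at_right 0)"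
      by (intro tendsto_divide GK tendsto_mult tendsto_const Hrv) auto
    also have "C / (?K * ?K powr (\<rho> - 1)) = C * ?K powr (- \<rho>)"
      by (simp add: powr_diff powr_minus field_simps del: of_nat_Suc)
    also have "\<dots> = c * (LBINT t:{0<..}. exp (- (?K * t)) * t powr (\<rho> - 1))"
      using \<rho> less_imp_neq[OF Gamma_real_pos[OF \<rho>(1)]] by (simp add: Gamma_lebesgue_integral(2) c_def)
    also have "\<dots> = (LBINT t:{0<..}. exp (- t) * exp (- t) ^ k * q0 t)"
      unfolding eq q0_def by (subst set_integral_mult_right[symmetric]) (simp add: mult_ac)
    finally show ?thesis
      by (rule Lim_transform_eventually)
         (use lhs in \<open>auto simp: eventually_at_right_less[of "0::real", THEN eventually_mono]\<close>)
  qed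
  note W = laplace_weierstrass[of q q0, OF int int0 _ _ mono]
  have q_nonneg: "0 \<le> q l t" if "0 < l" for l t using H[OF that] p01 by (auto simp: q_def)
  have q0_nonneg: "0 \<le> q0 t" for t using c0 by (auto simp: q0_def)
  \<comment> \<open>A positive bump on \<open>(a, b)\<close>, normalised to mass 1, averages the
    decreasing functions \<open>q l\<close> and \<open>q0\<close>, so each average lies between the
    values at the end points. Convergence is known for averages only; the sandwich passes it on to
    point values.\<close>
  have tent: "\<exists>\<phi> L. (\<phi> \<longlongrightarrow> L) (at_right 0) \<and> L \<le> a powr (\<rho> - 1) * c \<and> b powr (\<rho> - 1) * c \<le> L \<and>
       (\<forall>l>0. q l b \<le> \<phi> l \<and> \<phi> l \<le> q l a)" if ab: "0 < a" "a < b" for a b :: real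
  proof -
    \<comment> \<open>As a function of \<open>y = exp (- t)\<close> the bump is the positive part of
      a parabola with zeros \<open>exp (- b)\<close> and \<open>exp (- a)\<close>, hence continuous
      on the unit interval and supported between them.\<close>
    define g where "g y = max 0 ((y - exp (- b)) * (exp (- a) - y))" for y :: real
    have contg: "continuous_on {0..1} g" unfolding g_def by (intro continuous_intros)
    define I where "I = (LBINT t:{0<..}. exp (- t) * g (exp (- t)))"
    have I_int: "set_integrable lborel {0<..} (\<lambda>t. exp (- t) * g (exp (- t)))"
    proof -
      have [measurable]: "g \<in> borel_measurable borel" unfolding g_def by measurable
      obtain K where "0 \<le> K" "\<And>y. 0 \<le> y \<Longrightarrow> y \<le> 1 \<Longrightarrow> \<bar>g y\<bar> \<le> K" using f_ex[OF contg] by metis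
      then show ?thesis
        using set_integrable_exp_weighted[of g "\<lambda>_. 1" K 1] by simp
    qed
    have gz: "g (exp (- t)) = 0" if "\<not> (a < t \<and> t < b)" for t
    proof -
      have "(exp (- t) - exp (- b)) * (exp (- a) - exp (- t)) \<le> 0"
        using that ab by (auto simp: not_less mult_le_0_iff)
      then show ?thesis by (simp add: g_def)
    qed
    have gpos: "g (exp (- t)) > 0" if "a < t" "t < b" for t
      using that by (auto simp: g_def less_max_iff_disj intro!: mult_pos_pos)
    have gnn: "0 \<le> g y" for y by (simp add: g_def)
    have "0 < I"
    proof -
      have "0 \<le> I" unfolding I_def set_lebesgue_integral_def
        by (rule Bochner_Integration.integral_nonneg) (auto simp: gnn)
      moreover have "I \<noteq> 0"
      proof
        assume "I = 0"
        then have "AE t in lborel. indicator {0<..} t *\<^sub>R (exp (- t) * g (exp (- t))) = 0"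
          using I_int unfolding I_def set_lebesgue_integral_def set_integrable_def
          by (subst (asm) integral_nonneg_eq_0_iff_AE) (auto simp: gnn)
        then have "AE t in lborel. \<not> (a < t \<and> t < b)"
          by eventually_elim (use gpos ab in \<open>force simp: indicator_def\<close>)
        then have "AE t in lborel. t \<notin> {a<..<b}" by eventually_elim auto
        then have "emeasure lborel {x. a < x \<and> x < b} = 0" by (subst (asm) AE_iff_measurable[OF _ refl]) auto
        moreover have "{a<..<b} = {x. a < x \<and> x < b}" by auto
        ultimately show False using ab by (metis (no_types) emeasure_lborel_Ioo ennreal_eq_0_iff diff_gt_0_iff_gt less_imp_le not_le)
      qed
      ultimately show ?thesis by simp
    qed
    have gi: "(LBINT t:{0<..}. exp (- t) * g (exp (- t)) * K) = I * K" for K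
      unfolding I_def by (rule set_integral_mult_left)
    have cmp: "(LBINT t:{0<..}. exp (- t) * g (exp (- t)) * r t) \<le> (LBINT t:{0<..}. exp (- t) * g (exp (- t)) * r' t)"
      if "set_integrable lborel {0<..} (\<lambda>t. exp (- t) * g (exp (- t)) * r t)"
         "set_integrable lborel {0<..} (\<lambda>t. exp (- t) * g (exp (- t)) * r' t)"
         "\<And>t. a < t \<Longrightarrow> t < b \<Longrightarrow> r t \<le> r' t" for r r'
    proof (rule set_integral_mono[OF that(1,2)])
      fix t :: real
      show "exp (- t) * g (exp (- t)) * r t \<le> exp (- t) * g (exp (- t)) * r' t"
        using that(3)[of t] gz[of t] gnn by (cases "a < t \<and> t < b") (auto intro!: mult_left_mono)
    qed
    have Kint: "set_integrable lborel {0<..} (\<lambda>t. exp (- t) * g (exp (- t)) * K)" for K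
      using I_int by (intro set_integrable_mult_left) auto
    define \<phi> where "\<phi> l = (LBINT t:{0<..}. exp (- t) * g (exp (- t)) * q l t) / I" for l
    define L where "L = (LBINT t:{0<..}. exp (- t) * g (exp (- t)) * q0 t) / I"
    have "(\<phi> \<longlongrightarrow> L) (at_right 0)"
      unfolding \<phi>_def L_def using \<open>0 < I\<close>
      by (intro tendsto_divide W tendsto_const contg q_nonneg q0_nonneg) auto
    moreover have "L \<le> a powr (\<rho> - 1) * c"
    proof -
      have "q0 t \<le> a powr (\<rho> - 1) * c" if "a < t" for t
        using c0 ab \<rho> that by (auto simp: q0_def mult.commute[of c] intro!: mult_right_mono powr_mono2')
      then show ?thesis
        using cmp[OF int0[OF contg] Kint[of "a powr (\<rho> - 1) * c"]] \<open>0 < I\<close>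
        by (simp only: gi L_def) (simp add: field_simps)
    qed
    moreover have "b powr (\<rho> - 1) * c \<le> L"
    proof -
      have "b powr (\<rho> - 1) * c \<le> q0 t" if "a < t" "t < b" for t
        using c0 ab \<rho> that by (auto simp: q0_def mult.commute[of c] intro!: mult_right_mono powr_mono2')
      then show ?thesis
        using cmp[OF Kint[of "b powr (\<rho> - 1) * c"] int0[OF contg]] \<open>0 < I\<close>
        by (simp only: gi L_def) (simp add: field_simps)
    qed
    moreover have "q l b \<le> \<phi> l \<and> \<phi> l \<le> q l a" if l: "0 < l" for l
    proof -
      have q_anti: "q l t \<le> q l s" if "0 < s" "s \<le> t" for s t
        using H[OF l] l that unfolding q_def by (intro mult_left_mono anti) (auto intro: divide_right_mono)
      have "(LBINT t:{0<..}. exp (- t) * g (exp (- t)) * q l t) \<le> I * q l a"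
        using cmp[OF int[OF l contg] Kint[of "q l a"]] q_anti ab by (simp only: gi)
      moreover have "I * q l b \<le> (LBINT t:{0<..}. exp (- t) * g (exp (- t)) * q l t)"
        using cmp[OF Kint[of "q l b"] int[OF l contg]] q_anti ab by (simp only: gi)
      ultimately show ?thesis using \<open>0 < I\<close> by (simp add: \<phi>_def field_simps)
    qed
    ultimately show ?thesis by blast
  qed
  \<comment> \<open>Averages over \<open>(1, b)\<close> bound \<open>q l 1\<close> from below and
    averages over \<open>(b, 1)\<close> bound it from above; both bounds tend to \<open>c\<close> as
    \<open>b\<close> tends to 1.\<close>
  have "((\<lambda>l. q l 1) \<longlongrightarrow> c) (at_right 0)"
  proof (rule order_tendstoI)
    fix e assume "e < c"
    have "((\<lambda>b. b powr (\<rho> - 1) * c) \<longlongrightarrow> 1 powr (\<rho> - 1) * c) (at_right 1)"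
      by (intro tendsto_intros) auto
    then have "\<forall>\<^sub>F b in at_right 1. e < b powr (\<rho> - 1) * c" using \<open>e < c\<close> by (auto dest: order_tendstoD)
    then have "\<forall>\<^sub>F b in at_right (1::real). e < b powr (\<rho> - 1) * c \<and> 1 < b"
      by (intro eventually_conj eventually_at_right_less)
    then obtain b where b: "e < b powr (\<rho> - 1) * c" "1 < b"
      using eventually_happens trivial_limit_at_right_real by blast
    obtain \<phi> L where \<phi>: "(\<phi> \<longlongrightarrow> L) (at_right 0)" "b powr (\<rho> - 1) * c \<le> L" "\<forall>l>0. q l b \<le> \<phi> l \<and> \<phi> l \<le> q l 1"
      using tent[of 1 b] b by auto
    have "\<forall>\<^sub>F l in at_right 0. e < \<phi> l" using \<phi> b by (intro order_tendstoD(1)[OF \<phi>(1)]) auto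
    then show "\<forall>\<^sub>F l in at_right 0. e < q l 1"
      using eventually_at_right_less[of "0::real"] by eventually_elim (use \<phi>(3) in force)
  next
    fix e assume "c < e"
    have "((\<lambda>b. b powr (\<rho> - 1) * c) \<longlongrightarrow> 1 powr (\<rho> - 1) * c) (at_left 1)"
      by (intro tendsto_intros) auto
    then have "\<forall>\<^sub>F b in at_left 1. b powr (\<rho> - 1) * c < e" using \<open>c < e\<close> by (auto dest: order_tendstoD)
    moreover have "\<forall>\<^sub>F b in at_left (1::real). b \<in> {0<..<1}" by (rule eventually_at_leftI[of 0]) auto
    ultimately have "\<forall>\<^sub>F b in at_left (1::real). b powr (\<rho> - 1) * c < e \<and> b \<in> {0<..<1}"
      by (rule eventually_conj)
    then obtain b where b: "b powr (\<rho> - 1) * c < e" "0 < b" "b < 1"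
      using eventually_happens[of _ "at_left (1::real)"] trivial_limit_at_left_real by auto
    obtain \<phi> L where \<phi>: "(\<phi> \<longlongrightarrow> L) (at_right 0)" "L \<le> b powr (\<rho> - 1) * c" "\<forall>l>0. q l 1 \<le> \<phi> l \<and> \<phi> l \<le> q l b"
      using tent[of b 1] b by auto
    have "\<forall>\<^sub>F l in at_right 0. \<phi> l < e" using \<phi> b by (intro order_tendstoD(2)[OF \<phi>(1)]) auto
    then show "\<forall>\<^sub>F l in at_right 0. q l 1 < e"
      using eventually_at_right_less[of "0::real"] by eventually_elim (use \<phi>(3) in force)
  qed
  then have "((\<lambda>t. q (inverse t) 1) \<longlongrightarrow> c) at_top"
    by (rule filterlim_compose[OF _ filterlim_inverse_at_right_top])
  then show ?thesis
    by (simp add: q_def c_def inverse_eq_divide)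
qed

section \<open>The Fejer kernel\<close>

lemma one_minus_cos_le_square: "1 - cos x \<le> x\<^sup>2 / 2" for x :: real
proof -
  have "1 - cos x = 2 * (sin (x / 2))\<^sup>2" using cos_double_sin[of "x/2"] by simp
  also have "\<dots> \<le> 2 * (x / 2)\<^sup>2"
    using abs_sin_x_le_abs_x[of "x/2"] by (intro mult_left_mono) (auto simp: abs_le_square_iff[symmetric])
  finally show ?thesis by (simp add: power2_eq_square)
qed

text \<open>The factor \<open>min 1 (s\<^sup>2)\<close> is the integrand in the definition of a Levy
  measure, so this one bound serves the Levy-Khintchine integral, the kernel \<open>K\<close> and
  the Fejer kernel alike.\<close>

lemma one_minus_cos_le: "1 - cos (a * s) \<le> max 2 (a\<^sup>2 / 2) * min 1 (s\<^sup>2)" for a s :: real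
proof -
  have "1 - cos (a * s) \<le> 2" using cos_ge_minus_one[of "a * s"] by linarith
  moreover have "1 - cos (a * s) \<le> a\<^sup>2 / 2 * s\<^sup>2"
    using one_minus_cos_le_square[of "a * s"] by (simp add: power_mult_distrib)
  moreover have "a\<^sup>2 / 2 * s\<^sup>2 \<le> max 2 (a\<^sup>2 / 2) * s\<^sup>2" by (intro mult_right_mono) auto
  moreover have "2 \<le> max 2 (a\<^sup>2 / 2)" by simp
  moreover have "min 1 (s\<^sup>2) = 1 \<or> min 1 (s\<^sup>2) = s\<^sup>2" by (simp add: min_def)
  ultimately show ?thesis by (metis (no_types, lifting) mult.right_neutral order_trans)
qed

lemma set_integrable_min_one_inverse_square:
  "set_integrable lborel {0<..} (\<lambda>s::real. min 1 (1 / s\<^sup>2))"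
proof -
  have 1: "set_integrable lborel {1..} (\<lambda>s::real. 1 / s\<^sup>2)"
  proof -
    have "((\<lambda>s::real. - 1 / s) \<longlongrightarrow> 0) at_top"
      by (intro tendsto_divide_0[OF tendsto_const] filterlim_at_top_imp_at_infinity filterlim_ident)
    moreover have "DERIV (\<lambda>s. - 1 / s) x :> 1 / x\<^sup>2" if "1 \<le> x" for x :: real
      using that by (auto intro!: derivative_eq_intros simp: power2_eq_square)
    ultimately have "(\<integral>\<^sup>+s. ennreal (1 / s\<^sup>2) * indicator {1..} s \<partial>lborel) = ennreal (0 - (- 1 / 1))"
      by (intro nn_integral_FTC_atLeast) auto
    then have "integrable lborel (\<lambda>s::real. 1 / s\<^sup>2 * indicator {1..} s)"
      by (intro integrableI_nonneg) (auto simp: ennreal_mult' ennreal_indicator simp flip: times_divide_eq_left)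
    then show ?thesis by (simp add: set_integrable_def mult.commute)
  qed
  have 2: "set_integrable lborel {0..1} (\<lambda>s::real. min 1 (1 / s\<^sup>2))"
    by (rule set_integrable_bound[of _ _ "\<lambda>_. 1::real"])
       (auto simp: set_integrable_def set_borel_measurable_def)
  have 3: "set_integrable lborel {1..} (\<lambda>s::real. min 1 (1 / s\<^sup>2))"
    by (rule set_integrable_bound[OF 1]) (auto simp: set_borel_measurable_def)
  have "set_integrable lborel ({0..1} \<union> {1..}) (\<lambda>s::real. min 1 (1 / s\<^sup>2))"
    by (rule set_integrable_Un[OF 2 3]) auto
  then show ?thesis by (rule set_integrable_subset) auto
qed

lemma set_integrable_one_minus_cos_over_square:
  "set_integrable lborel {0<..} (\<lambda>s. (1 - cos (a * s)) / s\<^sup>2)" for a :: real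
proof (rule set_integrable_bound[OF set_integrable_mult_right[OF set_integrable_min_one_inverse_square]])
  show "set_borel_measurable lborel {0<..} (\<lambda>s. (1 - cos (a * s)) / s\<^sup>2)"
    by (simp add: set_borel_measurable_def)
  have "norm ((1 - cos (a * s)) / s\<^sup>2) \<le> norm (max 2 (a\<^sup>2 / 2) * min 1 (1 / s\<^sup>2))" if "0 < s" for s
  proof -
    have "(1 - cos (a * s)) / s\<^sup>2 \<le> max 2 (a\<^sup>2 / 2) * min 1 (s\<^sup>2) / s\<^sup>2"
      by (intro divide_right_mono one_minus_cos_le) auto
    also have "\<dots> = max 2 (a\<^sup>2 / 2) * min 1 (1 / s\<^sup>2)"
      using that by (simp add: min_def field_simps)
    finally show ?thesis by (simp add: abs_mult)
  qed
  then show "AE s in lborel. s \<in> {0<..} \<longrightarrow>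
      norm ((1 - cos (a * s)) / s\<^sup>2) \<le> norm (max 2 (a\<^sup>2 / 2) * min 1 (1 / s\<^sup>2))" by auto
qed

text \<open>Integration by parts leads to the Dirichlet integral: the antiderivative is
  \<open>a * Si (a * s) - (1 - cos (a * s)) / s\<close>, and \<open>Si\<close> tends to
  \<open>pi / 2\<close>. The modulus in the result is what lets second differences vanish for the
  Fejer kernel.\<close>

lemma integral_one_minus_cos_over_square:
  "(LBINT s:{0<..}. (1 - cos (a * s)) / s\<^sup>2) = pi / 2 * \<bar>a\<bar>" for a :: real
proof -
  have Si0: "Si 0 = 0" by (simp add: Si_def flip: zero_ereal_def)
  have pos: "(LBINT s:{0<..}. (1 - cos (a * s)) / s\<^sup>2) = pi / 2 * a" if a: "0 < a" for a :: real
  proof -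
    define F where "F s = a * Si (a * s) - (1 - cos (a * s)) / s" for s
    have "(LBINT s=ereal 0..\<infinity>. (1 - cos (a * s)) / s\<^sup>2) = pi / 2 * a - 0"
    proof (rule interval_integral_FTC_nonneg(2)[where F = F])
      show "DERIV F x :> (1 - cos (a * x)) / x\<^sup>2" if "ereal 0 < ereal x" "ereal x < \<infinity>" for x
        using that a unfolding F_def
        by (auto intro!: derivative_eq_intros DERIV_chain2[OF DERIV_Si] simp: power2_eq_square field_simps)
      show "isCont (\<lambda>x. (1 - cos (a * x)) / x\<^sup>2) x" if "ereal 0 < ereal x" "ereal x < \<infinity>" for x
        using that by (auto intro!: continuous_intros)
      have "(F \<longlongrightarrow> a * Si (a * 0) - 0) (at_right 0)"
      proof -
        have "((\<lambda>s. (1 - cos (a * s)) / s) \<longlongrightarrow> 0) (at_right 0)"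
        proof (rule tendsto_sandwich[of "\<lambda>_. 0" _ _ "\<lambda>s. a\<^sup>2 / 2 * s"])
          show "\<forall>\<^sub>F s in at_right 0. (1 - cos (a * s)) / s \<le> a\<^sup>2 / 2 * s"
            using eventually_at_right_less[of "0::real"]
            by eventually_elim (use one_minus_cos_le_square[of "a * s" for s] in \<open>auto simp: field_simps power2_eq_square\<close>)
          show "\<forall>\<^sub>F s in at_right 0. 0 \<le> (1 - cos (a * s)) / s"
            using eventually_at_right_less[of "0::real"] by eventually_elim auto
          show "((\<lambda>s. a\<^sup>2 / 2 * s) \<longlongrightarrow> 0) (at_right 0)"
            using tendsto_mult[OF tendsto_const[of "a\<^sup>2 / 2"] tendsto_ident_at[of "0::real" "{0<..}"]] by simp
        qed simp
        moreover have "((\<lambda>s. Si (a * s)) \<longlongrightarrow> Si (a * 0)) (at_right 0)"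
          by (rule isCont_tendsto_compose[OF isCont_Si tendsto_mult[OF tendsto_const tendsto_ident_at]])
        ultimately show ?thesis unfolding F_def by (intro tendsto_intros)
      qed
      then show "((F \<circ> real_of_ereal) \<longlongrightarrow> 0) (at_right (ereal 0))"
        by (simp add: Si0 ereal_tendsto_simps)
      have "(F \<longlongrightarrow> a * (pi / 2) - 0) at_top"
      proof -
        have "((\<lambda>s. (1 - cos (a * s)) / s) \<longlongrightarrow> 0) at_top"
        proof (rule tendsto_sandwich[of "\<lambda>_. 0" _ _ "\<lambda>s. 2 / s"])
          show "\<forall>\<^sub>F s in at_top. (1 - cos (a * s)) / s \<le> 2 / s"
            using eventually_gt_at_top[of 0]
          proof eventually_elim
            case (elim s)
            then show ?case using cos_ge_minus_one[of "a * s"] by (intro divide_right_mono) linarith+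
          qed
          show "\<forall>\<^sub>F s in at_top. 0 \<le> (1 - cos (a * s)) / s"
            using eventually_gt_at_top[of 0] by eventually_elim auto
          show "((\<lambda>s. 2 / s) \<longlongrightarrow> (0::real)) at_top"
            by (intro tendsto_divide_0[OF tendsto_const] filterlim_at_top_imp_at_infinity filterlim_ident)
        qed simp
        moreover have "((\<lambda>s. Si (a * s)) \<longlongrightarrow> pi / 2) at_top"
          by (rule filterlim_compose[OF Si_at_top])
             (use a in \<open>auto intro!: filterlim_tendsto_pos_mult_at_top filterlim_ident\<close>)
        ultimately show ?thesis unfolding F_def by (intro tendsto_intros)
      qed
      then show "((F \<circ> real_of_ereal) \<longlongrightarrow> pi / 2 * a) (at_left \<infinity>)"
        by (simp add: ereal_tendsto_simps mult.commute)
    qed auto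
    then show ?thesis
      by (simp add: interval_lebesgue_integral_def einterval_def greaterThan_def)
  qed
  consider "a = 0" | "a > 0" | "a < 0" by linarith
  then show ?thesis
  proof cases
    case 3
    then show ?thesis using pos[of "-a"] by simp
  qed (auto simp: pos)
qed

text \<open>The square of \<open>sin (s / 2) / (s / 2)\<close>. Division by zero makes its value at
  0 equal to 0 instead of 1, which is harmless: the bounds hold there as well and only the limit
  from the right is taken.\<close>

definition fejer :: "real \<Rightarrow> real" where
  "fejer s = 2 * (1 - cos s) / s\<^sup>2"

lemma fejer_measurable [measurable]: "fejer \<in> borel_measurable borel"
  unfolding fejer_def by measurable

lemma fejer_nonneg: "0 \<le> fejer s" by (simp add: fejer_def)

lemma fejer_le_1: "fejer s \<le> 1"
  using one_minus_cos_le_square[of s] by (cases "s = 0") (auto simp: fejer_def field_simps)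

lemma set_integrable_fejer: "0 < e \<Longrightarrow> set_integrable lborel {0<..} (\<lambda>s. fejer (e * s))"
  using set_integrable_mult_right[OF set_integrable_one_minus_cos_over_square[of e], of "2 / e\<^sup>2"]
  by (simp add: fejer_def power_mult_distrib)

lemma tendsto_fejer: "(fejer \<longlongrightarrow> 1) (at_right 0)"
proof -
  have "((\<lambda>s. (sin (s/2) / (s/2))\<^sup>2) \<longlongrightarrow> 1\<^sup>2) (at_right (0::real))"
  proof (rule tendsto_power)
    have "filterlim (\<lambda>s::real. s / 2) (at 0) (at_right 0)"
      by (auto simp: filterlim_at intro!: tendsto_eq_intros eventually_at_right_less[THEN eventually_mono])
    then show "((\<lambda>s::real. sin (s/2) / (s/2)) \<longlongrightarrow> 1) (at_right 0)"
      by (rule filterlim_compose[OF sinc_at_0])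
  qed
  moreover have "(sin (s/2) / (s/2))\<^sup>2 = fejer s" for s :: real
    using cos_double_sin[of "s/2"] by (simp add: fejer_def power_divide field_simps)
  ultimately show ?thesis by simp
qed

text \<open>The Fejer kernel is the cosine transform of the triangle function.\<close>

lemma cosine_transform_fejer_eq_0:
  assumes "0 < e" "e \<le> \<bar>y\<bar>"
  shows "(LBINT s:{0<..}. fejer (e * s) * cos (s * y)) = 0"
proof -
  \<comment> \<open>The product formula for cosines makes the integrand a second difference in
    \<open>y\<close> with step \<open>e\<close>. Integrated, it becomes the second difference of the
    modulus, which vanishes when the modulus is linear on all of
    \<open>[y - e, y + e]\<close>.\<close>
  have eq: "fejer (e * s) * cos (s * y) = 1 / e\<^sup>2 *
      ((1 - cos ((y + e) * s)) / s\<^sup>2 + (1 - cos ((y - e) * s)) / s\<^sup>2 - 2 * ((1 - cos (y * s)) / s\<^sup>2))" for s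
  proof -
    have "cos ((y + e) * s) + cos ((y - e) * s) = 2 * cos (e * s) * cos (y * s)"
      by (simp add: cos_add cos_diff algebra_simps)
    then have "2 * (1 - cos (e * s)) * cos (s * y) = (1 - cos ((y + e) * s)) + (1 - cos ((y - e) * s)) - 2 * (1 - cos (y * s))"
      by (simp add: algebra_simps)
    then show ?thesis by (simp add: fejer_def power_mult_distrib diff_divide_distrib[symmetric] add_divide_distrib[symmetric])
  qed
  have "(LBINT s:{0<..}. fejer (e * s) * cos (s * y)) =
     1 / e\<^sup>2 * (pi / 2 * \<bar>y + e\<bar> + pi / 2 * \<bar>y - e\<bar> - 2 * (pi / 2 * \<bar>y\<bar>))"
    unfolding eq
    by (simp add: set_integral_add set_integral_diff set_integrable_one_minus_cos_over_square
       set_integral_mult_right set_integrable_mult_right integral_one_minus_cos_over_square del: times_divide_eq_right)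
  also have "\<bar>y + e\<bar> + \<bar>y - e\<bar> = 2 * \<bar>y\<bar>" using assms by linarith
  then have "pi / 2 * \<bar>y + e\<bar> + pi / 2 * \<bar>y - e\<bar> - 2 * (pi / 2 * \<bar>y\<bar>) = 0"
    by (metis distrib_left mult.left_commute diff_self)
  finally show ?thesis by simp
qed

section \<open>Characteristic exponents\<close>

lemma dominated_convergence_at_right_0:
  fixes s :: "real \<Rightarrow> 'b \<Rightarrow> real"
  assumes "f \<in> borel_measurable M" "\<And>l. s l \<in> borel_measurable M" "integrable M w"
    and "AE x in M. ((\<lambda>l. s l x) \<longlongrightarrow> f x) (at_right 0)"
    and "\<forall>\<^sub>F l in at_right 0. AE x in M. norm (s l x) \<le> w x"
  shows "((\<lambda>l. \<integral>x. s l x \<partial>M) \<longlongrightarrow> (\<integral>x. f x \<partial>M)) (at_right 0)"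
proof -
  have "((\<lambda>t. \<integral>x. s (inverse t) x \<partial>M) \<longlongrightarrow> (\<integral>x. f x \<partial>M)) at_top"
    by (rule integral_dominated_convergence_at_top[where w = w])
       (use assms in \<open>auto simp: at_right_to_top filterlim_filtermap eventually_filtermap\<close>)
  then show ?thesis by (simp add: at_right_to_top filterlim_filtermap)
qed

lemma dyadic_bracket:
  fixes s :: real
  assumes "1 \<le> s"
  shows "\<exists>n. 2 ^ n \<le> s \<and> s < 2 ^ Suc n"
proof -
  define n where "n = (LEAST n. s < 2 ^ Suc n)"
  obtain m where "s < 2 ^ m" using real_arch_pow[of 2 s] by auto
  then have "s < 2 ^ Suc m" by (rule order_less_le_trans) (rule power_increasing, auto)
  then have "\<exists>n. s < 2 ^ Suc n" ..
  then have 1: "s < 2 ^ Suc n" unfolding n_def by (rule LeastI_ex)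
  have "2 ^ n \<le> s"
  proof (cases n)
    case (Suc m)
    then have "\<not> s < 2 ^ Suc m" unfolding n_def by (intro not_less_Least) simp
    then show ?thesis by (simp add: Suc)
  qed (use assms in simp)
  with 1 show ?thesis by blast
qed

lemma one_divide_le_mult: "0 < a \<Longrightarrow> 0 < b \<Longrightarrow> b \<le> k * a \<Longrightarrow> 1 / a \<le> k * (1 / b)" for a b k :: real
  by (simp add: field_simps)

text \<open>Everything that the analytic part uses about a characteristic exponent. Monotonicity is
  not among it: the inequalities for sums and doubled arguments take its place, and integrability of
  \<open>1 / (1 + \<psi>)\<close> controls the growth at infinity.\<close>

locale exponent =
  fixes \<psi> :: "real \<Rightarrow> real"
  assumes cont: "continuous_on UNIV \<psi>"
    and zero [simp]: "\<psi> 0 = 0"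
    and even [simp]: "\<And>s. \<psi> (- s) = \<psi> s"
    and nonneg [simp]: "\<And>s. 0 \<le> \<psi> s"
    and quasi_subadditive: "\<And>a b. \<psi> (a + b) \<le> 2 * \<psi> a + 2 * \<psi> b"
    and doubling: "\<And>s. \<psi> (2 * s) \<le> 4 * \<psi> s"
    and integrable_1: "set_integrable lborel {0<..} (\<lambda>x. 1 / (1 + \<psi> x))"
begin

lemma measurable [measurable]: "\<psi> \<in> borel_measurable borel"
  by (rule borel_measurable_continuous_onI[OF cont])

lemma cont_on: "continuous_on A \<psi>"
  by (rule continuous_on_subset[OF cont]) simp

lemma doubling_power: "\<psi> (2 ^ n * s) \<le> 4 ^ n * \<psi> s"
proof (induction n)
  case (Suc n)
  show ?case using doubling[of "2 ^ n * s"] Suc by (simp add: mult.assoc)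
qed simp

text \<open>If \<open>\<psi>\<close> were below \<open>K\<close> at arbitrarily large points
  \<open>s\<close>, quasi-subadditivity would bound it by one constant on every such interval
  \<open>[s, s + 1]\<close>, and each of these would contribute a fixed amount to a convergent
  integral.\<close>

lemma eventually_ge: "\<exists>R. \<forall>s\<ge>R. K \<le> \<psi> s"
proof (rule ccontr)
  assume "\<not> ?thesis"
  then have small: "\<exists>s\<ge>R. \<psi> s < K" for R by (auto simp: not_le)
  have "bdd_above (\<psi> ` {0..1})"
    by (intro bounded_imp_bdd_above compact_imp_bounded compact_continuous_image cont_on compact_Icc)
  then obtain m where "\<forall>y\<in>\<psi> ` {0..1}. y \<le> m" unfolding bdd_above_def by blast
  then have m: "\<psi> x \<le> m" if "0 \<le> x" "x \<le> 1" for x using that by auto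
  \<comment> \<open>The bound for \<open>\<psi> (s + v)\<close> with
    \<open>0 \<le> v \<le> 1\<close> when \<open>\<psi> s < K\<close>: \<open>m\<close> bounds
    \<open>\<psi>\<close> on the unit interval.\<close>
  define c where "c = 2 * K + 2 * m"
  have "0 < K" using small[of 0] nonneg by (meson le_less_trans)
  moreover have "0 \<le> m" using m[of 0] by simp
  ultimately have c: "0 < c" by (simp add: c_def)
  define f where "f x = indicator {0<..} x * (1 / (1 + \<psi> x))" for x
  have f_int: "integrable lborel f" using integrable_1 by (simp add: f_def[abs_def] set_integrable_def)
  have "(\<lambda>i. \<integral>x. indicator {real i..} x * f x \<partial>lborel) \<longlonglongrightarrow> (\<integral>x. 0 \<partial>(lborel :: real measure))"
  proof (rule integral_dominated_convergence[where w = f])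
    show "AE x in lborel. (\<lambda>i. indicator {real i..} x * f x) \<longlonglongrightarrow> 0"
    proof (rule AE_I2)
      fix x :: real
      obtain n where n: "x < real n" using reals_Archimedean2 by blast
      have "\<forall>\<^sub>F i in sequentially. indicator {real i..} x * f x = 0"
        using eventually_ge_at_top[of n] by eventually_elim (use n in \<open>auto simp: indicator_def\<close>)
      then show "(\<lambda>i. indicator {real i..} x * f x) \<longlonglongrightarrow> 0" by (rule tendsto_eventually)
    qed
  qed (use f_int in \<open>auto simp: f_def indicator_def\<close>)
  then have "\<forall>\<^sub>F i in sequentially. (\<integral>x. indicator {real i..} x * f x \<partial>lborel) < 1 / (1 + c)"
    using c by (intro order_tendstoD(2)) auto
  then obtain i where i: "(\<integral>x. indicator {real i..} x * f x \<partial>lborel) < 1 / (1 + c)"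
    using eventually_happens trivial_limit_sequentially by blast
  obtain s where s: "real i + 1 \<le> s" "\<psi> s < K" using small[of "real i + 1"] by auto
  have "1 / (1 + c) = (\<integral>x. indicator {s..s+1} x * (1 / (1 + c)) \<partial>lborel)" by simp
  also have "\<dots> \<le> (\<integral>x. indicator {real i..} x * f x \<partial>lborel)"
  proof (rule integral_mono)
    show "integrable lborel (\<lambda>x. indicator {s..s + 1} x * (1 / (1 + c)))"
      by (intro integrable_mult_left integrable_real_indicator) auto
    show "integrable lborel (\<lambda>x. indicator {real i..} x * f x)"
      by (rule integrable_real_mult_indicator[OF _ f_int, unfolded mult.commute[of "f _"]]) simp
    show "indicator {s..s + 1} x * (1 / (1 + c)) \<le> indicator {real i..} x * f x" for x
    proof (cases "x \<in> {s..s+1}")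
      case True
      have "\<psi> x \<le> 2 * \<psi> s + 2 * \<psi> (x - s)" using quasi_subadditive[of s "x - s"] by simp
      also have "\<dots> \<le> c" using s(2) m[of "x - s"] True by (auto simp: c_def)
      finally have "1 / (1 + c) \<le> 1 / (1 + \<psi> x)" by (intro divide_left_mono mult_pos_pos) (auto simp: add_pos_nonneg c less_imp_le)
      then show ?thesis using True s by (auto simp: f_def indicator_def)
    qed (auto simp: f_def)
  qed
  finally show False using i by simp
qed

text \<open>A zero away from the origin would spread to all its dyadic multiples by
  \<open>doubling_power\<close>, against the growth at infinity.\<close>

lemma pos: "s \<noteq> 0 \<Longrightarrow> 0 < \<psi> s"
proof (rule ccontr)
  assume s: "s \<noteq> 0" "\<not> 0 < \<psi> s"
  then have z: "\<psi> \<bar>s\<bar> = 0" using nonneg[of s] by (auto simp: abs_if)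
  obtain R where R: "\<And>s. R \<le> s \<Longrightarrow> 1 \<le> \<psi> s" using eventually_ge[of 1] by blast
  obtain n where "R / \<bar>s\<bar> < 2 ^ n" using real_arch_pow[of 2] by auto
  then have "R \<le> 2 ^ n * \<bar>s\<bar>" using s by (simp add: field_simps)
  then show False using R doubling_power[of n "\<bar>s\<bar>"] z by fastforce
qed

lemma bounded_below: "0 < a \<Longrightarrow> \<exists>c>0. \<forall>s\<ge>a. c \<le> \<psi> s"
proof -
  assume a: "0 < a"
  obtain R where R: "\<And>s. R \<le> s \<Longrightarrow> 1 \<le> \<psi> s" using eventually_ge[of 1] by blast
  obtain x where x: "x \<in> {a..max a R}" "\<And>y. y \<in> {a..max a R} \<Longrightarrow> \<psi> x \<le> \<psi> y"
    using continuous_attains_inf[OF compact_Icc _ cont_on, of a "max a R"] by (auto simp del: max.bounded_iff)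
  have "min 1 (\<psi> x) \<le> \<psi> s" if "a \<le> s" for s
    using x(2)[of s] R[of s] that by (cases "s \<le> R") (auto simp: min_le_iff_disj le_max_iff_disj)
  moreover have "0 < min 1 (\<psi> x)" using pos[of x] x(1) a by auto
  ultimately show ?thesis by blast
qed

lemma integrable_resolvent: "0 < l \<Longrightarrow> set_integrable lborel {0<..} (\<lambda>x. 1 / (l + \<psi> x))"
proof (rule set_integrable_bound[OF set_integrable_mult_right[OF integrable_1]])
  assume l: "0 < l"
  show "set_borel_measurable lborel {0<..} (\<lambda>x. 1 / (l + \<psi> x))" unfolding set_borel_measurable_def by measurable
  have "1 / (l + \<psi> x) \<le> max 1 (1 / l) * (1 / (1 + \<psi> x))" for x
  proof -
    have "1 \<le> max 1 (1 / l) * l" using l by (auto simp: max_def field_simps)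
    moreover have "1 * \<psi> x \<le> max 1 (1 / l) * \<psi> x" by (intro mult_right_mono) auto
    ultimately have "1 + \<psi> x \<le> max 1 (1 / l) * (l + \<psi> x)" by (simp add: distrib_left)
    then show ?thesis using l by (intro one_divide_le_mult) (auto simp: add_pos_nonneg)
  qed
  then have "norm (1 / (l + \<psi> x)) \<le> norm (max 1 (1 / l) * (1 / (1 + \<psi> x)))" for x
    using l by (simp add: abs_mult add_nonneg_nonneg)
  then show "AE x in lborel. x \<in> {0<..} \<longrightarrow> norm (1 / (l + \<psi> x)) \<le> norm (max 1 (1 / l) * (1 / (1 + \<psi> x)))"
    by auto
qed

lemma integrable_tail: "0 < a \<Longrightarrow> set_integrable lborel {a<..} (\<lambda>x. 1 / \<psi> x)"
proof -
  assume a: "0 < a"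
  then obtain c where c: "c > 0" "\<And>s. a \<le> s \<Longrightarrow> c \<le> \<psi> s" using bounded_below by blast
  show ?thesis
  proof (rule set_integrable_bound[OF set_integrable_mult_right[OF set_integrable_subset[OF integrable_1]]])
    show "{a<..} \<subseteq> {0<..}" using a by auto
    show "set_borel_measurable lborel {a<..} (\<lambda>x. 1 / \<psi> x)" unfolding set_borel_measurable_def by measurable
    have "norm (1 / \<psi> x) \<le> norm ((1 + 1 / c) * (1 / (1 + \<psi> x)))" if "a < x" for x
    proof -
      have "c \<le> \<psi> x" using c that by auto
      then have "1 \<le> \<psi> x / c" using c by simp
      then have "1 + \<psi> x \<le> (1 + 1 / c) * \<psi> x" by (simp add: algebra_simps)
      moreover have "0 < \<psi> x" using c that by (meson less_imp_le less_le_trans)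
      ultimately have "1 / \<psi> x \<le> (1 + 1 / c) * (1 / (1 + \<psi> x))" by (intro one_divide_le_mult) auto
      then show ?thesis using c(1) by (simp add: abs_mult)
    qed
    then show "AE x in lborel. x \<in> {a<..} \<longrightarrow> norm (1 / \<psi> x) \<le> norm ((1 + 1 / c) * (1 / (1 + \<psi> x)))" by auto
  qed auto
qed

text \<open>Doubling \<open>s\<close> until it reaches \<open>[1/2, 1]\<close> costs the factor
  \<open>4 ^ n\<close>, which is at most \<open>1 / s\<^sup>2\<close>. No exponent can therefore
  vanish faster than quadratically at the origin.\<close>

lemma ge_square: "\<exists>c>0. \<forall>s. 0 < s \<longrightarrow> s \<le> 1 \<longrightarrow> c * s\<^sup>2 \<le> \<psi> s"
proof -
  obtain c where c: "c > 0" "\<And>s. 1/2 \<le> s \<Longrightarrow> c \<le> \<psi> s" using bounded_below[of "1/2"] by auto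
  have "c * s\<^sup>2 \<le> \<psi> s" if s: "0 < s" "s \<le> 1" for s
  proof -
    obtain n where n: "2 ^ n \<le> 1 / s" "1 / s < 2 ^ Suc n" using dyadic_bracket[of "1 / s"] s by auto
    have "1/2 \<le> 2 ^ n * s" using n s by (simp add: field_simps)
    then have "c \<le> 4 ^ n * \<psi> s" using c(2) doubling_power[of n s] by (meson order_trans)
    moreover have "4 ^ n * s\<^sup>2 \<le> 1"
    proof -
      have "(2 ^ n * s)\<^sup>2 \<le> 1" using n s by (intro power_le_one) (auto simp: field_simps)
      moreover have "(2 ^ n * s)\<^sup>2 = 4 ^ n * s\<^sup>2"
        using power_mult[of "2::real" n 2] power_mult[of "2::real" 2 n] by (simp add: power_mult_distrib mult.commute)
      ultimately show ?thesis by simp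
    qed
    ultimately have "c * (4 ^ n * s\<^sup>2) \<le> 4 ^ n * \<psi> s" using c(1)
      by (meson mult_left_le less_imp_le order_trans)
    then show ?thesis by simp
  qed
  then show ?thesis using c by blast
qed

text \<open>This majorant makes the kernel \<open>K\<close> finite: \<open>ge_square\<close> handles
  the origin, where \<open>1 / \<psi>\<close> alone need not be integrable, and
  \<open>integrable_tail\<close> the rest.\<close>

lemma integrable_min_square: "set_integrable lborel {0<..} (\<lambda>s. min 1 (s\<^sup>2) / \<psi> s)"
proof -
  obtain c where c: "c > 0" "\<And>s. 0 < s \<Longrightarrow> s \<le> 1 \<Longrightarrow> c * s\<^sup>2 \<le> \<psi> s" using ge_square by blast
  have 1: "set_integrable lborel {0<..1} (\<lambda>s. min 1 (s\<^sup>2) / \<psi> s)"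
  proof (rule set_integrable_bound[where f = "\<lambda>_. 1 / c"])
    show "set_integrable lborel {0<..1::real} (\<lambda>_. 1 / c)" by (simp add: set_integrable_def)
    show "set_borel_measurable lborel {0<..1} (\<lambda>s. min 1 (s\<^sup>2) / \<psi> s)" unfolding set_borel_measurable_def by measurable
    have "norm (min 1 (s\<^sup>2) / \<psi> s) \<le> norm (1 / c)" if "s \<in> {0<..1}" for s
    proof -
      have "s\<^sup>2 \<le> \<psi> s / c" using c that by (simp add: field_simps)
      then have "s\<^sup>2 / \<psi> s \<le> 1 / c" using pos[of s] that c by (simp add: field_simps)
      moreover have "min 1 (s\<^sup>2) / \<psi> s \<le> s\<^sup>2 / \<psi> s" by (intro divide_right_mono) auto
      ultimately show ?thesis using c by simp
    qed
    then show "AE s in lborel. s \<in> {0<..1} \<longrightarrow> norm (min 1 (s\<^sup>2) / \<psi> s) \<le> norm (1 / c)" by auto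
  qed
  have 2: "set_integrable lborel {1<..} (\<lambda>s. min 1 (s\<^sup>2) / \<psi> s)"
    by (rule set_integrable_bound[OF integrable_tail[of 1]])
       (auto simp: set_borel_measurable_def intro!: divide_right_mono AE_I2)
  show ?thesis using set_integrable_Un[OF 1 2] by (rule set_integrable_subset) auto
qed

lemma one_minus_cos_over_le:
  assumes "0 < s"
  shows "(1 - cos (x * s)) / \<psi> s \<le> max 2 (x\<^sup>2 / 2) * (min 1 (s\<^sup>2) / \<psi> s)"
  using divide_right_mono[OF one_minus_cos_le nonneg] by simp

lemma integrable_kernel: "set_integrable lborel {0<..} (\<lambda>s. (1 - cos (x * s)) / \<psi> s)"
proof (rule set_integrable_bound[OF set_integrable_mult_right[OF integrable_min_square, of "max 2 (x\<^sup>2 / 2)"]])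
  show "set_borel_measurable lborel {0<..} (\<lambda>s. (1 - cos (x * s)) / \<psi> s)" unfolding set_borel_measurable_def by measurable
  show "AE s in lborel. s \<in> {0<..} \<longrightarrow> norm ((1 - cos (x * s)) / \<psi> s) \<le> norm (max 2 (x\<^sup>2 / 2) * (min 1 (s\<^sup>2) / \<psi> s))"
    using one_minus_cos_over_le[of _ x] by (auto simp: abs_mult)
qed

lemma compensated_kernel_measurable [measurable]: "compensated_kernel \<psi> \<in> borel_measurable borel"
  unfolding compensated_kernel_def set_lebesgue_integral_def by measurable

lemma compensated_kernel_nonneg: "0 \<le> compensated_kernel \<psi> x"
  unfolding compensated_kernel_def set_lebesgue_integral_def
  by (intro mult_nonneg_nonneg Bochner_Integration.integral_nonneg) auto

lemma compensated_kernel_bound: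
  "\<exists>C. \<forall>x. \<bar>x\<bar> \<le> R \<longrightarrow> compensated_kernel \<psi> x \<le> C"
proof -
  have "compensated_kernel \<psi> x \<le> 1 / pi * (max 2 (R\<^sup>2 / 2) * (LBINT s:{0<..}. min 1 (s\<^sup>2) / \<psi> s))" if x: "\<bar>x\<bar> \<le> R" for x
  proof -
    have "x\<^sup>2 \<le> R\<^sup>2" using x by (metis abs_le_square_iff abs_ge_self order_trans)
    have "(1 - cos (x * s)) / \<psi> s \<le> max 2 (R\<^sup>2 / 2) * (min 1 (s\<^sup>2) / \<psi> s)" if "0 < s" for s
      by (rule order_trans[OF one_minus_cos_over_le[OF that] mult_right_mono])
         (use \<open>x\<^sup>2 \<le> R\<^sup>2\<close> in auto)
    then show ?thesis unfolding compensated_kernel_def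
      by (subst set_integral_mult_right[symmetric])
         (intro mult_left_mono set_integral_mono integrable_kernel set_integrable_mult_right integrable_min_square, auto)
  qed
  then show ?thesis by blast
qed

text \<open>Since \<open>\<psi>\<close> is even and attains its supremum on \<open>[- s, s]\<close>,
  \<open>sup_exponent \<psi> s\<close> reaches \<open>l\<close> exactly when \<open>\<psi>\<close>
  does so on \<open>[0, s]\<close>. The inverse is therefore the first point at which a continuous
  function starting from 0 reaches the level, and equality holds there. Limits in \<open>r\<close>
  can then be read as limits in \<open>l = \<psi> r\<close>.\<close>

lemma inv_exponent:
  assumes l: "0 < l"
  shows "0 < inv_exponent \<psi> l" "\<psi> (inv_exponent \<psi> l) = l" "\<And>s. 0 \<le> s \<Longrightarrow> s \<le> inv_exponent \<psi> l \<Longrightarrow> \<psi> s \<le> l"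
proof -
  define Z where "Z = {0..} \<inter> \<psi> -` {l..}"
  have "closed Z" unfolding Z_def by (intro closed_Int closed_vimage cont) auto
  moreover obtain R where "\<And>s. R \<le> s \<Longrightarrow> l \<le> \<psi> s" using eventually_ge[of l] by blast
  then have "max 0 R \<in> Z" by (auto simp: Z_def)
  moreover have "bdd_below Z" by (auto simp: Z_def)
  ultimately have r: "Inf Z \<in> Z" by (intro closed_contains_Inf) auto
  have lower: "Inf Z \<le> s" if "s \<in> Z" for s using that \<open>bdd_below Z\<close> by (rule cInf_lower)
  have bdd: "bdd_above (\<psi> ` {u. \<bar>u\<bar> \<le> s})" and cpt: "compact {u::real. \<bar>u\<bar> \<le> s}" for s
  proof -
    have "{u::real. \<bar>u\<bar> \<le> s} = {-s..s}" by auto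
    then show c: "compact {u::real. \<bar>u\<bar> \<le> s}" by simp
    show "bdd_above (\<psi> ` {u. \<bar>u\<bar> \<le> s})"
      by (intro bounded_imp_bdd_above compact_imp_bounded compact_continuous_image cont_on c)
  qed
  have eq: "inv_exponent \<psi> l = Inf Z"
    unfolding inv_exponent_def
  proof (rule cInf_eq_minimum)
    have "\<psi> (Inf Z) \<le> sup_exponent \<psi> (Inf Z)"
      unfolding sup_exponent_def using r by (intro cSUP_upper bdd) (auto simp: Z_def)
    then show "Inf Z \<in> {s. 0 \<le> s \<and> l \<le> sup_exponent \<psi> s}" using r by (auto simp: Z_def)
    fix s assume s: "s \<in> {s. 0 \<le> s \<and> l \<le> sup_exponent \<psi> s}"
    then have "{u. \<bar>u\<bar> \<le> s} \<noteq> {}" by (auto intro: exI[of _ 0])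
    then obtain u where u: "\<bar>u\<bar> \<le> s" "\<And>v. \<bar>v\<bar> \<le> s \<Longrightarrow> \<psi> v \<le> \<psi> u"
      using continuous_attains_sup[OF cpt _ cont_on] by blast
    have "sup_exponent \<psi> s \<le> \<psi> u" unfolding sup_exponent_def using s u by (intro cSUP_least) (auto intro: exI[of _ 0])
    then have "l \<le> \<psi> \<bar>u\<bar>" using s by (auto simp: abs_if)
    then have "\<bar>u\<bar> \<in> Z" by (auto simp: Z_def)
    from lower[OF this] u(1) show "Inf Z \<le> s" by simp
  qed
  have "Inf Z \<noteq> 0" using r l by (auto simp: Z_def)
  then have r0: "0 < Inf Z" using r by (auto simp: Z_def)
  then show "0 < inv_exponent \<psi> l" by (simp add: eq)
  have lt: "\<psi> s < l" if "0 \<le> s" "s < Inf Z" for s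
    using lower[of s] that by (force simp: Z_def)
  have "\<psi> (Inf Z) \<le> l"
  proof (rule tendsto_upperbound)
    have "isCont \<psi> (Inf Z)" using cont by (simp add: continuous_on_eq_continuous_at)
    then show "(\<psi> \<longlongrightarrow> \<psi> (Inf Z)) (at_left (Inf Z))"
      by (simp add: isCont_def filterlim_at_split)
    show "\<forall>\<^sub>F s in at_left (Inf Z). \<psi> s \<le> l"
      by (rule eventually_at_leftI[OF _ r0]) (auto intro: less_imp_le lt)
  qed simp
  moreover have "l \<le> \<psi> (Inf Z)" using r by (auto simp: Z_def)
  ultimately show *: "\<psi> (inv_exponent \<psi> l) = l" by (simp add: eq)
  show "\<psi> s \<le> l" if "0 \<le> s" "s \<le> inv_exponent \<psi> l" for s
    using lt[of s] that * by (cases "s = Inf Z") (auto simp: eq)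
qed

lemma inv_exponent_at_right_0: "filterlim (inv_exponent \<psi>) (at_right 0) (at_right 0)"
  unfolding filterlim_at
proof (intro conjI)
  show "\<forall>\<^sub>F l in at_right 0. inv_exponent \<psi> l \<in> {0<..} \<and> inv_exponent \<psi> l \<noteq> 0"
    using eventually_at_right_less[of "0::real"] by eventually_elim (use inv_exponent(1) in force)
  show "(inv_exponent \<psi> \<longlongrightarrow> 0) (at_right 0)"
  proof (rule tendstoI)
    fix e :: real assume "0 < e"
    then obtain c where c: "0 < c" "\<And>s. e \<le> s \<Longrightarrow> c \<le> \<psi> s" using bounded_below by blast
    have "\<forall>\<^sub>F l in at_right 0. l \<in> {0<..<c}" by (rule eventually_at_rightI[OF _ c(1)])
    then show "\<forall>\<^sub>F l in at_right 0. dist (inv_exponent \<psi> l) 0 < e"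
    proof eventually_elim
      case (elim l)
      then show ?case using inv_exponent[of l] c(2)[of "inv_exponent \<psi> l"] by force
    qed
  qed
qed

end

section \<open>Regularly varying exponents\<close>

lemma Gamma_reflection_real:
  fixes x :: real
  shows "Gamma x * Gamma (1 - x) = pi / sin (pi * x)"
proof -
  have "complex_of_real (Gamma x * Gamma (1 - x)) = Gamma (of_real x) * Gamma (1 - of_real x)"
    using Gamma_complex_of_real[of x] Gamma_complex_of_real[of "1 - x"] by simp
  also have "\<dots> = of_real pi / sin (of_real pi * of_real x)" by (rule Gamma_reflection_complex)
  also have "\<dots> = complex_of_real (pi / sin (pi * x))" by (metis of_real_divide of_real_mult sin_of_real)
  finally have "complex_of_real (Gamma x * Gamma (1 - x)) = complex_of_real (pi / sin (pi * x))" .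
  then show ?thesis by (simp only: of_real_eq_iff)
qed

lemma set_integrable_powr_at_top:
  fixes b :: real
  assumes "1 < b"
  shows "set_integrable lborel {1..} (\<lambda>s. s powr (- b))"
proof -
  have "((\<lambda>s. - (s powr (1 - b)) / (b - 1)) \<longlongrightarrow> - 0 / (b - 1)) at_top"
    using assms by (intro tendsto_intros tendsto_neg_powr filterlim_ident) auto
  moreover have "DERIV (\<lambda>s. - (s powr (1 - b)) / (b - 1)) x :> x powr (- b)" if "1 \<le> x" for x :: real
  proof -
    have "((\<lambda>s. - (s powr (1 - b)) / (b - 1)) has_real_derivative (- ((1 - b) * x powr (1 - b - 1)) / (b - 1))) (at x)"
      using that by (intro DERIV_cdivide DERIV_minus has_real_derivative_powr) auto
    moreover have "- ((1 - b) * x powr (1 - b - 1)) = x powr (- b) * (b - 1)" by (simp add: algebra_simps)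
    ultimately have "((\<lambda>s. - (s powr (1 - b)) / (b - 1)) has_real_derivative (x powr (- b) * (b - 1) / (b - 1))) (at x)"
      by (simp only:)
    then show ?thesis using assms by simp
  qed
  ultimately have "(\<integral>\<^sup>+s. ennreal (s powr (- b)) * indicator {1..} s \<partial>lborel) = ennreal (- 0 / (b - 1) - (- (1 powr (1 - b)) / (b - 1)))"
    by (intro nn_integral_FTC_atLeast) auto
  then have "integrable lborel (\<lambda>s::real. s powr (- b) * indicator {1..} s)"
    by (intro integrableI_nonneg) (auto simp: ennreal_mult' ennreal_indicator)
  then show ?thesis by (simp add: set_integrable_def mult.commute)
qed

lemma nn_integral_Gamma:
  fixes a t :: real
  assumes "0 < a" "0 < t"
  shows "(\<integral>\<^sup>+v. indicator {0<..} v * ennreal (exp (- (t * v)) * v powr (a - 1)) \<partial>lborel)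
       = ennreal (Gamma a * t powr (- a))"
proof -
  have "(\<integral>\<^sup>+v. indicator {0<..} v * ennreal (exp (- (t * v)) * v powr (a - 1)) \<partial>lborel)
    = (\<integral>\<^sup>+v. ennreal (indicator {0<..} v *\<^sub>R (exp (- (t * v)) * v powr (a - 1))) \<partial>lborel)"
    by (intro nn_integral_cong) (auto simp: indicator_def)
  also have "\<dots> = ennreal (Gamma a * t powr (- a))"
    unfolding Gamma_lebesgue_integral(2)[OF assms, symmetric] set_lebesgue_integral_def
    by (rule nn_integral_eq_integral)
       (use Gamma_lebesgue_integral(1)[OF assms] in \<open>auto simp: set_integrable_def\<close>)
  finally show ?thesis .
qed

lemma nn_integral_exp_atLeast:
  fixes t c :: real
  assumes t: "0 < t"
  shows "(\<integral>\<^sup>+v. ennreal (t * exp (- (t * v))) * indicator {c..} v \<partial>lborel) = ennreal (exp (- (t * c)))"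
proof -
  have "((\<lambda>v. - exp (- (t * v))) \<longlongrightarrow> - 0) at_top"
    using t by (intro tendsto_minus filterlim_compose[OF exp_at_bot] filterlim_uminus_at_bot_at_top[THEN filterlim_compose]
        filterlim_tendsto_pos_mult_at_top[OF tendsto_const] filterlim_ident)
  then show ?thesis
    by (subst nn_integral_FTC_atLeast) (use t in \<open>auto intro!: derivative_eq_intros\<close>)
qed

text \<open>Layer-cake form: \<open>exp (- (t * u powr d))\<close> is the integral of
  \<open>t * exp (- (t * v))\<close> over \<open>v \<ge> u powr d\<close>. After the exchange the
  inner integral is the length \<open>v powr (1 / d)\<close> of the set of admissible
  \<open>u\<close>, and a Gamma integral remains.\<close>

lemma nn_integral_exp_neg_powr:
  fixes d t :: real
  assumes d: "0 < d" and t: "0 < t"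
  shows "(\<integral>\<^sup>+u. indicator {0<..} u * ennreal (exp (- (t * u powr d))) \<partial>lborel)
       = ennreal (Gamma (1 + 1 / d) * t powr (- (1 / d)))"
proof -
  have "(\<integral>\<^sup>+u. indicator {0<..} u * ennreal (exp (- (t * u powr d))) \<partial>lborel)
    = (\<integral>\<^sup>+u. \<integral>\<^sup>+v. indicator {0<..} u * (ennreal (t * exp (- (t * v))) * indicator {u powr d..} v) \<partial>lborel \<partial>lborel)"
    by (subst nn_integral_cmult) (auto simp: nn_integral_exp_atLeast[OF t])
  also have "\<dots> = (\<integral>\<^sup>+u. \<integral>\<^sup>+v. ennreal (t * exp (- (t * v))) * indicator {0<..} v * (if 0 < u \<and> u powr d \<le> v then 1 else 0) \<partial>lborel \<partial>lborel)"
  proof (intro nn_integral_cong)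
    fix u v :: real
    have "0 < v" if "0 < u" "u powr d \<le> v"
      by (rule order_less_le_trans[OF _ that(2)]) (use that in simp)
    then show "indicator {0<..} u * (ennreal (t * exp (- (t * v))) * indicator {u powr d..} v)
       = ennreal (t * exp (- (t * v))) * indicator {0<..} v * (if 0 < u \<and> u powr d \<le> v then 1 else 0)"
      by (auto simp: indicator_def)
  qed
  also have "\<dots> = (\<integral>\<^sup>+v. \<integral>\<^sup>+u. ennreal (t * exp (- (t * v))) * indicator {0<..} v * (if 0 < u \<and> u powr d \<le> v then 1 else 0) \<partial>lborel \<partial>lborel)"
    by (rule lborel_pair.Fubini') measurable
  also have "\<dots> = (\<integral>\<^sup>+v. ennreal t * (indicator {0<..} v * ennreal (exp (- (t * v)) * v powr (1 + 1 / d - 1))) \<partial>lborel)"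
  proof (intro nn_integral_cong)
    fix v :: real
    have "(\<integral>\<^sup>+u. (if 0 < u \<and> u powr d \<le> v then 1 else 0) \<partial>lborel) = ennreal (v powr (1 / d))" if v: "0 < v"
    proof -
      have "u powr d \<le> v \<longleftrightarrow> u \<le> v powr (1 / d)" if "0 < u" for u
      proof -
        have "v = (v powr (1 / d)) powr d" using v d by (simp add: powr_powr)
        moreover have "u powr d \<le> w powr d \<longleftrightarrow> u \<le> w" if "0 < w" for w
          using powr_mono2[of d u w] powr_less_mono2[of d w u] that \<open>0 < u\<close> d by (auto simp: not_le[symmetric])
        ultimately show ?thesis using v by (metis powr_gt_zero less_irrefl)
      qed
      then have "(\<lambda>u. if 0 < u \<and> u powr d \<le> v then 1 else 0) = (indicator {0<..v powr (1 / d)} :: real \<Rightarrow> ennreal)"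
        by (auto simp: fun_eq_iff indicator_def)
      then show ?thesis by simp
    qed
    then show "(\<integral>\<^sup>+u. ennreal (t * exp (- (t * v))) * indicator {0<..} v * (if 0 < u \<and> u powr d \<le> v then 1 else 0) \<partial>lborel)
       = ennreal t * (indicator {0<..} v * ennreal (exp (- (t * v)) * v powr (1 + 1 / d - 1)))"
      using t by (subst nn_integral_cmult) (auto simp: indicator_def ennreal_mult' mult_ac)
  qed
  also have "\<dots> = ennreal (t * (Gamma (1 + 1 / d) * t powr (- (1 + 1 / d))))"
    using t d nn_integral_Gamma[of "1 + 1 / d" t] by (subst nn_integral_cmult) (auto simp: add_pos_pos ennreal_mult')
  also have "t * (Gamma (1 + 1 / d) * t powr (- (1 + 1 / d))) = Gamma (1 + 1 / d) * t powr (- (1 / d))"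
    using t powr_add[of t 1 "- (1 + 1 / d)"] by simp
  finally show ?thesis .
qed

text \<open>Write \<open>1 / (k + u powr d)\<close> as a Laplace transform and exchange the integrals.\<close>

lemma integral_inverse_add_powr:
  fixes d k :: real
  assumes d: "1 < d" and k: "0 < k"
  shows "(LBINT u:{0<..}. 1 / (k + u powr d)) = pi / (d * sin (pi / d)) * k powr (1 / d - 1)"
proof -
  have inner: "(\<integral>\<^sup>+t. indicator {0<..} t * ennreal (exp (- (c * t))) \<partial>lborel) = ennreal (1 / c)" if "0 < c" for c
  proof -
    have "(\<integral>\<^sup>+t. indicator {0<..} t * ennreal (exp (- (c * t))) \<partial>lborel)
      = (\<integral>\<^sup>+t. indicator {0<..} t * ennreal (exp (- (c * t)) * t powr (1 - 1)) \<partial>lborel)"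
      by (intro nn_integral_cong) (auto simp: indicator_def)
    also have "\<dots> = ennreal (1 / c)"
      using nn_integral_Gamma[of 1 c] that by (simp add: powr_minus divide_inverse)
    finally show ?thesis .
  qed
  have pos: "0 < k + u powr d" for u using k by (simp add: add_pos_nonneg)
  have "(\<integral>\<^sup>+u. ennreal (indicator {0<..} u *\<^sub>R (1 / (k + u powr d))) \<partial>lborel)
    = (\<integral>\<^sup>+u. \<integral>\<^sup>+t. indicator {0<..} u * (indicator {0<..} t * ennreal (exp (- ((k + u powr d) * t)))) \<partial>lborel \<partial>lborel)"
    by (subst nn_integral_cmult) (auto simp: inner[OF pos] split: split_indicator intro!: nn_integral_cong)
  also have "\<dots> = (\<integral>\<^sup>+t. \<integral>\<^sup>+u. indicator {0<..} u * (indicator {0<..} t * ennreal (exp (- ((k + u powr d) * t)))) \<partial>lborel \<partial>lborel)"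
    by (rule lborel_pair.Fubini') measurable
  also have "\<dots> = (\<integral>\<^sup>+t. indicator {0<..} t * ennreal (exp (- (k * t))) *
       (\<integral>\<^sup>+u. indicator {0<..} u * ennreal (exp (- (t * u powr d))) \<partial>lborel) \<partial>lborel)"
  proof (intro nn_integral_cong)
    fix t :: real
    have "ennreal (exp (- ((k + u powr d) * t))) = ennreal (exp (- (k * t))) * ennreal (exp (- (t * u powr d)))" for u
      by (simp add: ennreal_mult' [symmetric] exp_add[symmetric] algebra_simps)
    then show "(\<integral>\<^sup>+u. indicator {0<..} u * (indicator {0<..} t * ennreal (exp (- ((k + u powr d) * t)))) \<partial>lborel)
      = indicator {0<..} t * ennreal (exp (- (k * t))) * (\<integral>\<^sup>+u. indicator {0<..} u * ennreal (exp (- (t * u powr d))) \<partial>lborel)"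
      by (subst nn_integral_cmult[symmetric]) (auto simp: mult_ac)
  qed
  also have "\<dots> = (\<integral>\<^sup>+t. ennreal (Gamma (1 + 1 / d)) *
      (indicator {0<..} t * ennreal (exp (- (k * t)) * t powr ((1 - 1 / d) - 1))) \<partial>lborel)"
  proof (intro nn_integral_cong)
    fix t :: real
    have G: "0 \<le> Gamma (1 + 1 / d)" using d by (intro less_imp_le[OF Gamma_real_pos]) (simp add: add_pos_pos)
    show "indicator {0<..} t * ennreal (exp (- (k * t))) * (\<integral>\<^sup>+u. indicator {0<..} u * ennreal (exp (- (t * u powr d))) \<partial>lborel)
      = ennreal (Gamma (1 + 1 / d)) * (indicator {0<..} t * ennreal (exp (- (k * t)) * t powr ((1 - 1 / d) - 1)))"
    proof (cases "0 < t")
      case True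
      then show ?thesis
        using nn_integral_exp_neg_powr[of d t] d G by (simp add: ennreal_mult mult_ac)
    qed simp
  qed
  also have "\<dots> = ennreal (Gamma (1 + 1 / d)) * ennreal (Gamma (1 - 1 / d) * k powr (- (1 - 1 / d)))"
    using nn_integral_Gamma[of "1 - 1 / d" k] d k by (subst nn_integral_cmult) (simp_all del: minus_diff_eq)
  also have "\<dots> = ennreal (Gamma (1 + 1 / d) * Gamma (1 - 1 / d) * k powr (1 / d - 1))"
  proof -
    have "0 \<le> Gamma (1 + 1 / d)" using d by (intro less_imp_le[OF Gamma_real_pos]) (simp add: add_pos_pos)
    then show ?thesis by (subst ennreal_mult'[symmetric]) (simp_all add: mult.assoc)
  qed
  also have "Gamma (1 + 1 / d) * Gamma (1 - 1 / d) = pi / (d * sin (pi / d))"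
  proof -
    have "0 < 1 / d" using d by (simp add: zero_less_divide_iff)
    then have nonpos: "1 / d \<notin> \<int>\<^sub>\<le>\<^sub>0" by (intro notI, elim nonpos_Ints_cases') linarith
    then have "Gamma (1 + 1 / d) = 1 / d * Gamma (1 / d)" using Gamma_plus1[OF nonpos] by (simp only: add.commute[of 1])
    then have "Gamma (1 + 1 / d) * Gamma (1 - 1 / d) = 1 / d * (Gamma (1 / d) * Gamma (1 - 1 / d))" by (simp only: mult.assoc)
    also have "\<dots> = 1 / d * (pi / sin (pi * (1 / d)))" by (simp only: Gamma_reflection_real)
    finally show ?thesis by simp
  qed
  finally have nn: "(\<integral>\<^sup>+u. ennreal (indicator {0<..} u *\<^sub>R (1 / (k + u powr d))) \<partial>lborel)
    = ennreal (pi / (d * sin (pi / d)) * k powr (1 / d - 1))" .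
  have "pi / d < pi" using d by (simp add: field_simps)
  then have "0 \<le> sin (pi / d)" using d by (intro sin_ge_zero) auto
  then show ?thesis unfolding set_lebesgue_integral_def
    using d pos by (subst integral_eq_nn_integral) (simp_all only: nn, auto intro!: AE_I2 divide_nonneg_pos)
qed

section \<open>Uniform bounds from pointwise regular variation\<close>

context exponent
begin

text \<open>Replaces the uniform convergence theorem, as the assumed limit is only pointwise in
  \<open>a\<close>. Baire gives one bound on some subinterval of \<open>[1, 2]\<close>, differences
  of points of that interval carry it to \<open>[0, d]\<close>, and doubling to
  \<open>[0, 1]\<close>.\<close>

lemma rv_bounded:
  assumes rv: "regularly_varying_at_0 \<psi> \<delta>"
  shows "\<exists>M>0. \<exists>r0>0. \<forall>r a. 0 < r \<longrightarrow> r \<le> r0 \<longrightarrow> 0 \<le> a \<longrightarrow> a \<le> 1 \<longrightarrow> \<psi> (a * r) \<le> M * \<psi> r"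
proof -
  \<comment> \<open>Closed sets on which the bound holds, with constant and range both governed by
    \<open>n\<close>. Pointwise convergence of \<open>\<psi> (a * r) / \<psi> r\<close> puts every
    \<open>a\<close> into one of them, so by Baire their complements cannot all be dense.\<close>
  define E where "E n = {a \<in> {1..2}. \<forall>r. 0 < r \<longrightarrow> r \<le> 1 / real (Suc n) \<longrightarrow> \<psi> (a * r) \<le> real (Suc n) * \<psi> r}" for n
  have closed_E: "closed (E n)" for n
  proof -
    have "closed {a. \<psi> (a * r) \<le> real (Suc n) * \<psi> r}" for r
      by (intro closed_Collect_le continuous_intros continuous_on_compose2[OF cont]) auto
    then have "closed {a. \<forall>r. 0 < r \<longrightarrow> r \<le> 1 / real (Suc n) \<longrightarrow> \<psi> (a * r) \<le> real (Suc n) * \<psi> r}"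
      by (intro closed_Collect_all closed_Collect_imp open_Collect_const)
    moreover have "E n = {1..2} \<inter> {a. \<forall>r. 0 < r \<longrightarrow> r \<le> 1 / real (Suc n) \<longrightarrow> \<psi> (a * r) \<le> real (Suc n) * \<psi> r}"
      by (auto simp: E_def)
    ultimately show ?thesis by auto
  qed
  have cover: "\<exists>n. a \<in> E n" if a: "a \<in> {1..2}" for a
  proof -
    have "((\<lambda>r. \<psi> (a * r) / \<psi> r) \<longlongrightarrow> a powr \<delta>) (at_right 0)"
      using rv a by (auto simp: regularly_varying_at_0_def)
    then have "\<forall>\<^sub>F r in at_right 0. \<psi> (a * r) / \<psi> r < a powr \<delta> + 1"
      by (rule order_tendstoD) simp
    then obtain b where b: "0 < b" "\<And>r. 0 < r \<Longrightarrow> r < b \<Longrightarrow> \<psi> (a * r) / \<psi> r < a powr \<delta> + 1"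
      by (auto simp: eventually_at_right_field)
    obtain n where n: "max (a powr \<delta> + 1) (1 / b) < real n" using reals_Archimedean2 by blast
    have "\<psi> (a * r) \<le> real (Suc n) * \<psi> r" if r: "0 < r" "r \<le> 1 / real (Suc n)" for r
    proof -
      have "1 / b < real (Suc n)" using n by simp
      then have "1 / real (Suc n) < b" using b(1) by (simp add: field_simps)
      then have "\<psi> (a * r) / \<psi> r < real (Suc n)" using b(2)[of r] r n by simp
      then show ?thesis using pos[of r] r by (simp add: pos_divide_less_eq)
    qed
    then show ?thesis using a unfolding E_def by blast
  qed
  have "\<exists>n. \<not> {1..2::real} \<subseteq> closure ({1..2} - E n)"
  proof (rule ccontr)
    assume "\<not> ?thesis"
    then have dense: "{1..2::real} \<subseteq> closure ({1..2} - E n)" for n by blast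
    have "{1..2::real} \<subseteq> closure (\<Inter> (range (\<lambda>n. {1..2} - E n)))"
    proof (rule Baire)
      fix T assume "T \<in> range (\<lambda>n. {1..2} - E n)"
      then obtain n where T: "T = {1..2} - E n" by blast
      have "openin (top_of_set {1..2}) ({1..2} \<inter> - E n)"
        by (rule openin_open_Int) (simp add: closed_E open_Compl)
      moreover have "{1..2} \<inter> - E n = {1..2} - E n" by auto
      ultimately show "openin (top_of_set {1..2}) T \<and> {1..2} \<subseteq> closure T"
        using dense[of n] by (simp add: T)
    qed auto
    moreover have "\<Inter> (range (\<lambda>n. {1..2} - E n)) = {}" using cover by blast
    ultimately have "{1..2::real} \<subseteq> closure {}" by (simp only:)
    then show False by simp
  qed
  then obtain n x where x: "x \<in> {1..2}" "x \<notin> closure ({1..2} - E n)" by blast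
  then obtain e where e: "0 < e" "\<And>y. \<bar>y - x\<bar> < e \<Longrightarrow> y \<in> {1..2} \<Longrightarrow> y \<in> E n"
    unfolding closure_approachable dist_real_def by blast
  \<comment> \<open>\<open>x\<close> is an interior point of \<open>E n\<close> relative to
    \<open>[1, 2]\<close> only; at the end point 2 the interval has to be placed to its
    left.\<close>
  obtain c d where cd: "1 \<le> c" "0 < d" "\<And>y. c \<le> y \<Longrightarrow> y \<le> c + d \<Longrightarrow> y \<in> E n"
  proof (cases "x < 2")
    case True
    show ?thesis
    proof (rule that[of x "min (2 - x) (e / 2)"])
      show "y \<in> E n" if "x \<le> y" "y \<le> x + min (2 - x) (e / 2)" for y
        using that x(1) e(1) by (intro e(2)) auto
    qed (use x e True in auto)
  next
    case False
    show ?thesis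
    proof (rule that[of "max 1 (2 - e / 2)" "2 - max 1 (2 - e / 2)"])
      show "y \<in> E n" if "max 1 (2 - e / 2) \<le> y" "y \<le> max 1 (2 - e / 2) + (2 - max 1 (2 - e / 2))" for y
        using that x(1) False e(1) by (intro e(2)) auto
    qed (use e in auto)
  qed
  define r0 where "r0 = 1 / real (Suc n)"
  have r0: "0 < r0" by (simp add: r0_def)
  \<comment> \<open>\<open>a * r\<close> is the difference of \<open>(c + a) * r\<close> and
    \<open>c * r\<close>, and both \<open>c + a\<close> and \<open>c\<close> lie in the interval
    found above; evenness turns quasi-subadditivity into a bound for differences.\<close>
  have small: "\<psi> (a * r) \<le> 4 * real (Suc n) * \<psi> r" if "0 < r" "r \<le> r0" "0 \<le> a" "a \<le> d" for a r
  proof -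
    have "c \<in> E n" "c + a \<in> E n" using cd that by auto
    then have "\<psi> (c * r) \<le> real (Suc n) * \<psi> r" "\<psi> ((c + a) * r) \<le> real (Suc n) * \<psi> r"
      using that by (auto simp: E_def r0_def)
    moreover have "\<psi> (a * r) \<le> 2 * \<psi> ((c + a) * r) + 2 * \<psi> (c * r)"
      using quasi_subadditive[of "(c + a) * r" "- (c * r)"] by (simp add: algebra_simps)
    ultimately show ?thesis by linarith
  qed
  \<comment> \<open>\<open>j\<close> doublings carry the range \<open>[0, d]\<close> to
    \<open>[0, 1]\<close>.\<close>
  obtain j where "1 / d < 2 ^ j" using real_arch_pow[of 2 "1 / d"] by auto
  then have j: "1 / 2 ^ j \<le> d" using cd(2) by (simp add: field_simps)
  have "\<psi> (a * r) \<le> 4 ^ j * (4 * real (Suc n)) * \<psi> r" if "0 < r" "r \<le> r0" "0 \<le> a" "a \<le> 1" for a r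
  proof -
    have "\<psi> (a * r) \<le> 4 ^ j * \<psi> ((a / 2 ^ j) * r)" using doubling_power[of j "a / 2 ^ j * r"] by simp
    also have "\<psi> ((a / 2 ^ j) * r) \<le> 4 * real (Suc n) * \<psi> r"
    proof (rule small)
      have "a / 2 ^ j \<le> 1 / 2 ^ j" using that by (intro divide_right_mono) auto
      then show "a / 2 ^ j \<le> d" using j by simp
    qed (use that in auto)
    finally show ?thesis by (simp add: mult.assoc)
  qed
  moreover have "0 < 4 ^ j * (4 * real (Suc n))" by simp
  ultimately show ?thesis using r0 by blast
qed

text \<open>A Potter-type bound. For dyadic factors it comes from iterating
  \<open>\<psi> (2 * r) > 2 powr \<beta> * \<psi> r\<close>, valid for small \<open>r\<close>
  because \<open>\<beta> < \<delta>\<close>; \<open>rv_bounded\<close> bridges the gap between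
  consecutive powers of 2.\<close>

lemma rv_lower_bound:
  assumes rv: "regularly_varying_at_0 \<psi> \<delta>" and \<beta>: "0 \<le> \<beta>" "\<beta> < \<delta>"
  shows "\<exists>c>0. \<exists>r1>0. \<forall>r s. 0 < r \<longrightarrow> 1 \<le> s \<longrightarrow> s * r \<le> r1 \<longrightarrow> c * s powr \<beta> * \<psi> r \<le> \<psi> (s * r)"
proof -
  obtain M r0 where M: "0 < M" "0 < r0" and
    Mle: "\<And>r a. 0 < r \<Longrightarrow> r \<le> r0 \<Longrightarrow> 0 \<le> a \<Longrightarrow> a \<le> 1 \<Longrightarrow> \<psi> (a * r) \<le> M * \<psi> r"
    using rv_bounded[OF rv] by blast
  have "((\<lambda>r. \<psi> (2 * r) / \<psi> r) \<longlongrightarrow> 2 powr \<delta>) (at_right 0)"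
    using rv by (auto simp: regularly_varying_at_0_def)
  then have "\<forall>\<^sub>F r in at_right 0. 2 powr \<beta> < \<psi> (2 * r) / \<psi> r"
    by (rule order_tendstoD) (use \<beta> in simp)
  then obtain b where b: "0 < b" "\<And>r. 0 < r \<Longrightarrow> r < b \<Longrightarrow> 2 powr \<beta> < \<psi> (2 * r) / \<psi> r"
    by (auto simp: eventually_at_right_field)
  define r1 where "r1 = min r0 (b / 2)"
  have r1: "0 < r1" "r1 \<le> r0" "r1 < b" using M b by (auto simp: r1_def)
  have pow: "(2 ^ n) powr \<beta> * \<psi> r \<le> \<psi> (2 ^ n * r)" if "0 < r" "2 ^ n * r \<le> r1" for n r
    using that(2)
  proof (induction n)
    case (Suc n)
    have le: "2 ^ n * r \<le> r1" using Suc.prems that(1) by (simp add: mult.assoc) (smt (verit) mult_pos_pos zero_less_power)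
    have "2 powr \<beta> * \<psi> (2 ^ n * r) \<le> \<psi> (2 * (2 ^ n * r))"
      using b(2)[of "2 ^ n * r"] le r1 that(1) pos[of "2 ^ n * r"] by (simp add: pos_less_divide_eq)
    moreover have "2 powr \<beta> * ((2 ^ n) powr \<beta> * \<psi> r) \<le> 2 powr \<beta> * \<psi> (2 ^ n * r)"
      by (intro mult_left_mono Suc.IH le) auto
    ultimately have "2 powr \<beta> * ((2 ^ n) powr \<beta> * \<psi> r) \<le> \<psi> (2 * (2 ^ n * r))" by (rule order_trans[rotated])
    then show ?case by (simp add: powr_mult mult.assoc)
  qed simp
  \<comment> \<open>The factor \<open>2 powr (- \<beta>)\<close> pays for rounding \<open>s\<close>
    down to \<open>2 ^ n\<close>, the division by \<open>M\<close> for passing from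
    \<open>\<psi> (2 ^ n * r)\<close> to \<open>\<psi> (s * r)\<close>, where no monotonicity
    helps.\<close>
  have "2 powr (- \<beta>) / M * s powr \<beta> * \<psi> r \<le> \<psi> (s * r)" if "0 < r" "1 \<le> s" "s * r \<le> r1" for r s
  proof -
    obtain n where n: "2 ^ n \<le> s" "s < 2 ^ Suc n" using dyadic_bracket[OF \<open>1 \<le> s\<close>] by blast
    have "(s / 2) powr \<beta> * \<psi> r \<le> (2 ^ n) powr \<beta> * \<psi> r"
      using n that \<beta> by (intro mult_right_mono powr_mono2) auto
    also have "2 ^ n * r \<le> r1" by (rule order_trans[OF _ that(3)]) (use n that in simp)
    then have "(2 ^ n) powr \<beta> * \<psi> r \<le> \<psi> (2 ^ n * r)"
      using that by (intro pow)
    also have "2 ^ n * r = (2 ^ n / s) * (s * r)" using that by simp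
    also have "\<psi> ((2 ^ n / s) * (s * r)) \<le> M * \<psi> (s * r)"
      using that n r1 by (intro Mle) auto
    finally have "2 powr (- \<beta>) * s powr \<beta> * \<psi> r \<le> M * \<psi> (s * r)"
      using that by (simp add: powr_divide powr_minus field_simps)
    then show ?thesis using M by (simp add: field_simps)
  qed
  moreover have "0 < 2 powr (- \<beta>) / M" using M by simp
  ultimately show ?thesis using r1(1) by blast
qed

end

lemma set_integral_greaterThan_pos:
  fixes f :: "real \<Rightarrow> real"
  assumes int: "set_integrable lborel {a<..} f" and f: "\<And>s. a < s \<Longrightarrow> 0 < f s"
  shows "0 < (LBINT s:{a<..}. f s)"
proof -
  have nn: "0 \<le> indicator {a<..} s *\<^sub>R f s" for s using f[of s] by (simp add: indicator_def less_imp_le)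
  have "0 \<le> (LBINT s:{a<..}. f s)" unfolding set_lebesgue_integral_def
    by (rule Bochner_Integration.integral_nonneg) (rule nn)
  moreover have "(LBINT s:{a<..}. f s) \<noteq> 0"
  proof
    assume "(LBINT s:{a<..}. f s) = 0"
    then have "AE s in lborel. indicator {a<..} s *\<^sub>R f s = 0"
      using int nn unfolding set_lebesgue_integral_def set_integrable_def
      by (subst (asm) integral_nonneg_eq_0_iff_AE) auto
    then have "AE s in lborel. \<not> (a < s \<and> s < a + 1)"
    proof eventually_elim
      case (elim s)
      then show ?case using f[of s] by (cases "a < s") auto
    qed
    then have "emeasure lborel {s. a < s \<and> s < a + 1} = 0" by (subst (asm) AE_iff_measurable[OF _ refl]) auto
    moreover have "{a<..<a+1} = {s. a < s \<and> s < a + 1}" by auto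
    ultimately have "emeasure lborel {a<..<a+1} = 0" by (simp only:)
    then show False by simp
  qed
  ultimately show ?thesis by simp
qed

section \<open>The resolvent at the origin for index above 1\<close>

context exponent
begin

text \<open>The number \<open>G\<^sub>l 0\<close>, that is \<open>pi\<close> times the resolvent
  density at the origin; the integral over the half-line uses that \<open>\<psi>\<close> is
  even.\<close>

definition resolvent :: "real \<Rightarrow> real" where
  "resolvent l = (LBINT s:{0<..}. 1 / (l + \<psi> s))"

lemma resolvent_pos: "0 < l \<Longrightarrow> 0 < resolvent l"
  unfolding resolvent_def
  by (intro set_integral_greaterThan_pos integrable_resolvent) (auto intro!: add_pos_nonneg)

lemma eventually_at_right_le: "0 < b \<Longrightarrow> \<forall>\<^sub>F r in at_right 0. 0 < r \<and> r \<le> (b::real)"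
  using eventually_at_rightI[of 0 b "\<lambda>r. 0 < r \<and> r \<le> b"] by auto

text \<open>Comparison of \<open>r\<close> with the fixed point \<open>r1\<close> in
  \<open>rv_lower_bound\<close>, for an exponent strictly between 1 and \<open>\<delta>\<close>. It
  makes the frequencies above \<open>r1\<close> negligible in the scaling limit.\<close>

lemma rv_over_tendsto_0:
  assumes rv: "regularly_varying_at_0 \<psi> \<delta>" and "1 < \<delta>"
  shows "((\<lambda>r. \<psi> r / r) \<longlongrightarrow> 0) (at_right 0)"
proof -
  define \<beta> where "\<beta> = (1 + \<delta>) / 2"
  have \<beta>: "1 < \<beta>" "\<beta> < \<delta>" using assms by (auto simp: \<beta>_def)
  obtain c r1 where c: "0 < c" "0 < r1"
    and le: "\<And>r s. 0 < r \<Longrightarrow> 1 \<le> s \<Longrightarrow> s * r \<le> r1 \<Longrightarrow> c * s powr \<beta> * \<psi> r \<le> \<psi> (s * r)"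
    using rv_lower_bound[OF rv, of \<beta>] \<beta> by auto
  define D where "D = \<psi> r1 / (c * r1 powr \<beta>)"
  show ?thesis
  proof (rule tendsto_sandwich[of "\<lambda>_. 0" _ _ "\<lambda>r. D * r powr (\<beta> - 1)"])
    show "\<forall>\<^sub>F r in at_right 0. 0 \<le> \<psi> r / r"
      using eventually_at_right_le[OF c(2)] by eventually_elim auto
    show "\<forall>\<^sub>F r in at_right 0. \<psi> r / r \<le> D * r powr (\<beta> - 1)"
      using eventually_at_right_le[OF c(2)]
    proof eventually_elim
      case (elim r)
      have "c * (r1 / r) powr \<beta> * \<psi> r \<le> \<psi> r1" using le[of r "r1 / r"] elim by simp
      moreover have "(r1 / r) powr \<beta> = r1 powr \<beta> / r powr \<beta>" using elim c by (simp add: powr_divide)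
      ultimately have "\<psi> r \<le> D * r powr \<beta>" using elim c by (simp add: D_def field_simps)
      then show ?case using elim by (simp add: powr_diff field_simps)
    qed
    have "((\<lambda>r. D * r powr (\<beta> - 1)) \<longlongrightarrow> D * 0 powr (\<beta> - 1)) (at_right 0)"
      using \<beta> by (intro tendsto_mult tendsto_const tendsto_powr' tendsto_ident_at) (auto simp: eventually_at_filter)
    then show "((\<lambda>r. D * r powr (\<beta> - 1)) \<longlongrightarrow> 0) (at_right 0)" by simp
  qed simp
qed

text \<open>The substitution \<open>s = r * u\<close> turns the left side into the integral of
  \<open>1 / (k + \<psi> (r * u) / \<psi> r)\<close>, whose integrand converges by regular
  variation. The majorant is available only for \<open>r * u \<le> r1\<close>, hence the splitting
  into the truncated integrand \<open>S\<close> and the remainder \<open>R\<close>, which is bounded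
  and multiplied by a null factor.\<close>

lemma resolvent_scaling_limit:
  assumes rv: "regularly_varying_at_0 \<psi> \<delta>" and \<delta>: "1 < \<delta>" and k: "0 < k"
  shows "((\<lambda>r. \<psi> r / r * resolvent (k * \<psi> r)) \<longlongrightarrow> (LBINT u:{0<..}. 1 / (k + u powr \<delta>))) (at_right 0)"
proof -
  define \<beta> where "\<beta> = (1 + \<delta>) / 2"
  have \<beta>: "1 < \<beta>" "\<beta> < \<delta>" using \<delta> by (auto simp: \<beta>_def)
  obtain c r1 where c: "0 < c" "0 < r1"
    and le: "\<And>r s. 0 < r \<Longrightarrow> 1 \<le> s \<Longrightarrow> s * r \<le> r1 \<Longrightarrow> c * s powr \<beta> * \<psi> r \<le> \<psi> (s * r)"
    using rv_lower_bound[OF rv, of \<beta>] \<beta> by auto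
  define S where "S r u = indicator {0<..} u * (if r * u \<le> r1 then 1 / (k + \<psi> (u * r) / \<psi> r) else 0)" for r u
  define J where "J = (LBINT s:{r1<..}. 1 / \<psi> s)"
  define R where "R r = (LBINT s:{r1<..}. 1 / (k * \<psi> r + \<psi> s))" for r
  have pos': "0 < k + \<psi> a / \<psi> b" for a b using k by (intro add_pos_nonneg) auto
  have int: "set_integrable lborel {0<..} (\<lambda>s. 1 / (k * \<psi> r + \<psi> s))" if "0 < r" for r
    using that k pos[of r] by (intro integrable_resolvent) auto
  have split: "\<psi> r / r * resolvent (k * \<psi> r) = (\<integral>u. S r u \<partial>lborel) + \<psi> r / r * R r" if r: "0 < r" for r
  proof -
    have "{0<..} = {0<..r1} \<union> {r1<..}" using c by auto
    then have "resolvent (k * \<psi> r) = (LBINT s:{0<..r1} \<union> {r1<..}. 1 / (k * \<psi> r + \<psi> s))"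
      by (simp add: resolvent_def)
    also have "\<dots> = (LBINT s:{0<..r1}. 1 / (k * \<psi> r + \<psi> s)) + R r"
      unfolding R_def by (rule set_integral_Un) (use c in \<open>auto intro!: set_integrable_subset[OF int[OF r]]\<close>)
    also have "(LBINT s:{0<..r1}. 1 / (k * \<psi> r + \<psi> s)) = r * (\<integral>u. indicator {0<..r1} (0 + r * u) *\<^sub>R (1 / (k * \<psi> r + \<psi> (0 + r * u))) \<partial>lborel)"
      unfolding set_lebesgue_integral_def using r by (subst lborel_integral_real_affine[of r _ 0]) auto
    also have "(\<integral>u. indicator {0<..r1} (0 + r * u) *\<^sub>R (1 / (k * \<psi> r + \<psi> (0 + r * u))) \<partial>lborel) = (\<integral>u. S r u / \<psi> r \<partial>lborel)"
      using r pos[of r] by (intro Bochner_Integration.integral_cong)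
        (auto simp: S_def indicator_def zero_less_mult_iff field_simps)
    also have "\<dots> = (\<integral>u. S r u \<partial>lborel) / \<psi> r" by simp
    finally show ?thesis using r pos[of r] by (simp add: field_simps)
  qed
  have [measurable]: "S r \<in> borel_measurable borel" for r unfolding S_def by measurable
  \<comment> \<open>The majorant drops the quotient in the denominator for \<open>u < 1\<close> and
    the summand \<open>k\<close> for \<open>u \<ge> 1\<close>; an exponent \<open>\<beta>\<close>
    above 1 makes the power integrable.\<close>
  define w where "w u = indicator {0..<1} u *\<^sub>R (1 / k) + indicator {1..} u *\<^sub>R (u powr (- \<beta>) * (1 / c))" for u
  have S_lim: "((\<lambda>r. \<integral>u. S r u \<partial>lborel) \<longlongrightarrow> (\<integral>u. indicator {0<..} u *\<^sub>R (1 / (k + u powr \<delta>)) \<partial>lborel)) (at_right 0)"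
  proof (rule dominated_convergence_at_right_0[where w = w])
    show "integrable lborel w" unfolding w_def
      using set_integrable_mult_left[OF set_integrable_powr_at_top[OF \<beta>(1)], of "1 / c"]
      by (intro Bochner_Integration.integrable_add) (auto simp: set_integrable_def)
    show "AE u in lborel. ((\<lambda>r. S r u) \<longlongrightarrow> indicator {0<..} u *\<^sub>R (1 / (k + u powr \<delta>))) (at_right 0)"
    proof (rule AE_I2)
      fix u :: real
      show "((\<lambda>r. S r u) \<longlongrightarrow> indicator {0<..} u *\<^sub>R (1 / (k + u powr \<delta>))) (at_right 0)"
      proof (cases "0 < u")
        case True
        have "((\<lambda>r. 1 / (k + \<psi> (u * r) / \<psi> r)) \<longlongrightarrow> 1 / (k + u powr \<delta>)) (at_right 0)"
          using rv True k add_pos_nonneg[of k "u powr \<delta>"]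
          by (intro tendsto_intros) (auto simp: regularly_varying_at_0_def)
        moreover have "\<forall>\<^sub>F r in at_right 0. 1 / (k + \<psi> (u * r) / \<psi> r) = S r u"
          using eventually_at_right_le[of "r1 / u"] c True
          by (auto elim!: eventually_mono simp: S_def field_simps)
        ultimately have "((\<lambda>r. S r u) \<longlongrightarrow> 1 / (k + u powr \<delta>)) (at_right 0)"
          by (rule Lim_transform_eventually)
        then show ?thesis using True by simp
      qed (simp add: S_def)
    qed
    show "\<forall>\<^sub>F r in at_right 0. AE u in lborel. norm (S r u) \<le> w u"
      using eventually_at_right_less[of "0::real"]
    proof (eventually_elim, intro AE_I2)
      fix r u :: real assume r: "0 < r"
      consider "u \<le> 0 \<or> r * u > r1" | "0 < u" "u < 1" | "1 \<le> u" "r * u \<le> r1" by linarith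
      then show "norm (S r u) \<le> w u"
      proof cases
        case 1
        then have "S r u = 0" by (auto simp: S_def)
        moreover have "0 \<le> w u" using k c by (auto simp: w_def)
        ultimately show ?thesis by simp
      next
        case 2
        have "1 / (k + \<psi> (u * r) / \<psi> r) \<le> 1 / k" using k by (intro divide_left_mono) (auto intro!: mult_pos_pos pos')
        then show ?thesis using 2 k pos'[of "u * r" r] by (auto simp: S_def w_def)
      next
        case 3
        have "c * u powr \<beta> * \<psi> r \<le> \<psi> (u * r)" using le[of r u] 3 r by (simp add: mult.commute)
        then have "c * u powr \<beta> \<le> \<psi> (u * r) / \<psi> r" using pos[of r] r by (simp add: field_simps)
        then have "1 / (k + \<psi> (u * r) / \<psi> r) \<le> 1 / (c * u powr \<beta>)"
          using k c 3 pos' by (intro divide_left_mono mult_pos_pos) auto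
        also have "\<dots> = u powr (- \<beta>) * (1 / c)" by (simp add: powr_minus field_simps)
        finally show ?thesis using 3 c k pos'[of "u * r" r] by (auto simp: S_def w_def indicator_def)
      qed
    qed
  qed measurable
  have R_le: "\<bar>R r\<bar> \<le> J" if r: "0 < r" for r
  proof -
    have "0 \<le> R r" unfolding R_def set_lebesgue_integral_def
      using k by (intro Bochner_Integration.integral_nonneg) (auto intro!: add_nonneg_nonneg)
    moreover have "R r \<le> J" unfolding R_def J_def
    proof (rule set_integral_mono[OF set_integrable_subset[OF int[OF r]] integrable_tail[OF c(2)]])
      show "1 / (k * \<psi> r + \<psi> s) \<le> 1 / \<psi> s" if "s \<in> {r1<..}" for s
        using that c k pos[of s] by (intro divide_left_mono) (auto intro!: mult_pos_pos add_nonneg_pos)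
    qed (use c in auto)
    ultimately show ?thesis by simp
  qed
  have "((\<lambda>r. \<psi> r / r * R r) \<longlongrightarrow> 0) (at_right 0)"
  proof (rule Lim_null_comparison)
    show "((\<lambda>r. \<psi> r / r * J) \<longlongrightarrow> 0) (at_right 0)"
      using tendsto_mult_left_zero[OF rv_over_tendsto_0[OF rv \<delta>]] .
    show "\<forall>\<^sub>F r in at_right 0. norm (\<psi> r / r * R r) \<le> \<psi> r / r * J"
      using eventually_at_right_less[of "0::real"]
      by eventually_elim (use R_le in \<open>auto simp: abs_mult intro!: divide_right_mono mult_left_mono\<close>)
  qed
  from tendsto_add[OF S_lim this]
  have "((\<lambda>r. (\<integral>u. S r u \<partial>lborel) + \<psi> r / r * R r) \<longlongrightarrow> (LBINT u:{0<..}. 1 / (k + u powr \<delta>))) (at_right 0)"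
    by (simp add: set_lebesgue_integral_def)
  then show ?thesis
    by (rule Lim_transform_eventually)
       (use split in \<open>auto intro: eventually_mono[OF eventually_at_right_less[of "0::real"]]\<close>)
qed

lemma resolvent_asymptotics:
  assumes rv: "regularly_varying_at_0 \<psi> \<delta>" and \<delta>: "1 < \<delta>" and k: "0 < k"
  shows "((\<lambda>l. l / inv_exponent \<psi> l * resolvent (k * l)) \<longlongrightarrow>
           pi / (\<delta> * sin (pi / \<delta>)) * k powr (1 / \<delta> - 1)) (at_right 0)"
proof -
  have "((\<lambda>l. \<psi> (inv_exponent \<psi> l) / inv_exponent \<psi> l * resolvent (k * \<psi> (inv_exponent \<psi> l))) \<longlongrightarrow>
           (LBINT u:{0<..}. 1 / (k + u powr \<delta>))) (at_right 0)"
    by (rule filterlim_compose[OF resolvent_scaling_limit[OF assms] inv_exponent_at_right_0])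
  then show ?thesis
    unfolding integral_inverse_add_powr[OF \<delta> k]
    by (rule Lim_transform_eventually)
       (use inv_exponent(2) in \<open>auto intro: eventually_mono[OF eventually_at_right_less[of "0::real"]]\<close>)
qed

section \<open>The tail integral for index 1\<close>

definition tail :: "real \<Rightarrow> real" where
  "tail r = (LBINT s:{r<..}. 1 / \<psi> s)"

lemma tail_antimono: "0 < a \<Longrightarrow> a \<le> b \<Longrightarrow> tail b \<le> tail a"
  unfolding tail_def set_lebesgue_integral_def
  using integrable_tail[of a] integrable_tail[of b] unfolding set_integrable_def
  by (intro integral_mono) (auto simp: indicator_def)

lemma tail_pos: "0 < a \<Longrightarrow> 0 < tail a"
  unfolding tail_def by (intro set_integral_greaterThan_pos integrable_tail) (auto intro!: pos)

text \<open>Each dyadic block \<open>[r, 2 * r]\<close> contributes a fixed fraction of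
  \<open>r / \<psi> r\<close> to the tail, and for index 1 this quantity hardly changes from one
  block to the next. Many blocks together therefore give a multiple that grows with
  \<open>n\<close>.\<close>

lemma tail_ge:
  assumes rv: "regularly_varying_at_0 \<psi> 1"
  shows "\<exists>M>0. \<forall>n::nat. \<forall>\<^sub>F r in at_right 0. real n / (8 * M) * (r / \<psi> r) \<le> tail r"
proof -
  obtain M r0 where M: "0 < M" "0 < r0" and
    Mle: "\<And>r a. 0 < r \<Longrightarrow> r \<le> r0 \<Longrightarrow> 0 \<le> a \<Longrightarrow> a \<le> 1 \<Longrightarrow> \<psi> (a * r) \<le> M * \<psi> r"
    using rv_bounded[OF rv] by blast
  \<comment> \<open>The factor 4 is the price of \<open>doubling\<close> from \<open>r\<close> to
    \<open>2 * r\<close>, and \<open>M\<close> that of the missing monotonicity in between.\<close>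
  have step: "r / (4 * M * \<psi> r) + tail (2 * r) \<le> tail r" if r: "0 < r" "2 * r \<le> r0" for r
  proof -
    have pr: "0 < \<psi> r" "0 < \<psi> (2 * r)" using pos r by auto
    have "{r<..} = {r<..2 * r} \<union> {2 * r<..}" using r by auto
    then have "tail r = (LBINT s:{r<..2 * r} \<union> {2 * r<..}. 1 / \<psi> s)" by (simp add: tail_def)
    also have "\<dots> = (LBINT s:{r<..2 * r}. 1 / \<psi> s) + tail (2 * r)"
      unfolding tail_def
      by (rule set_integral_Un) (use r in \<open>auto intro!: set_integrable_subset[OF integrable_tail[of r]]\<close>)
    also have "(LBINT s:{r<..2 * r}. 1 / (4 * M * \<psi> r)) \<le> (LBINT s:{r<..2 * r}. 1 / \<psi> s)"
    proof (rule set_integral_mono)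
      show "set_integrable lborel {r<..2 * r} (\<lambda>s. 1 / \<psi> s)"
        using r by (intro set_integrable_subset[OF integrable_tail[of r]]) auto
      fix s assume s: "s \<in> {r<..2 * r}"
      have "\<psi> s \<le> M * \<psi> (2 * r)" using Mle[of "2 * r" "s / (2 * r)"] s r by simp
      also have "\<dots> \<le> M * (4 * \<psi> r)" using M by (intro mult_left_mono doubling) auto
      finally show "1 / (4 * M * \<psi> r) \<le> 1 / \<psi> s"
        using pos[of s] s r M pr by (intro divide_left_mono mult_pos_pos) auto
    qed (unfold set_integrable_def, intro integrable_scaleR_left integrable_real_indicator, use r in auto)
    then have "r / (4 * M * \<psi> r) + tail (2 * r) \<le> (LBINT s:{r<..2 * r}. 1 / \<psi> s) + tail (2 * r)"
      using r by (simp add: set_lebesgue_integral_def measure_def)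
    finally show ?thesis by simp
  qed
  have "\<forall>\<^sub>F r in at_right 0. real n / (8 * M) * (r / \<psi> r) \<le> tail r" for n
  proof (induction n)
    case 0
    show ?case using eventually_at_right_less[of "0::real"] by eventually_elim (use tail_pos in \<open>auto intro: less_imp_le\<close>)
  next
    case (Suc n)
    have dbl: "filterlim (\<lambda>r::real. 2 * r) (at_right 0) (at_right 0)"
      by (rule filterlim_times_pos[of "\<lambda>x. x" 0 _ 2 0]) (auto simp: filterlim_ident)
    have "((\<lambda>r. \<psi> (2 * r) / \<psi> r) \<longlongrightarrow> 2 powr 1) (at_right 0)"
      using rv unfolding regularly_varying_at_0_def by fastforce
    \<comment> \<open>A block is worth two shares \<open>1 / (8 * M)\<close>: one raises
      \<open>n\<close>, the other absorbs the error. The tolerance is tuned to this: the claim for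
      \<open>Suc n\<close> asks for \<open>(n - 1) / \<psi> r \<le> 2 * n / \<psi> (2 * r)\<close>,
      which follows because \<open>(n - 1) * (n + 2) \<le> n * (n + 1)\<close>.\<close>
    then have "\<forall>\<^sub>F r in at_right 0. \<psi> (2 * r) / \<psi> r < 2 * (1 + 1 / real (Suc n))"
      by (rule order_tendstoD) simp
    moreover have "\<forall>\<^sub>F r in at_right 0. real n / (8 * M) * (2 * r / \<psi> (2 * r)) \<le> tail (2 * r)"
      using eventually_compose_filterlim[OF Suc dbl] .
    moreover have "\<forall>\<^sub>F r in at_right 0. 0 < r \<and> r \<le> r0 / 2" by (rule eventually_at_right_le) (use M in simp)
    ultimately show ?case
    proof eventually_elim
      case (elim r)
      define p q where "p = \<psi> r" and "q = \<psi> (2 * r)"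
      have pq: "0 < p" "0 < q" using elim pos by (auto simp: p_def q_def)
      have "q * real (Suc n) < 2 * (real n + 2) * p"
      proof -
        have "q / p < 2 * (1 + 1 / real (Suc n))" using elim(1) by (simp add: p_def q_def)
        then show ?thesis using pq by (simp add: field_simps)
      qed
      have "real n * (real n + 1) * q \<le> real n * (2 * (real n + 2) * p)"
        using \<open>q * real (Suc n) < 2 * (real n + 2) * p\<close>
        by (subst mult.assoc, intro mult_left_mono) (auto simp: algebra_simps)
      moreover have "(real n - 1) * (real n + 2) \<le> real n * (real n + 1)" by (simp add: algebra_simps)
      then have "(real n - 1) * (real n + 2) * q \<le> real n * (real n + 1) * q" using pq by (intro mult_right_mono) auto
      ultimately have "(real n + 2) * ((real n - 1) * q) \<le> (real n + 2) * (real n * 2 * p)" by (simp add: algebra_simps)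
      then have "(real n - 1) * q \<le> real n * 2 * p" by (simp add: mult_le_cancel_left_pos add_pos_nonneg)
      then have "(real n - 1) / p \<le> real n * 2 / q" using pq by (simp add: field_simps)
      then have "(real n - 1) / p * (r / (8 * M)) \<le> real n * 2 / q * (r / (8 * M))"
        using elim M by (intro mult_right_mono) auto
      moreover have "real (Suc n) / (8 * M) * (r / p) = r / (4 * M * p) + (real n - 1) / p * (r / (8 * M))"
        using pq M by (simp add: field_simps)
      moreover have "real n / (8 * M) * (2 * r / q) = real n * 2 / q * (r / (8 * M))" by simp
      ultimately have "real (Suc n) / (8 * M) * (r / p) \<le> r / (4 * M * p) + real n / (8 * M) * (2 * r / q)"
        by linarith
      also have "\<dots> \<le> r / (4 * M * \<psi> r) + tail (2 * r)" using elim by (simp add: p_def q_def)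
      also have "\<dots> \<le> tail r" using elim by (intro step) auto
      finally show ?case by (simp add: p_def)
    qed
  qed
  then show ?thesis using M by blast
qed

lemma over_tail_tendsto_0:
  assumes rv: "regularly_varying_at_0 \<psi> 1"
  shows "((\<lambda>r. r / \<psi> r / tail r) \<longlongrightarrow> 0) (at_right 0)"
proof (rule tendstoI)
  fix e :: real assume e: "0 < e"
  obtain M where M: "0 < M" and le: "\<And>n::nat. \<forall>\<^sub>F r in at_right 0. real n / (8 * M) * (r / \<psi> r) \<le> tail r"
    using tail_ge[OF rv] by blast
  obtain n where n: "8 * M / e < real n" using reals_Archimedean2 by blast
  show "\<forall>\<^sub>F r in at_right 0. dist (r / \<psi> r / tail r) 0 < e"
    using le[of n] eventually_at_right_less[of "0::real"]
  proof eventually_elim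
    case (elim r)
    define y where "y = r / \<psi> r"
    have y: "0 < y" using elim pos by (simp add: y_def)
    have "8 * M < e * real n" using n e by (simp add: field_simps)
    then have "y * (8 * M) < y * (e * real n)" using y by (rule mult_strict_left_mono)
    then have "y < e * (real n / (8 * M) * y)" using M by (simp add: field_simps)
    also have "\<dots> \<le> e * tail r" using elim e unfolding y_def by (intro mult_left_mono) auto
    finally have "y / tail r < e" using tail_pos[of r] elim by (simp add: divide_less_eq)
    then show ?case using tail_pos[of r] elim y by (simp add: dist_real_def flip: y_def)
  qed
qed

lemma psi_over_tail_tendsto_0: "((\<lambda>r. \<psi> r / tail r) \<longlongrightarrow> 0) (at_right 0)"
proof (rule Lim_null_comparison)
  have "isCont \<psi> 0" using cont by (simp add: continuous_on_eq_continuous_at)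
  then have "(\<psi> \<longlongrightarrow> 0) (at_right 0)" by (simp add: isCont_def filterlim_at_split)
  then show "((\<lambda>r. \<psi> r * (1 / tail 1)) \<longlongrightarrow> 0) (at_right 0)" by (rule tendsto_mult_left_zero)
  show "\<forall>\<^sub>F r in at_right 0. norm (\<psi> r / tail r) \<le> \<psi> r * (1 / tail 1)"
    using eventually_at_right_le[OF zero_less_one]
  proof eventually_elim
    case (elim r)
    then show ?case using tail_pos[of r] tail_pos[of 1] tail_antimono[of r 1]
      by (simp add: abs_mult) (intro divide_left_mono mult_pos_pos, auto)
  qed
qed

text \<open>The error when the resolvent \<open>\<integral> 1 / (\<psi> r + \<psi> s) ds\<close> is replaced by the tail integral from \<open>r\<close>.\<close>

lemma tail_error:
  assumes rv: "regularly_varying_at_0 \<psi> 1"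
  shows "\<exists>E. ((\<lambda>r. E r / tail r) \<longlongrightarrow> 0) (at_right 0) \<and>
     (\<forall>\<^sub>F r in at_right 0. set_integrable lborel {r<..} (\<lambda>s. \<psi> r / (\<psi> s)\<^sup>2) \<and>
        r / \<psi> r + (LBINT s:{r<..}. \<psi> r / (\<psi> s)\<^sup>2) \<le> E r)"
proof -
  \<comment> \<open>The exponent \<open>3/4\<close> is below the index 1, as
    \<open>rv_lower_bound\<close> demands, and above \<open>1/2\<close>, so that the square of the
    lower bound has an integrable reciprocal.\<close>
  obtain c r1 where c: "0 < c" "0 < r1"
    and le: "\<And>r s. 0 < r \<Longrightarrow> 1 \<le> s \<Longrightarrow> s * r \<le> r1 \<Longrightarrow> c * s powr (3/4) * \<psi> r \<le> \<psi> (s * r)"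
    using rv_lower_bound[OF rv, of "3/4"] by auto
  obtain b where b: "0 < b" "\<And>s. r1 \<le> s \<Longrightarrow> b \<le> \<psi> s" using bounded_below[OF c(2)] by blast
  define I where "I = (LBINT s:{1::real..}. s powr (- (3/2)))"
  define E where "E r = (1 + I / c\<^sup>2) * (r / \<psi> r) + \<psi> r * (tail r1 / b)" for r
  have "((\<lambda>r. (1 + I / c\<^sup>2) * (r / \<psi> r / tail r) + (\<psi> r / tail r) * (tail r1 / b)) \<longlongrightarrow> (1 + I / c\<^sup>2) * 0 + 0 * (tail r1 / b)) (at_right 0)"
    by (intro tendsto_intros over_tail_tendsto_0 rv psi_over_tail_tendsto_0)
  then have lim: "((\<lambda>r. E r / tail r) \<longlongrightarrow> 0) (at_right 0)"
    by (simp add: E_def add_divide_distrib mult.commute)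
  have main: "set_integrable lborel {r<..} (\<lambda>s. \<psi> r / (\<psi> s)\<^sup>2) \<and>
        r / \<psi> r + (LBINT s:{r<..}. \<psi> r / (\<psi> s)\<^sup>2) \<le> E r" if r: "0 < r \<and> r \<le> r1" for r
  proof -
    have pr: "0 < \<psi> r" using pos r by auto
    \<comment> \<open>Majorant for \<open>r < s \<le> r1\<close>, from the squared lower bound.
      Beyond \<open>r1\<close> one factor \<open>\<psi> s\<close> is bounded below by
      \<open>b\<close> and the other is left to the tail integral.\<close>
    define g where "g s = 1 / (c\<^sup>2 * \<psi> r) * (s / r) powr (- (3/2))" for s
    have g_has: "has_bochner_integral lborel (\<lambda>s. indicator {r..} s *\<^sub>R g s) (r / (c\<^sup>2 * \<psi> r) * I)"
    proof -
      have "has_bochner_integral lborel (\<lambda>s. indicator {1..} s *\<^sub>R (s powr (- (3/2)))) I"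
        using set_integrable_powr_at_top[of "3/2"] by (simp add: has_bochner_integral_iff I_def set_lebesgue_integral_def set_integrable_def)
      then have "has_bochner_integral lborel (\<lambda>s. indicator {1..} (0 + (1 / r) * s) *\<^sub>R ((0 + (1 / r) * s) powr (- (3/2)))) (I /\<^sub>R \<bar>1 / r\<bar>)"
        by (rule lborel_has_bochner_integral_real_affine_iff[THEN iffD1, rotated]) (use r in auto)
      then have "has_bochner_integral lborel (\<lambda>s. 1 / (c\<^sup>2 * \<psi> r) * (indicator {1..} (0 + (1 / r) * s) *\<^sub>R ((0 + (1 / r) * s) powr (- (3/2))))) (1 / (c\<^sup>2 * \<psi> r) * (I /\<^sub>R \<bar>1 / r\<bar>))"
        by (rule has_bochner_integral_mult_right) 
      moreover have "(\<lambda>s. 1 / (c\<^sup>2 * \<psi> r) * (indicator {1..} (0 + (1 / r) * s) *\<^sub>R ((0 + (1 / r) * s) powr (- (3/2))))) = (\<lambda>s. indicator {r..} s *\<^sub>R g s)"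
        using r by (auto simp: fun_eq_iff g_def indicator_def field_simps)
      moreover have "1 / (c\<^sup>2 * \<psi> r) * (I /\<^sub>R \<bar>1 / r\<bar>) = r / (c\<^sup>2 * \<psi> r) * I" using r by simp
      ultimately show ?thesis by (simp only:)
    qed
    define w where "w s = indicator {r..} s *\<^sub>R g s + \<psi> r / b * (indicator {r1<..} s *\<^sub>R (1 / \<psi> s))" for s
    have w_has: "has_bochner_integral lborel w (r / (c\<^sup>2 * \<psi> r) * I + \<psi> r / b * tail r1)"
      unfolding w_def
      using integrable_tail[OF c(2)] g_has
      by (intro has_bochner_integral_add has_bochner_integral_mult_right)
         (auto simp: has_bochner_integral_iff tail_def set_lebesgue_integral_def set_integrable_def)
    have bound: "\<bar>indicator {r<..} s *\<^sub>R (\<psi> r / (\<psi> s)\<^sup>2)\<bar> \<le> w s" for s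
    proof -
      consider "s \<le> r" | "r < s" "s \<le> r1" | "r1 < s" by linarith
      then show ?thesis
      proof cases
        case 1
        then show ?thesis using pr c b by (auto simp: w_def g_def)
      next
        case 2
        have ps: "0 < \<psi> s" using pos 2 r by auto
        have "c * (s / r) powr (3/4) * \<psi> r \<le> \<psi> s" using le[of r "s / r"] 2 r by simp
        then have "(c * (s / r) powr (3/4) * \<psi> r)\<^sup>2 \<le> (\<psi> s)\<^sup>2"
          using c pr by (intro power_mono) auto
        moreover have "(c * (s / r) powr (3/4) * \<psi> r)\<^sup>2 = c\<^sup>2 * (s / r) powr (3/2) * (\<psi> r)\<^sup>2"
          using r 2 by (simp add: power_mult_distrib powr_power)
        ultimately have "\<psi> r / (\<psi> s)\<^sup>2 \<le> \<psi> r / (c\<^sup>2 * (s / r) powr (3/2) * (\<psi> r)\<^sup>2)"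
          using ps pr c 2 r by (intro divide_left_mono mult_pos_pos) auto
        also have "\<dots> = g s" using pr by (simp add: g_def powr_minus power2_eq_square field_simps)
        finally show ?thesis using 2 pr by (simp add: w_def)
      next
        case 3
        have "0 < \<psi> s" "b \<le> \<psi> s" using b 3 by (auto intro: order_less_le_trans)
        then have "\<psi> r / (\<psi> s)\<^sup>2 \<le> \<psi> r / (b * \<psi> s)"
          using b pr by (intro divide_left_mono mult_pos_pos) (auto simp: power2_eq_square)
        moreover have "0 \<le> g s" using pr c by (simp add: g_def)
        ultimately show ?thesis using 3 pr r by (simp add: w_def)
      qed
    qed
    have int: "set_integrable lborel {r<..} (\<lambda>s. \<psi> r / (\<psi> s)\<^sup>2)"
      unfolding set_integrable_def
      by (rule Bochner_Integration.integrable_bound[of _ w]) (use w_has bound in \<open>auto simp: has_bochner_integral_iff intro!: AE_I2 order_trans[OF _ abs_ge_self]\<close>)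
    have "(LBINT s:{r<..}. \<psi> r / (\<psi> s)\<^sup>2) \<le> (\<integral>s. w s \<partial>lborel)"
      unfolding set_lebesgue_integral_def
      using int w_has order_trans[OF abs_ge_self bound]
      by (intro integral_mono) (auto simp: set_integrable_def has_bochner_integral_iff)
    also have "\<dots> = r / (c\<^sup>2 * \<psi> r) * I + \<psi> r / b * tail r1" using w_has by (simp add: has_bochner_integral_iff)
    finally show ?thesis using int by (simp add: E_def algebra_simps)
  qed
  show ?thesis
    by (rule exI[of _ E], rule conjI[OF lim], rule eventually_mono[OF eventually_at_right_le[OF c(2)]], rule main)
qed

text \<open>One majorant \<open>D\<close> serves both differences: above \<open>r\<close> it bounds
  the error of removing or rescaling the summand \<open>\<psi> r\<close> in the denominator, below
  \<open>r\<close> it is the crude bound \<open>1 / \<psi> r\<close>. The factor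
  \<open>a - 1\<close> appears because the denominators differ by
  \<open>(a - 1) * \<psi> r\<close>.\<close>

lemma resolvent_tail_estimates:
  assumes l: "0 < r" and int: "set_integrable lborel {r<..} (\<lambda>s. \<psi> r / (\<psi> s)\<^sup>2)"
    and E: "r / \<psi> r + (LBINT s:{r<..}. \<psi> r / (\<psi> s)\<^sup>2) \<le> E"
  shows "\<bar>resolvent (\<psi> r) - tail r\<bar> \<le> E"
    and "1 \<le> a \<Longrightarrow> \<bar>resolvent (a * \<psi> r) - resolvent (\<psi> r)\<bar> \<le> (a - 1) * E"
proof -
  have pr: "0 < \<psi> r" using pos l by simp
  define D where "D s = indicator {0<..r} s * (1 / \<psi> r) + indicator {r<..} s *\<^sub>R (\<psi> r / (\<psi> s)\<^sup>2)" for s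
  have D_has: "has_bochner_integral lborel D (r / \<psi> r + (LBINT s:{r<..}. \<psi> r / (\<psi> s)\<^sup>2))"
  proof -
    have "has_bochner_integral lborel (\<lambda>s. indicator {0<..r} s * (1 / \<psi> r)) (measure lborel {0<..r} * (1 / \<psi> r))"
      by (intro has_bochner_integral_mult_left has_bochner_integral_real_indicator) (use l in auto)
    moreover have "has_bochner_integral lborel (\<lambda>s. indicator {r<..} s *\<^sub>R (\<psi> r / (\<psi> s)\<^sup>2)) (LBINT s:{r<..}. \<psi> r / (\<psi> s)\<^sup>2)"
      using int by (simp add: has_bochner_integral_iff set_lebesgue_integral_def set_integrable_def)
    ultimately show ?thesis unfolding D_def using l by (auto dest: has_bochner_integral_add)
  qed
  have D: "integrable lborel D" "(\<integral>s. D s \<partial>lborel) \<le> E"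
    using D_has E by (auto simp: has_bochner_integral_iff)
  have res: "integrable lborel (\<lambda>s. indicator {0<..} s *\<^sub>R (1 / (a * \<psi> r + \<psi> s)))" if "0 < a" for a
    using integrable_resolvent[of "a * \<psi> r"] that pr by (simp add: set_integrable_def)
  have tl: "integrable lborel (\<lambda>s. indicator {r<..} s *\<^sub>R (1 / \<psi> s))"
    using integrable_tail[OF l] by (simp add: set_integrable_def)
  have "resolvent (\<psi> r) - tail r = (\<integral>s. indicator {0<..} s *\<^sub>R (1 / (1 * \<psi> r + \<psi> s)) - indicator {r<..} s *\<^sub>R (1 / \<psi> s) \<partial>lborel)"
    using res[of 1] tl by (subst Bochner_Integration.integral_diff) (auto simp: resolvent_def tail_def set_lebesgue_integral_def)
  also have "\<bar>\<dots>\<bar> \<le> (\<integral>s. D s \<partial>lborel)"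
  proof (intro integral_abs_bound_integral Bochner_Integration.integrable_diff res tl D)
    fix s
    consider "s \<le> 0" | "0 < s" "s \<le> r" | "r < s" by linarith
    then show "\<bar>indicator {0<..} s *\<^sub>R (1 / (1 * \<psi> r + \<psi> s)) - indicator {r<..} s *\<^sub>R (1 / \<psi> s)\<bar> \<le> D s"
    proof cases
      case 2
      have "1 / (\<psi> r + \<psi> s) \<le> 1 / \<psi> r" using pr by (intro divide_left_mono) (auto intro!: mult_pos_pos add_pos_nonneg)
      then show ?thesis using 2 by (simp add: D_def)
    next
      case 3
      then have ps: "0 < \<psi> s" using pos l by auto
      have "1 / q - 1 / (p + q) = p / ((p + q) * q)" if "0 < p" "0 < q" for p q :: real
      proof -
        have "0 < p + q" using that by simp
        then show ?thesis using that by (simp add: field_simps)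
      qed
      from this[OF pr ps] have "\<bar>1 / (\<psi> r + \<psi> s) - 1 / \<psi> s\<bar> = \<psi> r / ((\<psi> r + \<psi> s) * \<psi> s)"
        using pr ps by (subst abs_minus_commute) (simp only: abs_of_nonneg divide_nonneg_nonneg mult_nonneg_nonneg add_nonneg_nonneg less_imp_le)
      also have "\<dots> \<le> \<psi> r / (\<psi> s)\<^sup>2"
        using pr ps by (intro divide_left_mono mult_pos_pos) (auto simp: power2_eq_square add_pos_pos)
      finally show ?thesis using 3 l by (simp add: D_def)
    qed (use l in \<open>auto simp: D_def\<close>)
  qed simp
  finally show "\<bar>resolvent (\<psi> r) - tail r\<bar> \<le> E" using D(2) by simp
  assume a: "1 \<le> a"
  have "resolvent (a * \<psi> r) - resolvent (\<psi> r) = (\<integral>s. indicator {0<..} s *\<^sub>R (1 / (a * \<psi> r + \<psi> s)) - indicator {0<..} s *\<^sub>R (1 / (1 * \<psi> r + \<psi> s)) \<partial>lborel)"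
    using res[of 1] res[of a] a by (subst Bochner_Integration.integral_diff) (auto simp: resolvent_def set_lebesgue_integral_def)
  also have "\<bar>\<dots>\<bar> \<le> (\<integral>s. (a - 1) * D s \<partial>lborel)"
  proof (intro integral_abs_bound_integral Bochner_Integration.integrable_diff res integrable_mult_right D)
    fix s
    have eq: "\<bar>1 / (a * p + q) - 1 / (p + q)\<bar> = (a - 1) * (p / ((a * p + q) * (p + q)))" if "0 < p" "0 \<le> q" for p q
    proof -
      have "0 < a * p + q" "0 < p + q" "p \<le> a * p" using that a by (auto intro!: add_pos_nonneg)
      then have "1 / (p + q) - 1 / (a * p + q) = (a - 1) * (p / ((a * p + q) * (p + q)))"
        by (simp add: field_simps)
      moreover have "0 \<le> (a - 1) * (p / ((a * p + q) * (p + q)))"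
        using \<open>0 < a * p + q\<close> \<open>0 < p + q\<close> a that by simp
      ultimately show ?thesis by linarith
    qed
    consider "s \<le> 0" | "0 < s" "s \<le> r" | "r < s" by linarith
    then show "\<bar>indicator {0<..} s *\<^sub>R (1 / (a * \<psi> r + \<psi> s)) - indicator {0<..} s *\<^sub>R (1 / (1 * \<psi> r + \<psi> s))\<bar> \<le> (a - 1) * D s"
    proof cases
      case 2
      have "\<psi> r \<le> a * \<psi> r" using a pr by simp
      then have "\<psi> r * \<psi> r \<le> (a * \<psi> r + \<psi> s) * (\<psi> r + \<psi> s)"
        using pr by (intro mult_mono) (auto intro: add_increasing2)
      then have h: "\<psi> r / ((a * \<psi> r + \<psi> s) * (\<psi> r + \<psi> s)) \<le> \<psi> r / (\<psi> r * \<psi> r)"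
        using pr a by (intro divide_left_mono mult_pos_pos) (auto intro!: add_pos_nonneg)
      show ?thesis using mult_left_mono[OF h, of "a - 1"] 2 a pr eq[OF pr nonneg, of s] by (simp add: D_def)
    next
      case 3
      then have ps: "0 < \<psi> s" using pos l by auto
      have "\<psi> s * \<psi> s \<le> (a * \<psi> r + \<psi> s) * (\<psi> r + \<psi> s)"
        using pr ps a by (intro mult_mono) (auto intro: add_nonneg_nonneg)
      then have h: "\<psi> r / ((a * \<psi> r + \<psi> s) * (\<psi> r + \<psi> s)) \<le> \<psi> r / (\<psi> s)\<^sup>2"
        using pr ps a by (intro divide_left_mono mult_pos_pos) (auto intro!: add_pos_nonneg simp: power2_eq_square)
      show ?thesis using mult_left_mono[OF h, of "a - 1"] 3 a l eq[OF pr nonneg, of s] by (simp add: D_def)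
    qed (use l a in \<open>auto simp: D_def\<close>)
  qed (use a in simp_all)
  also have "\<dots> \<le> (a - 1) * E" using D(2) a by (simp add: mult_left_mono)
  finally show "\<bar>resolvent (a * \<psi> r) - resolvent (\<psi> r)\<bar> \<le> (a - 1) * E" .
qed

text \<open>The errors \<open>E\<close> and \<open>(a - 1) * E\<close> add up to
  \<open>a * E\<close>, which is small against the tail. The factor \<open>a\<close> is carried
  along because a comparison with the case \<open>a = 1\<close> yields slow variation of both the
  resolvent and the tail.\<close>

lemma resolvent_over_tail:
  assumes rv: "regularly_varying_at_0 \<psi> 1" and a: "1 \<le> a"
  shows "((\<lambda>l. resolvent (a * l) / tail (inv_exponent \<psi> l)) \<longlongrightarrow> 1) (at_right 0)"
proof -
  obtain E where lim: "((\<lambda>r. E r / tail r) \<longlongrightarrow> 0) (at_right 0)"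
    and E: "\<forall>\<^sub>F r in at_right 0. set_integrable lborel {r<..} (\<lambda>s. \<psi> r / (\<psi> s)\<^sup>2) \<and>
        r / \<psi> r + (LBINT s:{r<..}. \<psi> r / (\<psi> s)\<^sup>2) \<le> E r"
    using tail_error[OF rv] by blast
  have "((\<lambda>r. resolvent (a * \<psi> r) / tail r - 1) \<longlongrightarrow> 0) (at_right 0)"
  proof (rule Lim_null_comparison)
    show "((\<lambda>r. a * (E r / tail r)) \<longlongrightarrow> 0) (at_right 0)" by (rule tendsto_mult_right_zero[OF lim])
    show "\<forall>\<^sub>F r in at_right 0. norm (resolvent (a * \<psi> r) / tail r - 1) \<le> a * (E r / tail r)"
      using E eventually_at_right_less[of "0::real"]
    proof eventually_elim
      case (elim r)
      have t: "0 < tail r" using tail_pos elim by simp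
      have "\<bar>resolvent (a * \<psi> r) - tail r\<bar> \<le> a * E r"
        using resolvent_tail_estimates(1)[of r "E r"] resolvent_tail_estimates(2)[of r "E r" a] elim a
        by (simp add: algebra_simps)
      then have "\<bar>resolvent (a * \<psi> r) - tail r\<bar> / tail r \<le> a * E r / tail r"
        using t by (intro divide_right_mono) auto
      moreover have "\<bar>resolvent (a * \<psi> r) - tail r\<bar> / tail r = \<bar>resolvent (a * \<psi> r) / tail r - 1\<bar>"
        using t by (simp add: diff_divide_distrib[symmetric] field_simps)
      ultimately show ?case by simp
    qed
  qed
  from tendsto_add[OF this tendsto_const[of 1]]
  have "((\<lambda>r. resolvent (a * \<psi> r) / tail r) \<longlongrightarrow> 1) (at_right 0)" by simp
  from filterlim_compose[OF this inv_exponent_at_right_0]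
  show ?thesis
    by (rule Lim_transform_eventually)
       (use inv_exponent(2) in \<open>auto intro: eventually_mono[OF eventually_at_right_less[of "0::real"]]\<close>)
qed

lemma tail_inv_pos: "0 < l \<Longrightarrow> 0 < tail (inv_exponent \<psi> l)"
  by (intro tail_pos inv_exponent)

lemma resolvent_slowly_varying:
  assumes rv: "regularly_varying_at_0 \<psi> 1" and a: "1 \<le> a"
  shows "((\<lambda>l. resolvent (a * l) / resolvent l) \<longlongrightarrow> 1) (at_right 0)"
proof -
  have "((\<lambda>l. (resolvent (a * l) / tail (inv_exponent \<psi> l)) / (resolvent (1 * l) / tail (inv_exponent \<psi> l))) \<longlongrightarrow> 1 / 1) (at_right 0)"
    by (intro tendsto_divide resolvent_over_tail rv a) auto
  then have "((\<lambda>l. (resolvent (a * l) / tail (inv_exponent \<psi> l)) / (resolvent (1 * l) / tail (inv_exponent \<psi> l))) \<longlongrightarrow> 1) (at_right 0)"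
    by simp
  then show ?thesis
  proof (rule Lim_transform_eventually)
    show "\<forall>\<^sub>F l in at_right 0. (resolvent (a * l) / tail (inv_exponent \<psi> l)) / (resolvent (1 * l) / tail (inv_exponent \<psi> l)) = resolvent (a * l) / resolvent l"
      using eventually_at_right_less[of "0::real"]
    proof eventually_elim
      case (elim l)
      then show ?case using tail_inv_pos[OF elim] by simp
    qed
  qed
qed

text \<open>\<open>resolvent (a * l)\<close> is asymptotic both to the tail beyond
  \<open>inv_exponent \<psi> (a * l)\<close> and to the tail beyond
  \<open>inv_exponent \<psi> l\<close>. Factors below 1 are reduced to \<open>1 / a\<close> by
  passing to the variable \<open>a * l\<close>.\<close>

lemma tail_slowly_varying:
  assumes rv: "regularly_varying_at_0 \<psi> 1"
  shows "slowly_varying_at_0 (\<lambda>u. tail (inv_exponent \<psi> u))"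
proof -
  define L where "L u = tail (inv_exponent \<psi> u)" for u
  have Lpos: "0 < L u" if "0 < u" for u using tail_inv_pos[OF that] by (simp add: L_def)
  have scale: "filterlim (\<lambda>l. a * l) (at_right 0) (at_right 0)" if "0 < a" for a :: real
    by (rule filterlim_times_pos[of "\<lambda>x. x" 0 _ a 0]) (use that in \<open>auto simp: filterlim_ident\<close>)
  have ge1: "((\<lambda>l. L (a * l) / L l) \<longlongrightarrow> 1) (at_right 0)" if a: "1 \<le> a" for a
  proof -
    have 1: "((\<lambda>l. resolvent (1 * (a * l)) / L (a * l)) \<longlongrightarrow> 1) (at_right 0)"
      unfolding L_def by (rule filterlim_compose[OF resolvent_over_tail[OF rv order_refl] scale]) (use a in simp)
    have 2: "((\<lambda>l. resolvent (a * l) / L l) \<longlongrightarrow> 1) (at_right 0)"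
      unfolding L_def by (rule resolvent_over_tail[OF rv a])
    have "((\<lambda>l. (resolvent (a * l) / L l) / (resolvent (1 * (a * l)) / L (a * l))) \<longlongrightarrow> 1 / 1) (at_right 0)"
      by (intro tendsto_divide 1 2) auto
    then have "((\<lambda>l. (resolvent (a * l) / L l) / (resolvent (1 * (a * l)) / L (a * l))) \<longlongrightarrow> 1) (at_right 0)" by simp
    then show ?thesis
    proof (rule Lim_transform_eventually)
      show "\<forall>\<^sub>F l in at_right 0. (resolvent (a * l) / L l) / (resolvent (1 * (a * l)) / L (a * l)) = L (a * l) / L l"
        using eventually_at_right_less[of "0::real"]
      proof eventually_elim
        case (elim l)
        then have "0 < resolvent (a * l)" using a by (intro resolvent_pos) auto
        then show ?case by simp
      qed
    qed
  qed
  have "((\<lambda>l. L (a * l) / L l) \<longlongrightarrow> 1) (at_right 0)" if a: "0 < a" for a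
  proof (cases "1 \<le> a")
    case False
    then have "((\<lambda>l. L (1 / a * (a * l)) / L (a * l)) \<longlongrightarrow> 1) (at_right 0)"
      using a by (intro filterlim_compose[OF ge1 scale]) auto
    from tendsto_inverse[OF this] show ?thesis using a by simp
  qed (rule ge1)
  then show ?thesis by (simp add: regularly_varying_at_0_def L_def)
qed

end

section \<open>Levy processes\<close>

lemma (in symmetric_levy_process) integrable_one_minus_cos: "integrable \<nu> (\<lambda>x. 1 - cos (\<xi> * x))"
proof (rule Bochner_Integration.integrable_bound)
  show "integrable \<nu> (\<lambda>x. max 2 (\<xi>\<^sup>2 / 2) * min 1 (x\<^sup>2))"
    using levy_measure by (simp add: levy_measure_def)
  have [measurable_cong]: "sets \<nu> = sets borel" using levy_measure by (simp add: levy_measure_def)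
  show "(\<lambda>x. 1 - cos (\<xi> * x)) \<in> borel_measurable \<nu>" by measurable
  show "AE x in \<nu>. norm (1 - cos (\<xi> * x)) \<le> norm (max 2 (\<xi>\<^sup>2 / 2) * min 1 (x\<^sup>2))"
    using one_minus_cos_le[of \<xi>] by (auto simp: abs_mult)
qed

lemma one_minus_cos_double_le: "1 - cos (2 * x) \<le> 4 * (1 - cos x)" for x :: real
proof -
  have "1 - cos (2 * x) = 2 * ((1 + cos x) * (1 - cos x))"
    using cos_double_cos[of x] by (simp add: algebra_simps power2_eq_square)
  also have "\<dots> \<le> 2 * (2 * (1 - cos x))"
    by (intro mult_left_mono mult_right_mono) (auto intro: order_trans[OF add_left_mono[OF cos_le_one]])
  finally show ?thesis by simp
qed

text \<open>In half-angle form \<open>1 - cos z\<close> is twice a squared sine. The modulus of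
  \<open>sin ((x + y) / 2)\<close> is at most the sum of those of \<open>sin (x / 2)\<close> and
  \<open>sin (y / 2)\<close>, and squaring a sum costs the factor 2.\<close>

lemma one_minus_cos_add_le: "1 - cos (x + y) \<le> 2 * (1 - cos x) + 2 * (1 - cos y)" for x y :: real
proof -
  have half: "1 - cos z = 2 * (sin (z / 2))\<^sup>2" for z :: real using cos_double_sin[of "z / 2"] by simp
  have "(sin (x / 2) * cos (y / 2))\<^sup>2 \<le> (sin (x / 2))\<^sup>2" "(cos (x / 2) * sin (y / 2))\<^sup>2 \<le> (sin (y / 2))\<^sup>2"
    by (auto simp: power_mult_distrib abs_square_le_1 intro!: mult_left_le mult_left_le_one_le)
  moreover have "(sin ((x + y) / 2))\<^sup>2 = (sin (x / 2) * cos (y / 2) + cos (x / 2) * sin (y / 2))\<^sup>2"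
    by (simp add: add_divide_distrib sin_add)
  moreover have "(u + v)\<^sup>2 \<le> 2 * u\<^sup>2 + 2 * v\<^sup>2" for u v :: real
    using zero_le_power2[of "u - v"] by (simp add: power2_eq_square algebra_simps)
  from this[of "sin (x / 2) * cos (y / 2)" "cos (x / 2) * sin (y / 2)"]
  have "(sin (x / 2) * cos (y / 2) + cos (x / 2) * sin (y / 2))\<^sup>2 \<le> 2 * (sin (x / 2) * cos (y / 2))\<^sup>2 + 2 * (cos (x / 2) * sin (y / 2))\<^sup>2" .
  ultimately show ?thesis unfolding half by linarith
qed

lemma (in symmetric_levy_process) exponent:
  assumes "set_integrable lborel {0<..} (\<lambda>x. 1 / (1 + \<psi> x))"
  shows "exponent \<psi>"
proof
  note int = integrable_one_minus_cos
  interpret D: real_distribution "distr M borel (X 1)"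
    using random_variable_X[of 1] by (intro real_distribution_distr) auto
  \<comment> \<open>Continuity comes from the law of \<open>X 1\<close>: its characteristic function
    is continuous, real and positive, and \<open>\<psi>\<close> is minus its logarithm.\<close>
  have "\<psi> = (\<lambda>\<xi>. - ln (Re (char (distr M borel (X 1)) \<xi>)))"
    using char_exponent[of 1] by (auto simp: fun_eq_iff)
  moreover have "continuous_on UNIV (\<lambda>\<xi>. - ln (Re (char (distr M borel (X 1)) \<xi>)))"
    using char_exponent[of 1]
    by (intro continuous_intros continuous_at_imp_continuous_on ballI D.isCont_char) auto
  ultimately show "continuous_on UNIV \<psi>" by simp
  show "\<psi> 0 = 0" by (simp add: levy_khintchine)
  show "\<psi> (- s) = \<psi> s" for s by (simp add: levy_khintchine)
  show "0 \<le> \<psi> s" for s by (simp add: levy_khintchine)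
  show "\<psi> (a + b) \<le> 2 * \<psi> a + 2 * \<psi> b" for a b
  proof -
    have "(\<integral>x. 1 - cos ((a + b) * x) \<partial>\<nu>) \<le> (\<integral>x. 2 * (1 - cos (a * x)) + 2 * (1 - cos (b * x)) \<partial>\<nu>)"
      using one_minus_cos_add_le by (intro integral_mono Bochner_Integration.integrable_add integrable_mult_right int) (simp add: distrib_right)
    also have "\<dots> = 2 * (\<integral>x. 1 - cos (a * x) \<partial>\<nu>) + 2 * (\<integral>x. 1 - cos (b * x) \<partial>\<nu>)"
      using int by (subst Bochner_Integration.integral_add) (auto simp del: right_diff_distrib_numeral)
    finally have "(\<integral>x. 1 - cos ((a + b) * x) \<partial>\<nu>) \<le> 2 * (\<integral>x. 1 - cos (a * x) \<partial>\<nu>) + 2 * (\<integral>x. 1 - cos (b * x) \<partial>\<nu>)" .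
    moreover have "\<sigma>\<^sup>2 * (a + b)\<^sup>2 \<le> \<sigma>\<^sup>2 * (2 * a\<^sup>2 + 2 * b\<^sup>2)"
      using zero_le_power2[of "a - b"] by (intro mult_left_mono) (auto simp: power2_eq_square algebra_simps)
    ultimately show ?thesis by (simp add: levy_khintchine distrib_left)
  qed
  show "\<psi> (2 * s) \<le> 4 * \<psi> s" for s
  proof -
    have "(\<integral>x. 1 - cos (2 * s * x) \<partial>\<nu>) \<le> (\<integral>x. 4 * (1 - cos (s * x)) \<partial>\<nu>)"
    proof (intro integral_mono integrable_mult_right int)
      show "1 - cos (2 * s * x) \<le> 4 * (1 - cos (s * x))" for x
        using one_minus_cos_double_le[of "s * x"] by (simp add: mult.assoc)
    qed
    then show ?thesis by (simp add: levy_khintchine power_mult_distrib del: right_diff_distrib_numeral)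
  qed
qed (rule assms)

text \<open>Symmetric Levy processes without exceptional null set; \<open>markov\<close> combines the independence and
  the stationarity of the increments.\<close>

locale regular_levy_process = prob_space M + exponent \<psi>
  for M :: "'a measure" and \<psi> :: "real \<Rightarrow> real" +
  fixes X :: "real \<Rightarrow> 'a \<Rightarrow> real"
  assumes X_measurable [measurable]: "\<And>t. X t \<in> borel_measurable M"
    and X_0: "\<And>\<omega>. \<omega> \<in> space M \<Longrightarrow> X 0 \<omega> = 0"
    and X_right: "\<And>\<omega> t. \<omega> \<in> space M \<Longrightarrow> ((\<lambda>s. X s \<omega>) \<longlongrightarrow> X t \<omega>) (at_right t)"
    and X_left: "\<And>\<omega> t. \<omega> \<in> space M \<Longrightarrow> 0 < t \<Longrightarrow> \<exists>l. ((\<lambda>s. X s \<omega>) \<longlongrightarrow> l) (at_left t)"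
    and char_X: "\<And>t \<xi>. 0 \<le> t \<Longrightarrow> char (distr M borel (X t)) \<xi> = complex_of_real (exp (- t * \<psi> \<xi>))"
    and markov: "\<And>(\<tau> :: nat \<Rightarrow> real) k s F g c d. 0 \<le> \<tau> 0 \<Longrightarrow> (\<And>i. i < k \<Longrightarrow> \<tau> i \<le> \<tau> (Suc i)) \<Longrightarrow> 0 \<le> s \<Longrightarrow>
      F \<in> borel_measurable (PiM {..k} (\<lambda>_. borel)) \<Longrightarrow> g \<in> borel_measurable borel \<Longrightarrow>
      (\<And>y. \<bar>F y\<bar> \<le> (c::real)) \<Longrightarrow> (\<And>z. \<bar>g z\<bar> \<le> (d::real)) \<Longrightarrow>
      (\<integral>\<omega>. F (\<lambda>j\<in>{..k}. X (\<tau> j) \<omega>) * g (X (\<tau> k + s) \<omega> - X (\<tau> k) \<omega>) \<partial>M)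
        = (\<integral>\<omega>. F (\<lambda>j\<in>{..k}. X (\<tau> j) \<omega>) \<partial>M) * (\<integral>\<omega>. g (X s \<omega>) \<partial>M)"

section \<open>The Markov property and the passage to regular paths\<close>

lemma (in levy_process) markov_property:
  fixes \<tau> :: "nat \<Rightarrow> real" and F :: "(nat \<Rightarrow> real) \<Rightarrow> real" and g :: "real \<Rightarrow> real"
  assumes \<tau>: "0 \<le> \<tau> 0" "\<And>i. i < k \<Longrightarrow> \<tau> i \<le> \<tau> (Suc i)" and s: "0 \<le> s"
    and F[measurable]: "F \<in> borel_measurable (PiM {..k} (\<lambda>_. borel))" and g[measurable]: "g \<in> borel_measurable borel"
    and Fc: "\<And>y. \<bar>F y\<bar> \<le> c" and gd: "\<And>z. \<bar>g z\<bar> \<le> d"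
  shows "(\<integral>\<omega>. F (\<lambda>j\<in>{..k}. X (\<tau> j) \<omega>) * g (X (\<tau> k + s) \<omega> - X (\<tau> k) \<omega>) \<partial>M)
        = (\<integral>\<omega>. F (\<lambda>j\<in>{..k}. X (\<tau> j) \<omega>) \<partial>M) * (\<integral>\<omega>. g (X s \<omega>) \<partial>M)"
proof -
  \<comment> \<open>Time 0 is put in front and \<open>\<tau> k + s\<close> at the end, shifting
    indices by one. The positions \<open>X (\<tau> j)\<close> are then partial sums of the first
    \<open>k + 1\<close> increments, up to the value \<open>X 0\<close>, and the last increment is
    independent of them.\<close>
  define \<theta> where "\<theta> i = (case i of 0 \<Rightarrow> 0 | Suc i \<Rightarrow> if i \<le> k then \<tau> i else \<tau> k + s)" for i
  have \<tau>nn: "0 \<le> \<tau> i" if "i \<le> k" for i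
    using that
  proof (induction i)
    case (Suc i)
    then show ?case using \<tau>(2)[of i] by simp
  qed (use \<tau> in simp)
  have \<theta>nn: "0 \<le> \<theta> i" for i using \<tau>nn s by (auto simp: \<theta>_def split: nat.split)
  have [measurable]: "X (\<theta> i) \<in> borel_measurable M" for i by (rule random_variable_X[OF \<theta>nn])
  have Xs[measurable]: "X s \<in> borel_measurable M" by (rule random_variable_X[OF s])
  have [measurable]: "X (\<tau> k + s) \<in> borel_measurable M" by (rule random_variable_X) (use \<tau>nn s in simp)
  have X\<tau>: "X (\<tau> i) \<in> borel_measurable M" if "i \<le> k" for i by (rule random_variable_X) (use \<tau>nn that in simp)
  have [measurable]: "X (\<tau> k) \<in> borel_measurable M" by (rule X\<tau>) simp
  define inc where "inc i \<omega> = X (\<theta> (Suc i)) \<omega> - X (\<theta> i) \<omega>" for i \<omega>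
  have "indep_vars (\<lambda>_. borel) inc {..<k + 2}"
    unfolding inc_def[abs_def]
  proof (rule indep_increments)
    fix i assume "i < k + 2"
    then show "\<theta> i \<le> \<theta> (Suc i)"
    proof (cases i)
      case (Suc m)
      then have "m < k \<or> m = k" using \<open>i < k + 2\<close> by auto
      then show ?thesis using \<tau> s by (auto simp: \<theta>_def Suc)
    qed (use \<tau> in \<open>simp add: \<theta>_def\<close>)
  qed (simp add: \<theta>_def)
  then have "indep_var (PiM {..k} (\<lambda>_. borel)) (\<lambda>\<omega>. restrict (\<lambda>i. inc i \<omega>) {..k})
      (PiM {Suc k} (\<lambda>_. borel)) (\<lambda>\<omega>. restrict (\<lambda>i. inc i \<omega>) {Suc k})"
    by (rule indep_var_restrict) auto
  then have "indep_var borel ((\<lambda>y. F (\<lambda>j\<in>{..k}. \<Sum>i\<le>j. y i)) \<circ> (\<lambda>\<omega>. restrict (\<lambda>i. inc i \<omega>) {..k}))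
      borel ((\<lambda>y. g (y (Suc k))) \<circ> (\<lambda>\<omega>. restrict (\<lambda>i. inc i \<omega>) {Suc k}))"
    by (rule indep_var_compose) (auto intro!: measurable_compose[OF _ F] measurable_restrict borel_measurable_sum)
  then have ind: "indep_var borel (\<lambda>\<omega>. F (\<lambda>j\<in>{..k}. \<Sum>i\<le>j. inc i \<omega>)) borel (\<lambda>\<omega>. g (inc (Suc k) \<omega>))"
    by (simp add: comp_def cong: restrict_cong)
  have inc_sum: "(\<Sum>i\<le>j. inc i \<omega>) = X (\<theta> (Suc j)) \<omega> - X 0 \<omega>" for j \<omega>
    by (induction j) (auto simp: inc_def \<theta>_def)
  have [measurable]: "inc i \<in> borel_measurable M" for i unfolding inc_def[abs_def] by measurable
  have mF[measurable]: "(\<lambda>\<omega>. F (\<lambda>j\<in>{..k}. \<Sum>i\<le>j. inc i \<omega>)) \<in> borel_measurable M"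
    by (intro measurable_compose[OF _ F] measurable_restrict) measurable
  have mF'[measurable]: "(\<lambda>\<omega>. F (\<lambda>j\<in>{..k}. X (\<tau> j) \<omega>)) \<in> borel_measurable M"
    by (intro measurable_compose[OF _ F] measurable_restrict X\<tau>) auto
  have eq: "AE \<omega> in M. F (\<lambda>j\<in>{..k}. \<Sum>i\<le>j. inc i \<omega>) = F (\<lambda>j\<in>{..k}. X (\<tau> j) \<omega>)"
    using AE_start
  proof eventually_elim
    case (elim \<omega>)
    have "(\<lambda>j\<in>{..k}. \<Sum>i\<le>j. inc i \<omega>) = (\<lambda>j\<in>{..k}. X (\<tau> j) \<omega>)"
      unfolding inc_sum elim by (auto simp: \<theta>_def)
    then show ?case by simp
  qed
  have last: "inc (Suc k) \<omega> = X (\<tau> k + s) \<omega> - X (\<tau> k) \<omega>" for \<omega> by (simp add: inc_def \<theta>_def)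
  have "(\<integral>\<omega>. F (\<lambda>j\<in>{..k}. X (\<tau> j) \<omega>) * g (X (\<tau> k + s) \<omega> - X (\<tau> k) \<omega>) \<partial>M)
      = (\<integral>\<omega>. F (\<lambda>j\<in>{..k}. \<Sum>i\<le>j. inc i \<omega>) * g (inc (Suc k) \<omega>) \<partial>M)"
    using eq by (intro integral_cong_AE) (auto simp: last elim!: eventually_mono)
  also have "\<dots> = (\<integral>\<omega>. F (\<lambda>j\<in>{..k}. \<Sum>i\<le>j. inc i \<omega>) \<partial>M) * (\<integral>\<omega>. g (inc (Suc k) \<omega>) \<partial>M)"
  proof (rule indep_var_lebesgue_integral[OF ind])
    show "integrable M (\<lambda>\<omega>. F (\<lambda>j\<in>{..k}. \<Sum>i\<le>j. inc i \<omega>))"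
      by (rule integrable_const_bound[of _ c]) (auto simp: Fc)
    show "integrable M (\<lambda>\<omega>. g (inc (Suc k) \<omega>))"
      by (rule integrable_const_bound[of _ d]) (auto simp: gd)
  qed
  also have "(\<integral>\<omega>. F (\<lambda>j\<in>{..k}. \<Sum>i\<le>j. inc i \<omega>) \<partial>M) = (\<integral>\<omega>. F (\<lambda>j\<in>{..k}. X (\<tau> j) \<omega>) \<partial>M)"
    using eq by (intro integral_cong_AE) auto
  also have "(\<integral>\<omega>. g (inc (Suc k) \<omega>) \<partial>M) = (\<integral>z. g z \<partial>distr M borel (\<lambda>\<omega>. X (\<tau> k + s) \<omega> - X (\<tau> k) \<omega>))"
    by (subst integral_distr) (auto simp: last)
  also have "distr M borel (\<lambda>\<omega>. X (\<tau> k + s) \<omega> - X (\<tau> k) \<omega>) = distr M borel (X s)"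
    using \<tau>nn[of k] s by (intro stationary_increments) auto
  also have "(\<integral>z. g z \<partial>distr M borel (X s)) = (\<integral>\<omega>. g (X s \<omega>) \<partial>M)"
    by (subst integral_distr) auto
  finally show ?thesis .
qed

lemma (in symmetric_levy_process) regular_modification:
  assumes int: "set_integrable lborel {0<..} (\<lambda>x. 1 / (1 + \<psi> x))"
  shows "\<exists>X'. regular_levy_process M \<psi> X' \<and> (AE \<omega> in M. \<forall>t\<ge>0. X' t \<omega> = X t \<omega>)"
proof -
  have "AE \<omega> in M. X 0 \<omega> = 0 \<and> cadlag (\<lambda>t. X t \<omega>)" using AE_start AE_cadlag by eventually_elim simp
  then obtain N where N: "{\<omega> \<in> space M. \<not> (X 0 \<omega> = 0 \<and> cadlag (\<lambda>t. X t \<omega>))} \<subseteq> N" "N \<in> null_sets M"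
    unfolding eventually_ae_filter by blast
  \<comment> \<open>Paths are set to 0 on the exceptional set and frozen at their initial value for
    negative times, so that measurability and right-continuity hold at every real time.\<close>
  define X' where "X' t \<omega> = (if \<omega> \<in> N then 0 else X (max 0 t) \<omega>)" for t \<omega>
  have good: "X 0 \<omega> = 0" "cadlag (\<lambda>t. X t \<omega>)" if "\<omega> \<in> space M" "\<omega> \<notin> N" for \<omega>
    using N(1) that by auto
  have eq: "AE \<omega> in M. \<forall>t\<ge>0. X' t \<omega> = X t \<omega>"
    using AE_not_in[OF N(2)] by eventually_elim (auto simp: X'_def max_def)
  have [measurable]: "N \<in> sets M" using N(2) by auto
  have meas[measurable]: "X' t \<in> borel_measurable M" for t
  proof -
    have [measurable]: "X (max 0 t) \<in> borel_measurable M" by (rule random_variable_X) simp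
    show ?thesis unfolding X'_def[abs_def] by measurable
  qed
  interpret E: exponent \<psi> by (rule exponent[OF int])
  have "regular_levy_process M \<psi> X'"
  proof
    show "X' t \<in> borel_measurable M" for t by (rule meas)
    show "X' 0 \<omega> = 0" if "\<omega> \<in> space M" for \<omega> using good(1)[OF that] by (simp add: X'_def)
    show "((\<lambda>s. X' s \<omega>) \<longlongrightarrow> X' t \<omega>) (at_right t)" if \<omega>: "\<omega> \<in> space M" for \<omega> t
    proof (cases "\<omega> \<in> N")
      case False
      show ?thesis
      proof (cases "0 \<le> t")
        case True
        then have "((\<lambda>s. X s \<omega>) \<longlongrightarrow> X t \<omega>) (at_right t)"
          using good(2)[OF \<omega> False] by (simp add: cadlag_def)
        moreover have "\<forall>\<^sub>F s in at_right t. X s \<omega> = X' s \<omega>"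
          using eventually_at_right_less[of t] by eventually_elim (use False True in \<open>simp add: X'_def max_def\<close>)
        ultimately show ?thesis using False True by (auto simp: X'_def max_def intro: Lim_transform_eventually)
      next
        case neg: False
        have "\<forall>\<^sub>F s in at_right t. s < 0" using neg by (intro eventually_at_rightI[of t 0]) auto
        then have "\<forall>\<^sub>F s in at_right t. X' t \<omega> = X' s \<omega>"
          by eventually_elim (use neg in \<open>simp add: X'_def max_def\<close>)
        then show ?thesis by (rule Lim_transform_eventually[OF tendsto_const])
      qed
    qed (simp add: X'_def)
    show "\<exists>l. ((\<lambda>s. X' s \<omega>) \<longlongrightarrow> l) (at_left t)" if \<omega>: "\<omega> \<in> space M" and t: "0 < t" for \<omega> t
    proof (cases "\<omega> \<in> N")
      case False
      then obtain l where "((\<lambda>s. X s \<omega>) \<longlongrightarrow> l) (at_left t)"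
        using good(2)[OF \<omega> False] t by (auto simp: cadlag_def)
      moreover have "\<forall>\<^sub>F s in at_left t. X s \<omega> = X' s \<omega>"
        by (rule eventually_at_leftI[OF _ t]) (use False in \<open>simp add: X'_def max_def\<close>)
      ultimately show ?thesis by (auto intro: Lim_transform_eventually)
    qed (auto simp: X'_def)
    show "char (distr M borel (X' t)) \<xi> = complex_of_real (exp (- t * \<psi> \<xi>))" if t: "0 \<le> t" for t \<xi>
    proof -
      have [measurable]: "X t \<in> borel_measurable M" by (rule random_variable_X[OF t])
      have "distr M borel (X' t) = distr M borel (X t)"
        using eq t by (intro distr_cong_AE) (auto elim!: eventually_mono)
      then show ?thesis using char_exponent[OF t] by simp
    qed
    fix \<tau> :: "nat \<Rightarrow> real" and k :: nat and s :: real and F :: "(nat \<Rightarrow> real) \<Rightarrow> real" and g :: "real \<Rightarrow> real" and c d :: real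
    assume \<tau>: "0 \<le> \<tau> 0" "\<And>i. i < k \<Longrightarrow> \<tau> i \<le> \<tau> (Suc i)" and s: "0 \<le> s"
      and F[measurable]: "F \<in> borel_measurable (PiM {..k} (\<lambda>_. borel))" and g[measurable]: "g \<in> borel_measurable borel"
      and Fc: "\<And>y. \<bar>F y\<bar> \<le> c" and gd: "\<And>z. \<bar>g z\<bar> \<le> d"
    have \<tau>nn: "0 \<le> \<tau> i" if "i \<le> k" for i
      using that
    proof (induction i)
      case (Suc i)
      then show ?case using \<tau>(2)[of i] by simp
    qed (use \<tau> in simp)
    have mX: "X (\<tau> i) \<in> borel_measurable M" if "i \<le> k" for i by (rule random_variable_X) (use \<tau>nn that in simp)
    have [measurable]: "X (\<tau> k + s) \<in> borel_measurable M" by (rule random_variable_X) (use \<tau>nn s in simp)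
    have [measurable]: "X (\<tau> k) \<in> borel_measurable M" by (rule mX) simp
    have [measurable]: "X s \<in> borel_measurable M" by (rule random_variable_X[OF s])
    have [measurable]: "(\<lambda>\<omega>. F (\<lambda>j\<in>{..k}. X (\<tau> j) \<omega>)) \<in> borel_measurable M"
      by (intro measurable_compose[OF _ F] measurable_restrict mX) auto
    have [measurable]: "(\<lambda>\<omega>. F (\<lambda>j\<in>{..k}. X' (\<tau> j) \<omega>)) \<in> borel_measurable M"
      by (intro measurable_compose[OF _ F] measurable_restrict meas)
    have Feq: "AE \<omega> in M. F (\<lambda>j\<in>{..k}. X' (\<tau> j) \<omega>) = F (\<lambda>j\<in>{..k}. X (\<tau> j) \<omega>)"
      using eq
    proof eventually_elim
      case (elim \<omega>)
      then have "(\<lambda>j\<in>{..k}. X' (\<tau> j) \<omega>) = (\<lambda>j\<in>{..k}. X (\<tau> j) \<omega>)" using \<tau>nn by auto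
      then show ?case by simp
    qed
    have "(\<integral>\<omega>. F (\<lambda>j\<in>{..k}. X' (\<tau> j) \<omega>) * g (X' (\<tau> k + s) \<omega> - X' (\<tau> k) \<omega>) \<partial>M)
      = (\<integral>\<omega>. F (\<lambda>j\<in>{..k}. X (\<tau> j) \<omega>) * g (X (\<tau> k + s) \<omega> - X (\<tau> k) \<omega>) \<partial>M)"
    proof (intro integral_cong_AE)
      show "AE \<omega> in M. F (\<lambda>j\<in>{..k}. X' (\<tau> j) \<omega>) * g (X' (\<tau> k + s) \<omega> - X' (\<tau> k) \<omega>)
         = F (\<lambda>j\<in>{..k}. X (\<tau> j) \<omega>) * g (X (\<tau> k + s) \<omega> - X (\<tau> k) \<omega>)"
        using eq Feq by eventually_elim (use \<tau>nn[of k] s in simp)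
    qed measurable
    also have "\<dots> = (\<integral>\<omega>. F (\<lambda>j\<in>{..k}. X (\<tau> j) \<omega>) \<partial>M) * (\<integral>\<omega>. g (X s \<omega>) \<partial>M)"
      by (rule markov_property[OF \<tau> s F g Fc gd])
    also have "(\<integral>\<omega>. F (\<lambda>j\<in>{..k}. X (\<tau> j) \<omega>) \<partial>M) = (\<integral>\<omega>. F (\<lambda>j\<in>{..k}. X' (\<tau> j) \<omega>) \<partial>M)"
      using Feq by (intro integral_cong_AE) (auto elim!: eventually_mono)
    also have "(\<integral>\<omega>. g (X s \<omega>) \<partial>M) = (\<integral>\<omega>. g (X' s \<omega>) \<partial>M)"
      using eq s by (intro integral_cong_AE) (auto elim!: eventually_mono)
    finally show "(\<integral>\<omega>. F (\<lambda>j\<in>{..k}. X' (\<tau> j) \<omega>) * g (X' (\<tau> k + s) \<omega> - X' (\<tau> k) \<omega>) \<partial>M)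
        = (\<integral>\<omega>. F (\<lambda>j\<in>{..k}. X' (\<tau> j) \<omega>) \<partial>M) * (\<integral>\<omega>. g (X' s \<omega>) \<partial>M)" .
  qed
  then show ?thesis using eq by blast
qed

section \<open>Hitting times along grids\<close>

text \<open>With an infinite time discounted to 0, paths that never hit drop out of every stopped
  expectation and no indicator of a finite time has to be carried along.\<close>

definition discount :: "real \<Rightarrow> ereal \<Rightarrow> real" where
  "discount l t = (if t = \<infinity> then 0 else exp (- (l * real_of_ereal t)))"

lemma discount_measurable [measurable]: "discount l \<in> borel_measurable borel"
  unfolding discount_def[abs_def] by measurable

lemma discount_nonneg: "0 \<le> discount l t"
  by (simp add: discount_def)

lemma discount_le_1: "0 \<le> l \<Longrightarrow> 0 \<le> t \<Longrightarrow> discount l t \<le> 1"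
  by (cases t) (auto simp: discount_def)

text \<open>Positions at an infinite time are meaningless default values, so \<open>v\<close> is
  asked to converge for finite \<open>t\<close> only; for infinite \<open>t\<close> boundedness is
  enough because the discount factor tends to 0.\<close>

lemma tendsto_discount_mult:
  fixes v :: "'b \<Rightarrow> real"
  assumes l: "0 < l" and f: "(f \<longlongrightarrow> t) F" "0 \<le> t"
    and bound: "\<And>n. \<bar>v n\<bar> \<le> C" and v: "t \<noteq> \<infinity> \<Longrightarrow> (v \<longlongrightarrow> V) F"
  shows "((\<lambda>n. discount l (f n) * v n) \<longlongrightarrow> discount l t * V) F"
proof (cases t)
  case PInf
  have lim0: "((\<lambda>n. discount l (f n)) \<longlongrightarrow> 0) F"
  proof (rule tendstoI)
    fix e :: real assume e: "0 < e"
    have "\<forall>\<^sub>F n in F. ereal (- ln e / l) < f n"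
      using f(1) PInf by (simp add: tendsto_PInfty)
    then show "\<forall>\<^sub>F n in F. dist (discount l (f n)) 0 < e"
    proof eventually_elim
      case (elim n)
      show ?case
      proof (cases "f n")
        case (real r)
        then have "- ln e / l < r" using elim by simp
        then have "- (l * r) < ln e" using l by (simp add: field_simps)
        then have "exp (- (l * r)) < exp (ln e)" by (simp only: exp_less_cancel_iff)
        then show ?thesis using e real by (simp add: discount_def)
      qed (use elim e in \<open>auto simp: discount_def\<close>)
    qed
  qed
  have "((\<lambda>n. discount l (f n) * v n) \<longlongrightarrow> 0) F"
  proof (rule Lim_null_comparison)
    show "\<forall>\<^sub>F n in F. norm (discount l (f n) * v n) \<le> discount l (f n) * C"
      using bound by (intro always_eventually allI) (simp add: abs_mult discount_nonneg mult_left_mono)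
    show "((\<lambda>n. discount l (f n) * C) \<longlongrightarrow> 0) F" by (rule tendsto_mult_left_zero[OF lim0])
  qed
  then show ?thesis by (simp add: PInf discount_def)
next
  case (real r)
  have "((\<lambda>n. real_of_ereal (f n)) \<longlongrightarrow> r) F" using f(1) unfolding real by (rule lim_real_of_ereal)
  then have "((\<lambda>n. exp (- (l * real_of_ereal (f n)))) \<longlongrightarrow> exp (- (l * r))) F"
    by (intro tendsto_exp tendsto_minus tendsto_mult[OF tendsto_const])
  moreover have "\<forall>\<^sub>F n in F. f n < \<infinity>" using f(1) by (rule order_tendstoD) (simp add: real)
  then have "\<forall>\<^sub>F n in F. exp (- (l * real_of_ereal (f n))) = discount l (f n)"
    by eventually_elim (auto simp: discount_def)
  ultimately have "((\<lambda>n. discount l (f n)) \<longlongrightarrow> exp (- (l * r))) F" by (rule Lim_transform_eventually)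
  then show ?thesis using tendsto_mult[OF _ v] by (simp add: real discount_def)
qed (use f in auto)

definition grid :: "real \<Rightarrow> nat \<Rightarrow> nat \<Rightarrow> real" where
  "grid a m k = a + real k / 2 ^ m"

definition grid_hit :: "(real \<Rightarrow> real) \<Rightarrow> real set \<Rightarrow> real \<Rightarrow> nat \<Rightarrow> ereal" where
  "grid_hit w D a m = (INF k. if w (grid a m k) \<in> D then ereal (grid a m k) else \<infinity>)"

text \<open>An infimum over countably many times, hence measurable. For open \<open>D\<close> and
  right-continuous paths nothing is lost by looking at dyadic times, see \<open>open_hit_le\<close>;
  the grids are nested, so the infimum over \<open>m\<close> is a limit from above.\<close>

definition open_hit :: "(real \<Rightarrow> real) \<Rightarrow> real set \<Rightarrow> real \<Rightarrow> ereal" where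
  "open_hit w D a = (INF m. grid_hit w D a m)"

lemma grid_mono: "j \<le> k \<Longrightarrow> grid a m j \<le> grid a m k"
  by (simp add: grid_def divide_right_mono)

lemma grid_ge: "a \<le> grid a m k"
  by (simp add: grid_def)

lemma grid_Suc: "grid a m (Suc k) = grid a m k + 1 / 2 ^ m"
  by (simp add: grid_def add_divide_distrib)

lemma grid_hit_ge: "ereal a \<le> grid_hit w D a m"
  unfolding grid_hit_def by (intro INF_greatest) (use grid_ge in auto)

lemma open_hit_ge: "ereal a \<le> open_hit w D a"
  unfolding open_hit_def by (intro INF_greatest grid_hit_ge)

lemma grid_hit_eq:
  assumes "w (grid a m k) \<in> D" "\<And>j. j < k \<Longrightarrow> w (grid a m j) \<notin> D"
  shows "grid_hit w D a m = ereal (grid a m k)"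
proof (rule antisym)
  show "grid_hit w D a m \<le> ereal (grid a m k)"
    unfolding grid_hit_def by (rule INF_lower2[of k]) (use assms in auto)
  show "ereal (grid a m k) \<le> grid_hit w D a m"
    unfolding grid_hit_def
  proof (rule INF_greatest)
    fix j
    show "ereal (grid a m k) \<le> (if w (grid a m j) \<in> D then ereal (grid a m j) else \<infinity>)"
      using assms(2)[of j] grid_mono[of k j a m] by (cases "j < k") auto
  qed
qed

lemma grid_hit_cases:
  obtains (never) "\<And>k. w (grid a m k) \<notin> D" "grid_hit w D a m = \<infinity>"
    | (hit) k where "w (grid a m k) \<in> D" "\<And>j. j < k \<Longrightarrow> w (grid a m j) \<notin> D" "grid_hit w D a m = ereal (grid a m k)"
proof (cases "\<exists>k. w (grid a m k) \<in> D")
  case True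
  define k where "k = (LEAST k. w (grid a m k) \<in> D)"
  have "w (grid a m k) \<in> D" unfolding k_def using True by (rule LeastI_ex)
  moreover have "w (grid a m j) \<notin> D" if "j < k" for j using that unfolding k_def by (rule not_less_Least)
  ultimately show ?thesis using grid_hit_eq hit by metis
next
  case False
  then have "grid_hit w D a m = \<infinity>" by (simp add: grid_hit_def)
  then show ?thesis using False never by blast
qed

text \<open>The product of indicators survives only up to the first hit, so at most one summand is
  nonzero. Stopping thereby becomes a sum of functions of finitely many positions, the form in which
  the Markov property applies.\<close>

lemma sum_first_hit:
  fixes w :: "real \<Rightarrow> real" and \<phi> :: "real \<Rightarrow> real"
  shows "(\<Sum>k<n. (\<Prod>j<k. indicator (- D) (w (grid a m j))) * indicator D (w (grid a m k)) * \<phi> (grid a m k))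
     = (if grid_hit w D a m < ereal (grid a m n) then \<phi> (real_of_ereal (grid_hit w D a m)) else 0)"
proof (cases rule: grid_hit_cases[of w a m D])
  case (hit k)
  have z: "(\<Prod>j<i. indicator (- D) (w (grid a m j))) * indicator D (w (grid a m i)) * \<phi> (grid a m i)
     = (if i = k then \<phi> (grid a m k) else 0)" for i
  proof -
    consider "i < k" | "i = k" | "k < i" by linarith
    then show ?thesis
    proof cases
      case 1
      then show ?thesis using hit(2)[of i] by simp
    next
      case 2
      then have "(\<Prod>j<i. indicator (- D) (w (grid a m j))) = (1::real)"
        using hit(2) by (intro prod.neutral) auto
      then show ?thesis using 2 hit(1) by simp
    next
      case 3
      then have "(\<Prod>j<i. indicator (- D) (w (grid a m j))) = (0::real)"
        using hit(1) 3 by (intro prod_zero bexI[of _ k]) auto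
      then show ?thesis using 3 by simp
    qed
  qed
  have "(\<Sum>i<n. if i = k then \<phi> (grid a m k) else 0) = (if k < n then \<phi> (grid a m k) else 0)"
    by (simp add: sum.delta)
  moreover have "k < n \<longleftrightarrow> grid a m k < grid a m n" by (simp add: grid_def divide_less_cancel)
  ultimately show ?thesis unfolding z by (simp add: hit(3))
qed simp

lemma grid_at_top: "filterlim (grid a m) at_top sequentially"
  unfolding grid_def divide_inverse
  by (intro filterlim_tendsto_add_at_top[OF tendsto_const] filterlim_at_top_mult_tendsto_pos[OF tendsto_const _ filterlim_real_sequentially]) auto

lemma sum_first_hit_tendsto:
  fixes w :: "real \<Rightarrow> real" and \<phi> :: "real \<Rightarrow> real"
  shows "(\<lambda>n. \<Sum>k<n. (\<Prod>j<k. indicator (- D) (w (grid a m j))) * indicator D (w (grid a m k)) * \<phi> (grid a m k))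
    \<longlonglongrightarrow> (if grid_hit w D a m = \<infinity> then 0 else \<phi> (real_of_ereal (grid_hit w D a m)))"
  unfolding sum_first_hit
proof (rule tendsto_eventually)
  show "\<forall>\<^sub>F n in sequentially. (if grid_hit w D a m < ereal (grid a m n) then \<phi> (real_of_ereal (grid_hit w D a m)) else 0)
     = (if grid_hit w D a m = \<infinity> then 0 else \<phi> (real_of_ereal (grid_hit w D a m)))"
  proof (cases rule: grid_hit_cases[of w a m D])
    case (hit k)
    have "\<forall>\<^sub>F n in sequentially. grid a m k < grid a m n"
      using grid_at_top by (simp add: filterlim_at_top_dense)
    then show ?thesis by eventually_elim (simp add: hit)
  qed simp
qed

lemma grid_hit_decseq: "decseq (grid_hit w D a)"
proof (rule decseq_SucI)
  fix m
  show "grid_hit w D a (Suc m) \<le> grid_hit w D a m"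
  proof (cases rule: grid_hit_cases[of w a m D])
    case (hit k)
    have "grid a (Suc m) (2 * k) = grid a m k" by (simp add: grid_def)
    then have "grid_hit w D a (Suc m) \<le> ereal (grid a m k)"
      unfolding grid_hit_def by (intro INF_lower2[of "2 * k"]) (use hit(1) in auto)
    then show ?thesis by (simp add: hit(3))
  qed simp
qed

lemma grid_hit_tendsto: "grid_hit w D a \<longlonglongrightarrow> open_hit w D a"
  unfolding open_hit_def by (rule LIMSEQ_INF[OF grid_hit_decseq])

text \<open>Right-continuity keeps the path in the open set for a short time after \<open>t\<close>,
  and a sufficiently fine grid has a point in that time span.\<close>

lemma open_hit_le:
  assumes right: "(w \<longlongrightarrow> w t) (at_right t)" and D: "open D" "w t \<in> D" and t: "a \<le> t"
  shows "open_hit w D a \<le> ereal t"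
proof (rule ereal_le_epsilon2)
    fix e :: real assume e: "0 < e"
    have "\<forall>\<^sub>F s in at_right t. w s \<in> D" using right D by (rule topological_tendstoD)
    then obtain b where b: "t < b" "\<And>s. t < s \<Longrightarrow> s < b \<Longrightarrow> w s \<in> D"
      by (auto simp: eventually_at_right_field)
    have "1 / 2 ^ m < z" if "0 < z" "1 / z < 2 ^ m" for z :: real and m
      using that by (simp add: field_simps)
    moreover obtain m where "1 / min (b - t) e < 2 ^ m" using real_arch_pow[of 2] by auto
    ultimately have m: "1 / 2 ^ m < min (b - t) e" using b e by (metis diff_gt_0_iff_gt min_less_iff_conj)
    define k where "k = nat \<lceil>(t - a) * 2 ^ m\<rceil>"
    have "(t - a) * 2 ^ m \<le> real k" "real k < (t - a) * 2 ^ m + 1"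
    proof -
      have "0 \<le> (t - a) * 2 ^ m" using t by simp
      then have "real k = real_of_int \<lceil>(t - a) * 2 ^ m\<rceil>" by (simp add: k_def)
      then show "(t - a) * 2 ^ m \<le> real k" "real k < (t - a) * 2 ^ m + 1"
        using ceiling_correct[of "(t - a) * 2 ^ m"] by linarith+
    qed
    then have "(t - a) * 2 ^ m / 2 ^ m \<le> real k / 2 ^ m" "real k / 2 ^ m < ((t - a) * 2 ^ m + 1) / 2 ^ m"
      by (intro divide_right_mono divide_strict_right_mono; simp)+
    then have k: "t \<le> grid a m k" "grid a m k < t + 1 / 2 ^ m"
      by (simp_all add: grid_def add_divide_distrib)
    have "w (grid a m k) \<in> D"
      using k m b(2)[of "grid a m k"] D(2) by (cases "grid a m k = t") auto
    then have "grid_hit w D a m \<le> ereal (grid a m k)"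
      unfolding grid_hit_def by (intro INF_lower2[of k]) auto
    moreover have "open_hit w D a \<le> grid_hit w D a m" unfolding open_hit_def by (rule INF_lower) simp
    moreover have "grid a m k \<le> t + e" using k m by simp
    ultimately show "open_hit w D a \<le> ereal t + ereal e"
      by (metis ereal_less_eq(3) order_trans plus_ereal.simps(1))
qed

lemma tendsto_right_compose:
  fixes w :: "real \<Rightarrow> real"
  assumes right: "(w \<longlongrightarrow> w r) (at_right r)" and s: "(s \<longlongrightarrow> r) F" "\<forall>\<^sub>F n in F. r \<le> s n"
  shows "((\<lambda>n. w (s n)) \<longlongrightarrow> w r) F"
proof (rule tendstoI)
  fix e :: real assume e: "0 < e"
  from tendstoD[OF right this] obtain b where b: "r < b" "\<And>s. r < s \<Longrightarrow> s < b \<Longrightarrow> dist (w s) (w r) < e"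
    by (auto simp: eventually_at_right_field)
  have "\<forall>\<^sub>F n in F. s n < b" using s(1) b(1) by (rule order_tendstoD)
  with s(2) show "\<forall>\<^sub>F n in F. dist (w (s n)) (w r) < e"
  proof eventually_elim
    case (elim n)
    then show ?case using b(2)[of "s n"] e by (cases "s n = r") auto
  qed
qed

text \<open>Approach from above asks for right-continuity only. The shift \<open>s\<close> is there
  for increments after a stopping time, where the positions at \<open>t + s\<close> and at
  \<open>t\<close> are both followed.\<close>

lemma tendsto_decreasing_compose:
  fixes w :: "real \<Rightarrow> real" and f :: "nat \<Rightarrow> ereal"
  assumes f: "f \<longlonglongrightarrow> t" "\<And>n. t \<le> f n" and t: "t \<noteq> \<infinity>" "0 \<le> t"
    and right: "(w \<longlongrightarrow> w (real_of_ereal t + s)) (at_right (real_of_ereal t + s))"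
  shows "(\<lambda>n. w (real_of_ereal (f n) + s)) \<longlonglongrightarrow> w (real_of_ereal t + s)"
proof -
  obtain r where r: "t = ereal r" using t by (cases t) auto
  have "\<forall>\<^sub>F n in sequentially. f n < \<infinity>" using f(1) by (rule order_tendstoD) (simp add: r)
  then have "\<forall>\<^sub>F n in sequentially. real_of_ereal t + s \<le> real_of_ereal (f n) + s"
  proof eventually_elim
    case (elim n)
    then show ?case using f(2)[of n] by (cases "f n") (auto simp: r)
  qed
  moreover have "(\<lambda>n. real_of_ereal (f n)) \<longlonglongrightarrow> real_of_ereal t"
  proof (rule lim_real_of_ereal)
    show "f \<longlonglongrightarrow> ereal (real_of_ereal t)" using f(1) by (simp only: r real_of_ereal.simps)
  qed
  then have "(\<lambda>n. real_of_ereal (f n) + s) \<longlonglongrightarrow> real_of_ereal t + s" by (rule tendsto_add[OF _ tendsto_const])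
  ultimately show ?thesis by (intro tendsto_right_compose[OF right])
qed

text \<open>At the grid times the distance is below \<open>e\<close>, but the limit of these times
  need not be a time in the open set itself; right-continuity leaves the weak inequality.\<close>

lemma open_hit_infdist:
  assumes right: "\<And>t. (w \<longlongrightarrow> w t) (at_right t)" and fin: "open_hit w {y. infdist y B < e} a \<noteq> \<infinity>" and a: "0 \<le> a"
  shows "infdist (w (real_of_ereal (open_hit w {y. infdist y B < e} a))) B \<le> e"
proof -
  let ?D = "{y. infdist y B < e}"
  let ?S = "open_hit w ?D a"
  have S0: "0 \<le> ?S" using open_hit_ge[of a w ?D] a by (meson ereal_less(2) ereal_less_eq(5) order_trans)
  have le: "?S \<le> grid_hit w ?D a m" for m unfolding open_hit_def by (rule INF_lower) simp
  have "(\<lambda>m. w (real_of_ereal (grid_hit w ?D a m) + 0)) \<longlonglongrightarrow> w (real_of_ereal ?S + 0)"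
    by (rule tendsto_decreasing_compose[OF grid_hit_tendsto le fin S0 right])
  then have "(\<lambda>m. infdist (w (real_of_ereal (grid_hit w ?D a m))) B) \<longlonglongrightarrow> infdist (w (real_of_ereal ?S)) B"
    by (auto intro: tendsto_infdist)
  moreover have "?S < \<infinity>" using fin by (simp add: less_top[symmetric] top_ereal_def)
  then have "\<forall>\<^sub>F m in sequentially. grid_hit w ?D a m < \<infinity>"
    by (rule order_tendstoD[OF grid_hit_tendsto])
  then have "\<forall>\<^sub>F m in sequentially. infdist (w (real_of_ereal (grid_hit w ?D a m))) B \<le> e"
  proof eventually_elim
    case (elim m)
    show ?case
    proof (cases rule: grid_hit_cases[of w a m ?D])
      case (hit k)
      then show ?thesis by simp
    qed (use elim in simp)
  qed
  ultimately show ?thesis by (rule tendsto_upperbound) simp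
qed

section \<open>Optional stopping\<close>

lemma abs_mult_le:
  fixes u v :: real
  assumes "\<bar>u\<bar> \<le> c" "\<bar>v\<bar> \<le> 1"
  shows "\<bar>u * v\<bar> \<le> c" "\<bar>v * u\<bar> \<le> c"
  using mult_mono[OF assms] assms by (auto simp: abs_mult mult.commute)

context regular_levy_process
begin

lemma X_joint_measurable: "(\<lambda>p. X (fst p) (snd p)) \<in> borel_measurable (borel \<Otimes>\<^sub>M M)"
proof (rule borel_measurable_LIMSEQ_real)
  \<comment> \<open>Dyadic times strictly to the right of \<open>t\<close>, within
    \<open>1 / 2 ^ n\<close>: for fixed \<open>n\<close> they take countably many values, and
    right-continuity recovers the path in the limit.\<close>
  define s where "s n t = (real_of_int \<lfloor>t * 2 ^ n\<rfloor> + 1) / 2 ^ n" for n :: nat and t :: real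
  have s: "t < s n t" "s n t \<le> t + 1 / 2 ^ n" for n t
  proof -
    have "t * 2 ^ n / 2 ^ n < (real_of_int \<lfloor>t * 2 ^ n\<rfloor> + 1) / 2 ^ n"
      by (intro divide_strict_right_mono) (auto simp: floor_less_iff real_of_int_floor_add_one_gt)
    then show "t < s n t" by (simp add: s_def)
    have "(real_of_int \<lfloor>t * 2 ^ n\<rfloor> + 1) / 2 ^ n \<le> (t * 2 ^ n + 1) / 2 ^ n"
      by (intro divide_right_mono) auto
    then show "s n t \<le> t + 1 / 2 ^ n" by (simp add: s_def add_divide_distrib)
  qed
  have lim: "(\<lambda>n. s n t) \<longlonglongrightarrow> t" for t
  proof (rule tendsto_sandwich[of "\<lambda>_. t" _ _ "\<lambda>n. t + 1 / 2 ^ n"])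
    have "(\<lambda>n. t + (1 / 2) ^ n) \<longlonglongrightarrow> t + 0" by (intro tendsto_add tendsto_const LIMSEQ_realpow_zero) auto
    then show "(\<lambda>n. t + 1 / 2 ^ n) \<longlonglongrightarrow> t" by (simp add: power_one_over)
  qed (use s in \<open>auto intro!: always_eventually less_imp_le\<close>)
  show "(\<lambda>n. X (s n (fst p)) (snd p)) \<longlonglongrightarrow> X (fst p) (snd p)" if "p \<in> space (borel \<Otimes>\<^sub>M M)" for p
    by (rule tendsto_right_compose[OF X_right lim])
       (use that s in \<open>auto simp: space_pair_measure intro!: always_eventually less_imp_le\<close>)
  show "(\<lambda>p. X (s n (fst p)) (snd p)) \<in> borel_measurable (borel \<Otimes>\<^sub>M M)" for n
    unfolding s_def
    by (rule measurable_compose_countable[where f = "\<lambda>i p. X ((real_of_int i + 1) / 2 ^ n) (snd p)" and g = "\<lambda>p. \<lfloor>fst p * 2 ^ n\<rfloor>"]) measurable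
qed

lemma X_random_time [measurable]:
  assumes [measurable]: "S \<in> borel_measurable M"
  shows "(\<lambda>\<omega>. X (S \<omega>) \<omega>) \<in> borel_measurable M"
proof -
  have "(\<lambda>\<omega>. (S \<omega>, \<omega>)) \<in> M \<rightarrow>\<^sub>M borel \<Otimes>\<^sub>M M" by measurable
  from measurable_compose[OF this X_joint_measurable] show ?thesis by simp
qed

lemma integrable_bounded: 
  fixes f :: "'a \<Rightarrow> real"
  shows "f \<in> borel_measurable M \<Longrightarrow> (\<And>\<omega>. \<omega> \<in> space M \<Longrightarrow> \<bar>f \<omega>\<bar> \<le> C) \<Longrightarrow> integrable M f"
  by (rule integrable_const_bound[of _ C]) auto

lemma abs_expectation_le:
  fixes f :: "'a \<Rightarrow> real"
  assumes [measurable]: "f \<in> borel_measurable M" and f: "\<And>\<omega>. \<bar>f \<omega>\<bar> \<le> C"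
  shows "\<bar>\<integral>\<omega>. f \<omega> \<partial>M\<bar> \<le> C"
proof -
  have "\<bar>\<integral>\<omega>. f \<omega> \<partial>M\<bar> \<le> (\<integral>\<omega>. \<bar>f \<omega>\<bar> \<partial>M)" by (rule integral_abs_bound)
  also have "\<dots> \<le> (\<integral>\<omega>. C \<partial>M)"
    by (intro integral_mono f integrable_abs integrable_bounded[of f C]) auto
  finally show ?thesis by (simp add: prob_space)
qed

lemma expectation_cos_sin:
  assumes "0 \<le> s"
  shows "(\<integral>\<omega>. cos (\<xi> * X s \<omega>) \<partial>M) = exp (- s * \<psi> \<xi>)" "(\<integral>\<omega>. sin (\<xi> * X s \<omega>) \<partial>M) = 0"
proof -
  have int: "integrable M (\<lambda>\<omega>. iexp (\<xi> * X s \<omega>))"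
    by (rule integrable_const_bound[of _ 1]) auto
  have eq: "(\<integral>\<omega>. iexp (\<xi> * X s \<omega>) \<partial>M) = complex_of_real (exp (- s * \<psi> \<xi>))"
    using char_X[OF assms, of \<xi>] by (simp add: char_def integral_distr)
  have "(\<integral>\<omega>. cos (\<xi> * X s \<omega>) \<partial>M) = Re (\<integral>\<omega>. iexp (\<xi> * X s \<omega>) \<partial>M)"
    using int by (subst integral_Re[symmetric]) (auto simp: Re_exp)
  then show "(\<integral>\<omega>. cos (\<xi> * X s \<omega>) \<partial>M) = exp (- s * \<psi> \<xi>)" unfolding eq by simp
  have "(\<integral>\<omega>. sin (\<xi> * X s \<omega>) \<partial>M) = Im (\<integral>\<omega>. iexp (\<xi> * X s \<omega>) \<partial>M)"
    using int by (subst integral_Im[symmetric]) (auto simp: Im_exp)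
  then show "(\<integral>\<omega>. sin (\<xi> * X s \<omega>) \<partial>M) = 0" unfolding eq by simp
qed

text \<open>The addition theorem splits off the last increment, whose sine has mean zero because the
  characteristic function is real. Cosines are thus eigenfunctions of the transition operators, also
  in combination with a factor depending on the past.\<close>

lemma markov_cos:
  assumes \<tau>: "0 \<le> \<tau> 0" "\<And>i. i < k \<Longrightarrow> \<tau> i \<le> \<tau> (Suc i)" and s: "0 \<le> s"
    and F[measurable]: "F \<in> borel_measurable (PiM {..k} (\<lambda>_. borel))" and Fc: "\<And>y. \<bar>F y\<bar> \<le> (c::real)"
  shows "(\<integral>\<omega>. F (\<lambda>j\<in>{..k}. X (\<tau> j) \<omega>) * cos (\<xi> * (x + X (\<tau> k + s) \<omega>)) \<partial>M)
     = exp (- s * \<psi> \<xi>) * (\<integral>\<omega>. F (\<lambda>j\<in>{..k}. X (\<tau> j) \<omega>) * cos (\<xi> * (x + X (\<tau> k) \<omega>)) \<partial>M)"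
proof -
  define F1 where "F1 y = F y * cos (\<xi> * (x + y k))" for y
  define F2 where "F2 y = F y * sin (\<xi> * (x + y k))" for y
  have m: "F1 \<in> borel_measurable (PiM {..k} (\<lambda>_. borel))" "F2 \<in> borel_measurable (PiM {..k} (\<lambda>_. borel))"
    unfolding F1_def[abs_def] F2_def[abs_def] by measurable
  have c0: "0 \<le> c" using Fc[of undefined] by linarith
  have b: "\<bar>F1 y\<bar> \<le> c" "\<bar>F2 y\<bar> \<le> c" for y
    unfolding F1_def F2_def by (rule abs_mult_le[OF Fc], simp)+
  define V where "V = (\<lambda>\<omega>. \<lambda>j\<in>{..k}. X (\<tau> j) \<omega>)"
  have [measurable]: "V \<in> M \<rightarrow>\<^sub>M PiM {..k} (\<lambda>_. borel)" unfolding V_def by measurable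
  have Vk: "V \<omega> k = X (\<tau> k) \<omega>" for \<omega> by (simp add: V_def)
  have mV[measurable]: "(\<lambda>\<omega>. F1 (V \<omega>)) \<in> borel_measurable M" "(\<lambda>\<omega>. F2 (V \<omega>)) \<in> borel_measurable M"
    using measurable_compose[OF _ m(1)] measurable_compose[OF _ m(2)] by measurable
  have i1: "integrable M (\<lambda>\<omega>. F1 (V \<omega>) * cos (\<xi> * (X (\<tau> k + s) \<omega> - X (\<tau> k) \<omega>)))"
    by (rule integrable_bounded[of _ c]) (auto intro!: abs_mult_le(1) b)
  have i2: "integrable M (\<lambda>\<omega>. F2 (V \<omega>) * sin (\<xi> * (X (\<tau> k + s) \<omega> - X (\<tau> k) \<omega>)))"
    by (rule integrable_bounded[of _ c]) (auto intro!: abs_mult_le(1) b)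
  have "F (V \<omega>) * cos (\<xi> * (x + X (\<tau> k + s) \<omega>)) = F1 (V \<omega>) * cos (\<xi> * (X (\<tau> k + s) \<omega> - X (\<tau> k) \<omega>))
     - F2 (V \<omega>) * sin (\<xi> * (X (\<tau> k + s) \<omega> - X (\<tau> k) \<omega>))" for \<omega>
  proof -
    have "\<xi> * (x + X (\<tau> k + s) \<omega>) = \<xi> * (x + X (\<tau> k) \<omega>) + \<xi> * (X (\<tau> k + s) \<omega> - X (\<tau> k) \<omega>)"
      by (simp add: algebra_simps)
    then show ?thesis by (simp only: cos_add F1_def F2_def Vk) (simp add: algebra_simps)
  qed
  then have "(\<integral>\<omega>. F (V \<omega>) * cos (\<xi> * (x + X (\<tau> k + s) \<omega>)) \<partial>M)
    = (\<integral>\<omega>. F1 (V \<omega>) * cos (\<xi> * (X (\<tau> k + s) \<omega> - X (\<tau> k) \<omega>)) \<partial>M)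
      - (\<integral>\<omega>. F2 (V \<omega>) * sin (\<xi> * (X (\<tau> k + s) \<omega> - X (\<tau> k) \<omega>)) \<partial>M)"
    using i1 i2 by simp
  also have "\<dots> = (\<integral>\<omega>. F1 (V \<omega>) \<partial>M) * exp (- s * \<psi> \<xi>)"
    unfolding V_def
    using markov[OF \<tau> s m(1) _ b(1), of "\<lambda>z. cos (\<xi> * z)" 1] markov[OF \<tau> s m(2) _ b(2), of "\<lambda>z. sin (\<xi> * z)" 1]
    by (simp add: expectation_cos_sin[OF s])
  finally show ?thesis by (simp add: F1_def V_def mult.commute)
qed

text \<open>Carries \<open>markov_cos\<close> from single cosines to their superpositions with an
  integrable weight; boundedness of \<open>Z\<close> supplies absolute integrability on the product
  space.\<close>

lemma cosine_Fubini:
  assumes w: "integrable lborel w" and [measurable]: "Z \<in> borel_measurable M" "Y \<in> borel_measurable M"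
    and Z: "\<And>\<omega>. \<bar>Z \<omega>\<bar> \<le> (1::real)"
  shows "(\<integral>\<omega>. Z \<omega> * (\<integral>\<xi>. w \<xi> * cos (\<xi> * Y \<omega>) \<partial>lborel) \<partial>M)
     = (\<integral>\<xi>. w \<xi> * (\<integral>\<omega>. Z \<omega> * cos (\<xi> * Y \<omega>) \<partial>M) \<partial>lborel)"
proof -
  interpret P: pair_sigma_finite lborel M by standard
  have [measurable]: "w \<in> borel_measurable borel" using w by auto
  have le: "\<bar>w \<xi> * (Z \<omega> * cos (\<xi> * Y \<omega>))\<bar> \<le> \<bar>w \<xi>\<bar>" for \<xi> \<omega>
    by (intro abs_mult_le Z) auto
  have int1: "integrable M (\<lambda>\<omega>. w \<xi> * (Z \<omega> * cos (\<xi> * Y \<omega>)))" for \<xi>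
    by (intro integrable_bounded[of _ "\<bar>w \<xi>\<bar>"] le) measurable
  have "integrable (lborel \<Otimes>\<^sub>M M) (\<lambda>(\<xi>, \<omega>). w \<xi> * (Z \<omega> * cos (\<xi> * Y \<omega>)))"
  proof (rule P.Fubini_integrable)
    show "integrable lborel (\<lambda>\<xi>. \<integral>\<omega>. norm (case (\<xi>, \<omega>) of (\<xi>, \<omega>) \<Rightarrow> w \<xi> * (Z \<omega> * cos (\<xi> * Y \<omega>))) \<partial>M)"
    proof (rule Bochner_Integration.integrable_bound[OF w])
      show "AE \<xi> in lborel. norm (\<integral>\<omega>. norm (case (\<xi>, \<omega>) of (\<xi>, \<omega>) \<Rightarrow> w \<xi> * (Z \<omega> * cos (\<xi> * Y \<omega>))) \<partial>M) \<le> norm (w \<xi>)"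
      proof (rule AE_I2)
        fix \<xi>
        have "(\<integral>\<omega>. \<bar>w \<xi> * (Z \<omega> * cos (\<xi> * Y \<omega>))\<bar> \<partial>M) \<le> (\<integral>\<omega>. \<bar>w \<xi>\<bar> \<partial>M)"
          using int1[of \<xi>] by (intro integral_mono le integrable_abs) auto
        then show "norm (\<integral>\<omega>. norm (case (\<xi>, \<omega>) of (\<xi>, \<omega>) \<Rightarrow> w \<xi> * (Z \<omega> * cos (\<xi> * Y \<omega>))) \<partial>M) \<le> norm (w \<xi>)"
          by (simp add: prob_space)
      qed
    qed measurable
  qed (use int1 in auto)
  from P.Fubini_integral[OF this]
  have "(\<integral>\<omega>. (\<integral>\<xi>. w \<xi> * (Z \<omega> * cos (\<xi> * Y \<omega>)) \<partial>lborel) \<partial>M) = (\<integral>\<xi>. (\<integral>\<omega>. w \<xi> * (Z \<omega> * cos (\<xi> * Y \<omega>)) \<partial>M) \<partial>lborel)"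
    by simp
  moreover have "(\<integral>\<xi>. w \<xi> * (Z \<omega> * cos (\<xi> * Y \<omega>)) \<partial>lborel) = Z \<omega> * (\<integral>\<xi>. w \<xi> * cos (\<xi> * Y \<omega>) \<partial>lborel)" for \<omega>
    by (subst integral_mult_right_zero[symmetric]) (simp add: mult_ac)
  ultimately show ?thesis by simp
qed

lemma grid_hit_measurable [measurable]:
  assumes [measurable]: "D \<in> sets borel"
  shows "(\<lambda>\<omega>. grid_hit (\<lambda>t. x + X t \<omega>) D a m) \<in> borel_measurable M"
  unfolding grid_hit_def by measurable

lemma open_hit_measurable [measurable]:
  assumes [measurable]: "D \<in> sets borel"
  shows "(\<lambda>\<omega>. open_hit (\<lambda>t. x + X t \<omega>) D a) \<in> borel_measurable M"
  unfolding open_hit_def by measurable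

text \<open>The cosine transform of \<open>w\<close> is harmonic for the discounted random walk outside \<open>D\<close>.\<close>

lemma optional_stopping_grid:
  fixes w :: "real \<Rightarrow> real" and D :: "real set" and l a x :: real and m :: nat
  defines "h \<equiv> 1 / 2 ^ m"
  defines "G \<equiv> \<lambda>y. \<integral>\<xi>. w \<xi> * cos (\<xi> * y) \<partial>lborel"
    and "S \<equiv> \<lambda>\<omega>. grid_hit (\<lambda>t. x + X t \<omega>) D a m"
  assumes w: "integrable lborel w" and D[measurable]: "D \<in> sets borel" and l: "0 < l" and a: "0 \<le> a"
    and harmonic: "\<And>y. y \<notin> D \<Longrightarrow> (\<integral>\<xi>. w \<xi> * (1 - exp (- h * (l + \<psi> \<xi>))) * cos (\<xi> * y) \<partial>lborel) = 0"
  shows "(\<integral>\<omega>. discount l (S \<omega>) * G (x + X (real_of_ereal (S \<omega>)) \<omega>) \<partial>M)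
    = exp (- l * a) * (\<integral>\<xi>. w \<xi> * exp (- a * \<psi> \<xi>) * cos (\<xi> * x) \<partial>lborel)"
proof -
  have h: "0 < h" by (simp add: h_def)
  define t where "t = grid a m"
  have tS: "t (Suc k) = t k + h" for k by (simp add: t_def grid_Suc h_def)
  have t0: "0 \<le> t k" for k using a grid_ge[of a m k] by (simp add: t_def)
  have [measurable]: "w \<in> borel_measurable borel" using w by auto
  have [measurable]: "G \<in> borel_measurable borel" unfolding G_def by measurable
  define C where "C = (\<integral>\<xi>. \<bar>w \<xi>\<bar> \<partial>lborel)"
  have wint: "integrable lborel (\<lambda>\<xi>. w \<xi> * v \<xi>)" if [measurable]: "v \<in> borel_measurable borel" and v: "\<And>\<xi>. \<bar>v \<xi>\<bar> \<le> 1" for v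
    by (rule Bochner_Integration.integrable_bound[OF w]) (use v in \<open>auto simp: abs_mult intro!: mult_left_le\<close>)
  have GC: "\<bar>G y\<bar> \<le> C" for y
    unfolding G_def C_def
    by (rule integral_abs_bound_integral) (use w wint[of "\<lambda>\<xi>. cos (\<xi> * y)"] in \<open>auto simp: abs_mult intro!: mult_left_le\<close>)
  have C0: "0 \<le> C" using GC[of 0] by linarith
  define W where "W k \<omega> = x + X (t k) \<omega>" for k \<omega>
  have [measurable]: "W k \<in> borel_measurable M" for k unfolding W_def[abs_def] by measurable
  define Z where "Z k \<omega> = (\<Prod>j<k. indicator (- D) (W j \<omega>) :: real)" for k \<omega>
  have [measurable]: "Z k \<in> borel_measurable M" for k unfolding Z_def[abs_def] by measurable
  have Z01: "0 \<le> Z k \<omega>" "Z k \<omega> \<le> 1" for k \<omega>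
    unfolding Z_def by (auto intro!: prod_nonneg prod_le_1)
  have Zabs: "\<bar>Z k \<omega>\<bar> \<le> 1" for k \<omega> using Z01[of k \<omega>] by simp
  have ZS: "Z (Suc k) \<omega> = Z k \<omega> * indicator (- D) (W k \<omega>)" for k \<omega> by (simp add: Z_def)
  have int: "integrable M (\<lambda>\<omega>. V \<omega> * G (W k \<omega>))" if [measurable]: "V \<in> borel_measurable M" and V: "\<And>\<omega>. \<bar>V \<omega>\<bar> \<le> 1" for V k
    by (rule integrable_bounded[of _ C]) (auto intro!: abs_mult_le(2) GC V)
  \<comment> \<open>\<open>A k\<close> is the discounted contribution of the paths not stopped
    before the time \<open>t k\<close>, and \<open>B k\<close> the part stopped exactly there. The
    identity \<open>A k = B k + A (Suc k)\<close> is the martingale property off \<open>D\<close>,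
    and telescoping it gives the stopped expectation.\<close>
  define A where "A k = exp (- l * t k) * (\<integral>\<omega>. Z k \<omega> * G (W k \<omega>) \<partial>M)" for k
  define B where "B k = exp (- l * t k) * (\<integral>\<omega>. Z k \<omega> * indicator D (W k \<omega>) * G (W k \<omega>) \<partial>M)" for k
  have Vabs: "\<bar>Z k \<omega> * indicator D (W k \<omega>)\<bar> \<le> 1" for k \<omega> using Zabs[of k \<omega>] by (simp add: indicator_def)
  have step: "A k = B k + A (Suc k)" for k
  proof -
    have "(\<integral>\<omega>. Z k \<omega> * G (W k \<omega>) \<partial>M) = (\<integral>\<omega>. Z k \<omega> * indicator D (W k \<omega>) * G (W k \<omega>) + Z (Suc k) \<omega> * G (W k \<omega>) \<partial>M)"
      by (intro Bochner_Integration.integral_cong) (auto simp: ZS indicator_def)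
    also have "\<dots> = (\<integral>\<omega>. Z k \<omega> * indicator D (W k \<omega>) * G (W k \<omega>) \<partial>M) + (\<integral>\<omega>. Z (Suc k) \<omega> * G (W k \<omega>) \<partial>M)"
      using int[of "Z (Suc k)" k] int[of "\<lambda>\<omega>. Z k \<omega> * indicator D (W k \<omega>)" k] Zabs Vabs
      by (intro Bochner_Integration.integral_add) auto
    finally have 1: "(\<integral>\<omega>. Z k \<omega> * G (W k \<omega>) \<partial>M)
       = (\<integral>\<omega>. Z k \<omega> * indicator D (W k \<omega>) * G (W k \<omega>) \<partial>M) + (\<integral>\<omega>. Z (Suc k) \<omega> * G (W k \<omega>) \<partial>M)" .
    define F where "F y = (\<Prod>j\<le>k. indicator (- D) (x + y j) :: real)" for y :: "nat \<Rightarrow> real"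
    have F: "F \<in> borel_measurable (PiM {..k} (\<lambda>_. borel))" unfolding F_def[abs_def] by measurable
    have F1: "\<bar>F y\<bar> \<le> 1" for y unfolding F_def abs_prod by (intro prod_le_1) (auto simp: indicator_def)
    have ZF: "Z (Suc k) \<omega> = F (\<lambda>j\<in>{..k}. X (t j) \<omega>)" for \<omega>
      by (simp add: Z_def F_def W_def lessThan_Suc_atMost)
    have mc: "(\<integral>\<omega>. Z (Suc k) \<omega> * cos (\<xi> * W (Suc k) \<omega>) \<partial>M) = exp (- h * \<psi> \<xi>) * (\<integral>\<omega>. Z (Suc k) \<omega> * cos (\<xi> * W k \<omega>) \<partial>M)" for \<xi>
      unfolding ZF W_def tS
      by (rule markov_cos) (use t0 tS h F F1 in auto)
    have wh: "integrable lborel (\<lambda>\<xi>. w \<xi> * exp (- h * \<psi> \<xi>))" using h by (intro wint) auto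
    have "(\<integral>\<omega>. Z (Suc k) \<omega> * G (W (Suc k) \<omega>) \<partial>M) = (\<integral>\<xi>. w \<xi> * (\<integral>\<omega>. Z (Suc k) \<omega> * cos (\<xi> * W (Suc k) \<omega>) \<partial>M) \<partial>lborel)"
      unfolding G_def by (rule cosine_Fubini[OF w]) (auto simp: Zabs)
    also have "\<dots> = (\<integral>\<xi>. w \<xi> * exp (- h * \<psi> \<xi>) * (\<integral>\<omega>. Z (Suc k) \<omega> * cos (\<xi> * W k \<omega>) \<partial>M) \<partial>lborel)"
      by (simp only: mc mult.assoc)
    also have "\<dots> = (\<integral>\<omega>. Z (Suc k) \<omega> * (\<integral>\<xi>. w \<xi> * exp (- h * \<psi> \<xi>) * cos (\<xi> * W k \<omega>) \<partial>lborel) \<partial>M)"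
      by (rule cosine_Fubini[OF wh, symmetric]) (auto simp: Zabs)
    also have "\<dots> = (\<integral>\<omega>. exp (l * h) * (Z (Suc k) \<omega> * G (W k \<omega>)) \<partial>M)"
    proof (intro Bochner_Integration.integral_cong refl)
      fix \<omega>
      show "Z (Suc k) \<omega> * (\<integral>\<xi>. w \<xi> * exp (- h * \<psi> \<xi>) * cos (\<xi> * W k \<omega>) \<partial>lborel) = exp (l * h) * (Z (Suc k) \<omega> * G (W k \<omega>))"
      \<comment> \<open>Inside \<open>D\<close> both sides vanish through the factor
        \<open>Z (Suc k)\<close>. Outside, harmonicity says that one step of the walk multiplies
        \<open>G\<close> by \<open>exp (l * h)\<close>, which the discount over that step
        cancels.\<close>
      proof (cases "W k \<omega> \<in> D")
        case False
        let ?y = "W k \<omega>"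
        have i1: "integrable lborel (\<lambda>\<xi>. w \<xi> * cos (\<xi> * ?y))" by (intro wint) auto
        have i2: "integrable lborel (\<lambda>\<xi>. exp (- l * h) * (w \<xi> * (exp (- h * \<psi> \<xi>) * cos (\<xi> * ?y))))"
          using h by (intro integrable_mult_right wint) (auto simp: abs_mult intro!: mult_le_one)
        have "0 = (\<integral>\<xi>. w \<xi> * (1 - exp (- h * (l + \<psi> \<xi>))) * cos (\<xi> * ?y) \<partial>lborel)"
          by (rule harmonic[OF False, symmetric])
        also have "\<dots> = (\<integral>\<xi>. w \<xi> * cos (\<xi> * ?y) - exp (- l * h) * (w \<xi> * (exp (- h * \<psi> \<xi>) * cos (\<xi> * ?y))) \<partial>lborel)"
          by (intro Bochner_Integration.integral_cong) (auto simp: algebra_simps exp_add[symmetric])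
        also have "\<dots> = G ?y - exp (- l * h) * (\<integral>\<xi>. w \<xi> * (exp (- h * \<psi> \<xi>) * cos (\<xi> * ?y)) \<partial>lborel)"
          using i1 i2 by (subst Bochner_Integration.integral_diff) (auto simp: G_def)
        finally have "exp (l * h) * G ?y = exp (l * h) * exp (- l * h) * (\<integral>\<xi>. w \<xi> * (exp (- h * \<psi> \<xi>) * cos (\<xi> * ?y)) \<partial>lborel)"
          by simp
        then show ?thesis by (simp add: exp_add[symmetric] mult.assoc)
      qed (simp add: ZS)
    qed
    finally have 2: "(\<integral>\<omega>. Z (Suc k) \<omega> * G (W (Suc k) \<omega>) \<partial>M) = exp (l * h) * (\<integral>\<omega>. Z (Suc k) \<omega> * G (W k \<omega>) \<partial>M)"
      by simp
    have "A (Suc k) = exp (- l * t k) * (exp (- l * h) * exp (l * h)) * (\<integral>\<omega>. Z (Suc k) \<omega> * G (W k \<omega>) \<partial>M)"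
      unfolding A_def 2 tS by (simp add: exp_add[symmetric] algebra_simps)
    then have "A (Suc k) = exp (- l * t k) * (\<integral>\<omega>. Z (Suc k) \<omega> * G (W k \<omega>) \<partial>M)"
      by (simp add: exp_add[symmetric])
    then show ?thesis unfolding A_def[of k] B_def 1 by (simp add: distrib_left)
  qed
  have sumB: "(\<Sum>k<n. B k) = A 0 - A n" for n
  proof (induction n)
    case (Suc n)
    then show ?case using step[of n] by simp
  qed simp
  have A_lim: "A \<longlonglongrightarrow> 0"
  proof (rule Lim_null_comparison)
    have "filterlim (\<lambda>n. - (l * t n)) at_bot sequentially"
      unfolding filterlim_uminus_at_bot minus_minus t_def using l
      by (intro filterlim_tendsto_pos_mult_at_top[OF tendsto_const] grid_at_top) auto
    then have "(\<lambda>n. exp (- (l * t n))) \<longlonglongrightarrow> 0" by (rule filterlim_compose[OF exp_at_bot])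
    then show "(\<lambda>n. exp (- (l * t n)) * C) \<longlonglongrightarrow> 0" by (rule tendsto_mult_left_zero)
    have "\<bar>\<integral>\<omega>. Z n \<omega> * G (W n \<omega>) \<partial>M\<bar> \<le> C" for n
      by (intro abs_expectation_le abs_mult_le(2) GC Zabs) measurable
    then show "\<forall>\<^sub>F n in sequentially. norm (A n) \<le> exp (- (l * t n)) * C"
      by (intro always_eventually allI) (simp add: A_def abs_mult prob_space)
  qed
  define \<phi> where "\<phi> \<omega> r = exp (- (l * r)) * G (x + X r \<omega>)" for \<omega> r
  define P where "P n \<omega> = (\<Sum>k<n. Z k \<omega> * indicator D (W k \<omega>) * \<phi> \<omega> (t k))" for n \<omega>
  have P_eq: "P n \<omega> = (if S \<omega> < ereal (t n) then \<phi> \<omega> (real_of_ereal (S \<omega>)) else 0)" for n \<omega>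
    unfolding P_def Z_def W_def S_def t_def by (rule sum_first_hit[where w = "\<lambda>t. x + X t \<omega>"])
  have S_ge: "0 \<le> S \<omega>" for \<omega>
    using grid_hit_ge[of a "\<lambda>t. x + X t \<omega>" D m] a unfolding S_def by (meson ereal_less_eq(5) order_trans)
  have [measurable]: "S \<in> borel_measurable M" unfolding S_def by measurable
  have cos_a: "(\<integral>\<omega>. cos (\<xi> * (x + X a \<omega>)) \<partial>M) = exp (- a * \<psi> \<xi>) * cos (\<xi> * x)" for \<xi>
  proof -
    have "integrable M (\<lambda>\<omega>. cos (\<xi> * x) * cos (\<xi> * X a \<omega>))" "integrable M (\<lambda>\<omega>. sin (\<xi> * x) * sin (\<xi> * X a \<omega>))"
      by (intro integrable_mult_right integrable_bounded[of _ 1]; simp)+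
    then show ?thesis using expectation_cos_sin[OF a, of \<xi>]
      by (simp add: distrib_left cos_add)
  qed
  have "(\<lambda>n. \<integral>\<omega>. P n \<omega> \<partial>M) \<longlonglongrightarrow> (\<integral>\<omega>. discount l (S \<omega>) * G (x + X (real_of_ereal (S \<omega>)) \<omega>) \<partial>M)"
  proof (rule integral_dominated_convergence[where w = "\<lambda>_. C"])
    show "AE \<omega> in M. (\<lambda>n. P n \<omega>) \<longlonglongrightarrow> discount l (S \<omega>) * G (x + X (real_of_ereal (S \<omega>)) \<omega>)"
    proof (rule AE_I2)
      fix \<omega>
      have "(\<lambda>n. P n \<omega>) \<longlonglongrightarrow> (if S \<omega> = \<infinity> then 0 else \<phi> \<omega> (real_of_ereal (S \<omega>)))"
        unfolding P_def Z_def W_def S_def t_def by (rule sum_first_hit_tendsto[where w = "\<lambda>t. x + X t \<omega>"])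
      then show "(\<lambda>n. P n \<omega>) \<longlonglongrightarrow> discount l (S \<omega>) * G (x + X (real_of_ereal (S \<omega>)) \<omega>)"
        by (simp add: \<phi>_def discount_def split: if_splits)
    qed
    show "AE \<omega> in M. norm (P n \<omega>) \<le> C" for n
    proof (rule AE_I2)
      fix \<omega>
      have "\<bar>\<phi> \<omega> r\<bar> \<le> C" if "0 \<le> r" for r
        unfolding \<phi>_def using that l by (intro abs_mult_le(2) GC) auto
      moreover have "0 \<le> real_of_ereal (S \<omega>)" using S_ge[of \<omega>] by (rule real_of_ereal_pos)
      ultimately show "norm (P n \<omega>) \<le> C" unfolding P_eq using C0 by auto
    qed
    show "P n \<in> borel_measurable M" for n unfolding P_def[abs_def] \<phi>_def by measurable
  qed (auto simp: G_def[symmetric])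
  moreover have "(\<integral>\<omega>. P n \<omega> \<partial>M) = A 0 - A n" for n
  proof -
    have "integrable M (\<lambda>\<omega>. exp (- l * t k) * (Z k \<omega> * indicator D (W k \<omega>) * G (W k \<omega>)))" for k
      by (intro integrable_mult_right int Vabs) measurable
    from Bochner_Integration.integral_sum[OF this]
    have "(\<integral>\<omega>. (\<Sum>k<n. exp (- l * t k) * (Z k \<omega> * indicator D (W k \<omega>) * G (W k \<omega>))) \<partial>M)
      = (\<Sum>k<n. \<integral>\<omega>. exp (- l * t k) * (Z k \<omega> * indicator D (W k \<omega>) * G (W k \<omega>)) \<partial>M)" .
    moreover have "P n \<omega> = (\<Sum>k<n. exp (- l * t k) * (Z k \<omega> * indicator D (W k \<omega>) * G (W k \<omega>)))" for \<omega>
      unfolding P_def \<phi>_def by (intro sum.cong refl) (simp add: W_def mult_ac)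
    ultimately have "(\<integral>\<omega>. P n \<omega> \<partial>M) = (\<Sum>k<n. \<integral>\<omega>. exp (- l * t k) * (Z k \<omega> * indicator D (W k \<omega>) * G (W k \<omega>)) \<partial>M)"
      by simp
    also have "\<dots> = (\<Sum>k<n. B k)" by (simp add: B_def)
    finally show ?thesis by (simp add: sumB)
  qed
  moreover have "(\<lambda>n. A 0 - A n) \<longlonglongrightarrow> A 0 - 0" by (intro tendsto_diff tendsto_const A_lim)
  ultimately have "(\<integral>\<omega>. discount l (S \<omega>) * G (x + X (real_of_ereal (S \<omega>)) \<omega>) \<partial>M) = A 0"
    using LIMSEQ_unique by fastforce
  also have "A 0 = exp (- l * a) * (\<integral>\<omega>. 1 * G (x + X a \<omega>) \<partial>M)"
    by (simp add: A_def Z_def W_def t_def grid_def)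
  also have "(\<integral>\<omega>. 1 * G (x + X a \<omega>) \<partial>M) = (\<integral>\<xi>. w \<xi> * (\<integral>\<omega>. 1 * cos (\<xi> * (x + X a \<omega>)) \<partial>M) \<partial>lborel)"
    unfolding G_def by (rule cosine_Fubini[OF w]) auto
  finally show ?thesis by (simp add: cos_a mult.assoc)
qed

text \<open>The increment after the \<open>k\<close>-th grid time is independent of the event that
  the first hit happens there. These events are disjoint and the discount is at most 1, so summation
  gives an inequality, which is the direction that quasi-left continuity uses.\<close>

lemma increment_grid:
  fixes g :: "real \<Rightarrow> real" and D :: "real set" and a x s :: real and m :: nat
  defines "S \<equiv> \<lambda>\<omega>. grid_hit (\<lambda>t. x + X t \<omega>) D a m"
  assumes D[measurable]: "D \<in> sets borel" and a: "0 \<le> a" and s: "0 \<le> s"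
    and g[measurable]: "g \<in> borel_measurable borel" and g01: "\<And>z. 0 \<le> g z" "\<And>z. g z \<le> 1"
  shows "(\<integral>\<omega>. discount 1 (S \<omega>) * g (X (real_of_ereal (S \<omega>) + s) \<omega> - X (real_of_ereal (S \<omega>)) \<omega>) \<partial>M)
    \<le> (\<integral>\<omega>. g (X s \<omega>) \<partial>M)"
proof -
  define t where "t = grid a m"
  have t0: "0 \<le> t k" for k using a grid_ge[of a m k] by (simp add: t_def)
  define W where "W k \<omega> = x + X (t k) \<omega>" for k \<omega>
  have [measurable]: "W k \<in> borel_measurable M" for k unfolding W_def[abs_def] by measurable
  define V where "V k \<omega> = (\<Prod>j<k. indicator (- D) (W j \<omega>)) * (indicator D (W k \<omega>) :: real)" for k \<omega>
  have [measurable]: "V k \<in> borel_measurable M" for k unfolding V_def[abs_def] by measurable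
  have V01: "0 \<le> V k \<omega>" "V k \<omega> \<le> 1" for k \<omega>
    unfolding V_def by (auto intro!: mult_nonneg_nonneg prod_nonneg prod_le_1 mult_le_one)
  have Vint: "integrable M (V k)" for k by (rule integrable_bounded[of _ 1]) (use V01 in \<open>auto simp: abs_le_iff intro: order_trans[of _ 0]\<close>)
  define \<phi> where "\<phi> \<omega> r = exp (- r) * g (X (r + s) \<omega> - X r \<omega>)" for \<omega> r
  define P where "P n \<omega> = (\<Sum>k<n. V k \<omega> * \<phi> \<omega> (t k))" for n \<omega>
  have P_eq: "P n \<omega> = (if S \<omega> < ereal (t n) then \<phi> \<omega> (real_of_ereal (S \<omega>)) else 0)" for n \<omega>
    unfolding P_def V_def W_def S_def t_def by (rule sum_first_hit[where w = "\<lambda>t. x + X t \<omega>"])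
  have S_ge: "0 \<le> S \<omega>" for \<omega>
    using grid_hit_ge[of a "\<lambda>t. x + X t \<omega>" D m] a unfolding S_def by (meson ereal_less_eq(5) order_trans)
  have [measurable]: "S \<in> borel_measurable M" unfolding S_def by measurable
  have \<phi>01: "0 \<le> \<phi> \<omega> r" "0 \<le> r \<Longrightarrow> \<phi> \<omega> r \<le> 1" for \<omega> r
    unfolding \<phi>_def using g01 by (auto intro!: mult_le_one)
  have lim: "(\<lambda>n. \<integral>\<omega>. P n \<omega> \<partial>M) \<longlonglongrightarrow> (\<integral>\<omega>. discount 1 (S \<omega>) * g (X (real_of_ereal (S \<omega>) + s) \<omega> - X (real_of_ereal (S \<omega>)) \<omega>) \<partial>M)"
  proof (rule integral_dominated_convergence[where w = "\<lambda>_. 1"])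
    show "AE \<omega> in M. (\<lambda>n. P n \<omega>) \<longlonglongrightarrow> discount 1 (S \<omega>) * g (X (real_of_ereal (S \<omega>) + s) \<omega> - X (real_of_ereal (S \<omega>)) \<omega>)"
    proof (rule AE_I2)
      fix \<omega>
      have "(\<lambda>n. P n \<omega>) \<longlonglongrightarrow> (if S \<omega> = \<infinity> then 0 else \<phi> \<omega> (real_of_ereal (S \<omega>)))"
        unfolding P_def V_def W_def S_def t_def by (rule sum_first_hit_tendsto[where w = "\<lambda>t. x + X t \<omega>"])
      then show "(\<lambda>n. P n \<omega>) \<longlonglongrightarrow> discount 1 (S \<omega>) * g (X (real_of_ereal (S \<omega>) + s) \<omega> - X (real_of_ereal (S \<omega>)) \<omega>)"
        by (simp add: \<phi>_def discount_def split: if_splits)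
    qed
    show "AE \<omega> in M. norm (P n \<omega>) \<le> 1" for n
    proof (rule AE_I2)
      fix \<omega>
      have "0 \<le> real_of_ereal (S \<omega>)" using S_ge[of \<omega>] by (rule real_of_ereal_pos)
      then show "norm (P n \<omega>) \<le> 1" unfolding P_eq using \<phi>01 by auto
    qed
    show "P n \<in> borel_measurable M" for n unfolding P_def[abs_def] \<phi>_def by measurable
  qed auto
  moreover have "(\<integral>\<omega>. P n \<omega> \<partial>M) \<le> (\<integral>\<omega>. g (X s \<omega>) \<partial>M)" for n
  proof -
    have single: "(\<integral>\<omega>. V k \<omega> * g (X (t k + s) \<omega> - X (t k) \<omega>) \<partial>M) = (\<integral>\<omega>. V k \<omega> \<partial>M) * (\<integral>\<omega>. g (X s \<omega>) \<partial>M)" for k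
    proof -
      define F where "F y = (\<Prod>j<k. indicator (- D) (x + y j)) * (indicator D (x + y k) :: real)" for y :: "nat \<Rightarrow> real"
      have F: "F \<in> borel_measurable (PiM {..k} (\<lambda>_. borel))" unfolding F_def[abs_def] by measurable
      have F1: "\<bar>F y\<bar> \<le> 1" for y
      proof -
        have "0 \<le> F y" "F y \<le> 1" unfolding F_def by (auto intro!: mult_nonneg_nonneg prod_nonneg prod_le_1 mult_le_one)
        then show ?thesis by simp
      qed
      have VF: "V k \<omega> = F (\<lambda>j\<in>{..k}. X (t j) \<omega>)" for \<omega>
        by (simp add: V_def F_def W_def)
      show ?thesis unfolding VF
        by (rule markov[where d = 1]) (use t0 F F1 g01 grid_mono[of _ "Suc _"] s in \<open>auto simp: t_def\<close>)
    qed
    have int: "integrable M (\<lambda>\<omega>. exp (- t k) * (V k \<omega> * g (X (t k + s) \<omega> - X (t k) \<omega>)))" for k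
      using g01 V01 by (intro integrable_mult_right integrable_bounded[of _ 1]) (auto simp: abs_mult intro!: mult_le_one)
    have "(\<integral>\<omega>. P n \<omega> \<partial>M) = (\<integral>\<omega>. (\<Sum>k<n. exp (- t k) * (V k \<omega> * g (X (t k + s) \<omega> - X (t k) \<omega>))) \<partial>M)"
      by (simp add: P_def \<phi>_def mult_ac)
    also have "\<dots> = (\<Sum>k<n. \<integral>\<omega>. exp (- t k) * (V k \<omega> * g (X (t k + s) \<omega> - X (t k) \<omega>)) \<partial>M)"
      by (rule Bochner_Integration.integral_sum[OF int])
    also have "\<dots> = (\<Sum>k<n. exp (- t k) * ((\<integral>\<omega>. V k \<omega> \<partial>M) * (\<integral>\<omega>. g (X s \<omega>) \<partial>M)))"
      by (simp add: single)
    also have "\<dots> \<le> (\<Sum>k<n. 1 * ((\<integral>\<omega>. V k \<omega> \<partial>M) * (\<integral>\<omega>. g (X s \<omega>) \<partial>M)))"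
      using t0 g01 V01 by (intro sum_mono mult_right_mono mult_nonneg_nonneg Bochner_Integration.integral_nonneg) auto
    also have "\<dots> = (\<integral>\<omega>. (\<Sum>k<n. V k \<omega>) \<partial>M) * (\<integral>\<omega>. g (X s \<omega>) \<partial>M)"
      using Vint by (simp add: sum_distrib_right)
    also have "\<dots> \<le> 1 * (\<integral>\<omega>. g (X s \<omega>) \<partial>M)"
    proof (intro mult_right_mono Bochner_Integration.integral_nonneg g01)
      have "(\<Sum>k<n. V k \<omega>) \<le> 1" for \<omega>
        using sum_first_hit[of D "\<lambda>t. x + X t \<omega>" a m "\<lambda>_. 1" n]
        by (simp add: V_def W_def t_def split: if_splits)
      then have "(\<integral>\<omega>. (\<Sum>k<n. V k \<omega>) \<partial>M) \<le> (\<integral>\<omega>. 1 \<partial>M)"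
        using Vint by (intro integral_mono) auto
      then show "(\<integral>\<omega>. (\<Sum>k<n. V k \<omega>) \<partial>M) \<le> 1" by (simp add: prob_space)
    qed
    finally show ?thesis by simp
  qed
  ultimately show ?thesis by (intro LIMSEQ_le_const2[OF lim]) auto
qed

end

section \<open>From grids to open neighbourhoods\<close>

definition cos_transform :: "(real \<Rightarrow> real) \<Rightarrow> real \<Rightarrow> real" where
  "cos_transform v y = (\<integral>\<xi>. v \<xi> * cos (\<xi> * y) \<partial>lborel)"

lemma integrable_cos_transform:
  fixes v :: "real \<Rightarrow> real"
  assumes "integrable lborel v"
  shows "integrable lborel (\<lambda>\<xi>. v \<xi> * cos (\<xi> * y))"
proof (rule Bochner_Integration.integrable_bound[OF assms])
  have [measurable]: "v \<in> borel_measurable borel" using assms by auto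
  show "(\<lambda>\<xi>. v \<xi> * cos (\<xi> * y)) \<in> borel_measurable lborel" by measurable
  show "AE \<xi> in lborel. norm (v \<xi> * cos (\<xi> * y)) \<le> norm (v \<xi>)"
    unfolding real_norm_def by (intro AE_I2 abs_mult_le(1)) auto
qed

lemma cos_transform_measurable [measurable]:
  assumes [measurable]: "v \<in> borel_measurable borel"
  shows "cos_transform v \<in> borel_measurable borel"
  unfolding cos_transform_def[abs_def] by measurable

lemma cos_transform_diff_le:
  assumes "integrable lborel u" "integrable lborel v" "integrable lborel d" "\<And>\<xi>. \<bar>u \<xi> - v \<xi>\<bar> \<le> d \<xi>"
  shows "\<bar>cos_transform u y - cos_transform v y\<bar> \<le> (\<integral>\<xi>. d \<xi> \<partial>lborel)"
proof -
  have "cos_transform u y - cos_transform v y = (\<integral>\<xi>. (u \<xi> - v \<xi>) * cos (\<xi> * y) \<partial>lborel)"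
    using integrable_cos_transform[OF assms(1), of y] integrable_cos_transform[OF assms(2), of y]
    by (simp add: cos_transform_def left_diff_distrib)
  also have "\<bar>\<dots>\<bar> \<le> (\<integral>\<xi>. d \<xi> \<partial>lborel)"
    using assms by (intro integral_abs_bound_integral integrable_cos_transform Bochner_Integration.integrable_diff abs_mult_le(1)) auto
  finally show ?thesis .
qed

lemma cos_transform_le:
  assumes "integrable lborel v"
  shows "\<bar>cos_transform v y\<bar> \<le> (\<integral>\<xi>. \<bar>v \<xi>\<bar> \<partial>lborel)"
  unfolding cos_transform_def
  using assms by (intro integral_abs_bound_integral integrable_cos_transform integrable_abs abs_mult_le(1)) auto

lemma tendsto_cos_transform:
  assumes v: "integrable lborel v" and y: "y \<longlonglongrightarrow> z"
  shows "(\<lambda>n. cos_transform v (y n)) \<longlonglongrightarrow> cos_transform v z"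
  unfolding cos_transform_def
proof (rule integral_dominated_convergence[where w = "\<lambda>\<xi>. \<bar>v \<xi>\<bar>"])
  show "AE \<xi> in lborel. (\<lambda>n. v \<xi> * cos (\<xi> * y n)) \<longlonglongrightarrow> v \<xi> * cos (\<xi> * z)"
    by (intro AE_I2 tendsto_intros y)
  show "AE \<xi> in lborel. norm (v \<xi> * cos (\<xi> * y n)) \<le> \<bar>v \<xi>\<bar>" for n
    unfolding real_norm_def by (intro AE_I2 abs_mult_le(1)) auto
qed (use v integrable_cos_transform[OF v] in auto)

text \<open>Compares the potential of the discrete walk with step \<open>h\<close> to that of the
  process; both directions come from \<open>1 + u \<le> exp u\<close>, at \<open>u\<close> and at
  \<open>- u\<close>. The bound is free of \<open>p\<close>, hence uniform over all
  frequencies.\<close>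

lemma inverse_one_minus_exp_bounds:
  fixes h p :: real
  assumes h: "0 < h" and p: "0 < p"
  shows "\<bar>h / (1 - exp (- (h * p))) - 1 / p\<bar> \<le> h"
proof -
  define u where "u = h * p"
  have u: "0 < u" using assms by (simp add: u_def)
  have e: "0 < 1 - exp (- u)" using u by simp
  have "1 - exp (- u) \<le> u" using exp_ge_add_one_self[of "- u"] by simp
  then have 1: "1 / u \<le> 1 / (1 - exp (- u))" using u e by (intro divide_left_mono) auto
  have "(1 + u) * exp (- u) \<le> exp u * exp (- u)" by (intro mult_right_mono exp_ge_add_one_self_aux) (use u in auto)
  then have "u \<le> (1 + u) * (1 - exp (- u))" by (simp add: exp_add[symmetric] algebra_simps)
  then have 2: "1 / (1 - exp (- u)) \<le> (1 + u) / u" using u e by (simp add: field_simps)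
  have "h * (1 / u) \<le> h * (1 / (1 - exp (- u)))" "h * (1 / (1 - exp (- u))) \<le> h * ((1 + u) / u)"
    by (rule mult_left_mono[OF 1 less_imp_le[OF h]], rule mult_left_mono[OF 2 less_imp_le[OF h]])
  moreover have "h * (1 / u) = 1 / p" "h * ((1 + u) / u) = 1 / p + h"
    using assms by (auto simp: u_def field_simps)
  ultimately show ?thesis by (simp add: u_def)
qed

context regular_levy_process
begin

text \<open>The Fourier side of the resolvent, restricted to positive frequencies; the density in
  space is, up to a factor, its cosine transform \<open>G\<^sub>l\<close>.\<close>

definition resolvent_density :: "real \<Rightarrow> real \<Rightarrow> real" where
  "resolvent_density l \<xi> = indicator {0<..} \<xi> / (l + \<psi> \<xi>)"

lemma resolvent_density_measurable [measurable]: "resolvent_density l \<in> borel_measurable borel"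
  unfolding resolvent_density_def[abs_def] by measurable

lemma integrable_resolvent_density: "0 < l \<Longrightarrow> integrable lborel (resolvent_density l)"
  using integrable_resolvent[of l] by (simp add: set_integrable_def resolvent_density_def[abs_def])

lemma resolvent_density_nonneg: "0 < l \<Longrightarrow> 0 \<le> resolvent_density l \<xi>"
  by (simp add: resolvent_density_def add_nonneg_nonneg)

lemma integrable_times_bounded:
  fixes u v :: "real \<Rightarrow> real"
  assumes "integrable lborel u" "v \<in> borel_measurable borel" "\<And>\<xi>. \<bar>v \<xi>\<bar> \<le> 1"
  shows "integrable lborel (\<lambda>\<xi>. u \<xi> * v \<xi>)"
  by (rule Bochner_Integration.integrable_bound[OF assms(1)])
     (use assms in \<open>auto simp: abs_mult intro!: mult_left_le\<close>)

lemma tendsto_stopped: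
  assumes \<omega>: "\<omega> \<in> space M" and f: "f \<longlonglongrightarrow> t" "\<And>n. t \<le> f n" "0 \<le> t" and l: "0 < l"
    and H: "\<And>y z. y \<longlonglongrightarrow> z \<Longrightarrow> (\<lambda>n. H (y n)) \<longlonglongrightarrow> H z" "\<And>y. \<bar>H y\<bar> \<le> C"
  shows "(\<lambda>n. discount l (f n) * H (x + X (real_of_ereal (f n)) \<omega>)) \<longlonglongrightarrow> discount l t * H (x + X (real_of_ereal t) \<omega>)"
proof (rule tendsto_discount_mult[OF l f(1,3) H(2)])
  assume t: "t \<noteq> \<infinity>"
  have "(\<lambda>n. X (real_of_ereal (f n) + 0) \<omega>) \<longlonglongrightarrow> X (real_of_ereal t + 0) \<omega>"
    by (rule tendsto_decreasing_compose[OF f(1,2) t f(3) X_right[OF \<omega>]])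
  then show "(\<lambda>n. H (x + X (real_of_ereal (f n)) \<omega>)) \<longlonglongrightarrow> H (x + X (real_of_ereal t) \<omega>)"
    by (intro H tendsto_add tendsto_const) simp
qed

lemma discount_mult_bound: "0 < l \<Longrightarrow> 0 \<le> t \<Longrightarrow> \<bar>v\<bar> \<le> C \<Longrightarrow> \<bar>discount l t * v\<bar> \<le> C"
  using discount_nonneg[of l t] discount_le_1[of l t] by (intro abs_mult_le(2)) auto

text \<open>The weight is found backwards: \<open>v m\<close> is such that multiplication by
  \<open>1 - exp (- (h m * p \<xi>))\<close> leaves \<open>h m\<close> times the Fejer weight, whose
  cosine transform vanishes at distance at least \<open>e\<close> from the origin. Since
  \<open>0 \<in> B\<close>, every point outside \<open>D\<close> is that far away, so the transform
  of \<open>v m\<close> is harmonic for the walk on the grid. As the mesh shrinks,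
  \<open>v m\<close> tends to \<open>w\<close> in mean.\<close>

lemma optional_stopping_fejer:
  fixes e l a x :: real and B :: "real set"
  defines "D \<equiv> {y. infdist y B < e}"
    and "w \<equiv> \<lambda>\<xi>. fejer (e * \<xi>) * resolvent_density l \<xi>"
  defines "S \<equiv> \<lambda>\<omega>. open_hit (\<lambda>t. x + X t \<omega>) D a"
  assumes l: "0 < l" and a: "0 \<le> a" and e: "0 < e" and B: "0 \<in> B"
  shows "(\<integral>\<omega>. discount l (S \<omega>) * cos_transform w (x + X (real_of_ereal (S \<omega>)) \<omega>) \<partial>M)
    = exp (- l * a) * cos_transform (\<lambda>\<xi>. w \<xi> * exp (- a * \<psi> \<xi>)) x"
proof -
  have "open D" unfolding D_def by (intro open_Collect_less continuous_intros)
  then have D[measurable]: "D \<in> sets borel" by simp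
  define p where "p \<xi> = l + \<psi> \<xi>" for \<xi>
  have p: "0 < p \<xi>" for \<xi> using l by (simp add: p_def add_pos_nonneg)
  have [measurable]: "p \<in> borel_measurable borel" unfolding p_def[abs_def] by measurable
  define f where "f \<xi> = indicator {0<..} \<xi> * fejer (e * \<xi>)" for \<xi>
  have f_int: "integrable lborel f"
    using set_integrable_fejer[OF e] by (simp add: set_integrable_def f_def[abs_def])
  have [measurable]: "f \<in> borel_measurable borel" unfolding f_def[abs_def] by measurable
  have f0: "0 \<le> f \<xi>" for \<xi> by (simp add: f_def fejer_nonneg)
  have w_eq: "w \<xi> = f \<xi> * (1 / p \<xi>)" for \<xi> by (simp add: w_def f_def p_def resolvent_density_def)
  have w_int: "integrable lborel w"
    using integrable_times_bounded[OF integrable_resolvent_density[OF l], of "\<lambda>\<xi>. fejer (e * \<xi>)"] fejer_le_1 fejer_nonneg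
    by (simp add: w_def mult.commute)
  have [measurable]: "w \<in> borel_measurable borel" using w_int by auto
  define h where "h m = (1 / 2 ^ m :: real)" for m :: nat
  have h: "0 < h m" for m by (simp add: h_def)
  define v where "v m \<xi> = f \<xi> * (h m / (1 - exp (- (h m * p \<xi>))))" for m \<xi>
  have [measurable]: "v m \<in> borel_measurable borel" for m unfolding v_def[abs_def] by measurable
  have vw: "\<bar>v m \<xi> - w \<xi>\<bar> \<le> h m * f \<xi>" for m \<xi>
  proof -
    have "v m \<xi> - w \<xi> = f \<xi> * (h m / (1 - exp (- (h m * p \<xi>))) - 1 / p \<xi>)"
      by (simp add: v_def w_eq right_diff_distrib)
    then show ?thesis
      using mult_left_mono[OF inverse_one_minus_exp_bounds[OF h[of m] p[of \<xi>]] f0[of \<xi>]] f0[of \<xi>] by (simp add: abs_mult mult.commute)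
  qed
  have hf_int: "integrable lborel (\<lambda>\<xi>. h m * f \<xi>)" for m by (intro integrable_mult_right f_int)
  have v_int: "integrable lborel (v m)" for m
  proof -
    have "integrable lborel (\<lambda>\<xi>. v m \<xi> - w \<xi>)"
      by (rule Bochner_Integration.integrable_bound[OF hf_int[of m]]) (use vw[of m] in \<open>auto intro!: AE_I2 order_trans[OF _ abs_ge_self]\<close>)
    from Bochner_Integration.integrable_add[OF this w_int] show ?thesis by simp
  qed
  define c where "c = (\<integral>\<xi>. f \<xi> \<partial>lborel)"
  define T where "T m \<omega> = grid_hit (\<lambda>t. x + X t \<omega>) D a m" for m \<omega>
  have [measurable]: "T m \<in> borel_measurable M" for m unfolding T_def[abs_def] by measurable
  have [measurable]: "S \<in> borel_measurable M" unfolding S_def by measurable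
  have T0: "0 \<le> T m \<omega>" for m \<omega>
    using grid_hit_ge[of a "\<lambda>t. x + X t \<omega>" D m] a unfolding T_def by (meson ereal_less_eq(5) order_trans)
  have S0: "0 \<le> S \<omega>" for \<omega>
    using open_hit_ge[of a "\<lambda>t. x + X t \<omega>" D] a unfolding S_def by (meson ereal_less_eq(5) order_trans)
  have TS: "(\<lambda>m. T m \<omega>) \<longlonglongrightarrow> S \<omega>" "S \<omega> \<le> T m \<omega>" for \<omega> m
    using grid_hit_tendsto[of "\<lambda>t. x + X t \<omega>" D a] by (auto simp: T_def S_def open_hit_def INF_lower)
  define R where "R = exp (- l * a) * cos_transform (\<lambda>\<xi>. w \<xi> * exp (- a * \<psi> \<xi>)) x"
  have grid: "(\<integral>\<omega>. discount l (T m \<omega>) * cos_transform (v m) (x + X (real_of_ereal (T m \<omega>)) \<omega>) \<partial>M)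
     = exp (- l * a) * cos_transform (\<lambda>\<xi>. v m \<xi> * exp (- a * \<psi> \<xi>)) x" for m
    unfolding T_def cos_transform_def
  proof (rule optional_stopping_grid[OF v_int D l a])
    fix y assume "y \<notin> D"
    then have "e \<le> infdist y B" by (simp add: D_def)
    also have "\<dots> \<le> dist y 0" using B by (rule infdist_le)
    finally have y: "e \<le> \<bar>y\<bar>" by (simp add: dist_real_def)
    have eq: "v m \<xi> * (1 - exp (- (1 / 2 ^ m) * (l + \<psi> \<xi>))) * cos (\<xi> * y) = h m * (indicator {0<..} \<xi> *\<^sub>R (fejer (e * \<xi>) * cos (\<xi> * y)))" for \<xi>
    proof -
      have "0 < 1 - exp (- (h m * p \<xi>))" using h p by simp
      then have "v m \<xi> * (1 - exp (- (h m * p \<xi>))) = h m * f \<xi>"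
        using h[of m] p[of \<xi>] by (simp add: v_def)
      moreover have "exp (- (1 / 2 ^ m) * (l + \<psi> \<xi>)) = exp (- (h m * p \<xi>))" by (simp add: h_def p_def)
      ultimately show ?thesis by (simp only: f_def) simp
    qed
    show "(\<integral>\<xi>. v m \<xi> * (1 - exp (- (1 / 2 ^ m) * (l + \<psi> \<xi>))) * cos (\<xi> * y) \<partial>lborel) = 0"
      unfolding eq using cosine_transform_fejer_eq_0[OF e y] by (simp add: set_lebesgue_integral_def)
  qed
  have meas: "(\<lambda>\<omega>. discount l (T m \<omega>) * cos_transform u (x + X (real_of_ereal (T m \<omega>)) \<omega>)) \<in> borel_measurable M"
    if [measurable]: "u \<in> borel_measurable borel" for u m by measurable
  have int: "integrable M (\<lambda>\<omega>. discount l (T m \<omega>) * cos_transform u (x + X (real_of_ereal (T m \<omega>)) \<omega>))"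
    if "integrable lborel u" for u m
    by (rule integrable_bounded[OF meas discount_mult_bound[OF l T0 cos_transform_le[OF that]]]) (use that in auto)
  \<comment> \<open>Replacing \<open>v m\<close> by \<open>w\<close> costs \<open>h m * c\<close> in
    the stopped expectation and once more on the right side of the grid identity.\<close>
  have close: "\<bar>(\<integral>\<omega>. discount l (T m \<omega>) * cos_transform w (x + X (real_of_ereal (T m \<omega>)) \<omega>) \<partial>M) - R\<bar> \<le> 2 * (h m * c)" for m
  proof -
    have "\<bar>\<integral>\<omega>. discount l (T m \<omega>) * (cos_transform (v m) (x + X (real_of_ereal (T m \<omega>)) \<omega>)
          - cos_transform w (x + X (real_of_ereal (T m \<omega>)) \<omega>)) \<partial>M\<bar> \<le> (\<integral>\<xi>. h m * f \<xi> \<partial>lborel)"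
      by (intro abs_expectation_le discount_mult_bound l T0 cos_transform_diff_le v_int w_int hf_int vw) measurable
    then have 1: "\<bar>(\<integral>\<omega>. discount l (T m \<omega>) * cos_transform (v m) (x + X (real_of_ereal (T m \<omega>)) \<omega>) \<partial>M)
       - (\<integral>\<omega>. discount l (T m \<omega>) * cos_transform w (x + X (real_of_ereal (T m \<omega>)) \<omega>) \<partial>M)\<bar> \<le> h m * c"
      using int[OF v_int] int[OF w_int] by (simp add: right_diff_distrib c_def)
    have eb: "\<bar>exp (- a * \<psi> \<xi>)\<bar> \<le> 1" for \<xi> using a by simp
    have "\<bar>cos_transform (\<lambda>\<xi>. v m \<xi> * exp (- a * \<psi> \<xi>)) x - cos_transform (\<lambda>\<xi>. w \<xi> * exp (- a * \<psi> \<xi>)) x\<bar> \<le> (\<integral>\<xi>. h m * f \<xi> \<partial>lborel)"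
    proof (rule cos_transform_diff_le[OF integrable_times_bounded[OF v_int _ eb] integrable_times_bounded[OF w_int _ eb] hf_int])
      show "\<bar>v m \<xi> * exp (- a * \<psi> \<xi>) - w \<xi> * exp (- a * \<psi> \<xi>)\<bar> \<le> h m * f \<xi>" for \<xi>
        using abs_mult_le(1)[OF vw[of m \<xi>] eb[of \<xi>]] by (simp add: left_diff_distrib)
    qed measurable
    then have "\<bar>exp (- l * a) * (cos_transform (\<lambda>\<xi>. v m \<xi> * exp (- a * \<psi> \<xi>)) x - cos_transform (\<lambda>\<xi>. w \<xi> * exp (- a * \<psi> \<xi>)) x)\<bar> \<le> h m * c"
      using l a by (intro abs_mult_le(2)) (auto simp: c_def)
    then have "\<bar>exp (- l * a) * cos_transform (\<lambda>\<xi>. v m \<xi> * exp (- a * \<psi> \<xi>)) x - R\<bar> \<le> h m * c"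
      by (simp add: R_def right_diff_distrib)
    with 1 show ?thesis unfolding grid by linarith
  qed
  have "(\<lambda>m. \<integral>\<omega>. discount l (T m \<omega>) * cos_transform w (x + X (real_of_ereal (T m \<omega>)) \<omega>) \<partial>M)
     \<longlonglongrightarrow> (\<integral>\<omega>. discount l (S \<omega>) * cos_transform w (x + X (real_of_ereal (S \<omega>)) \<omega>) \<partial>M)"
  proof (rule integral_dominated_convergence[where w = "\<lambda>_. \<integral>\<xi>. \<bar>w \<xi>\<bar> \<partial>lborel"])
    show "AE \<omega> in M. (\<lambda>m. discount l (T m \<omega>) * cos_transform w (x + X (real_of_ereal (T m \<omega>)) \<omega>))
       \<longlonglongrightarrow> discount l (S \<omega>) * cos_transform w (x + X (real_of_ereal (S \<omega>)) \<omega>)"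
      by (intro AE_I2 tendsto_stopped[OF _ TS S0 l tendsto_cos_transform[OF w_int] cos_transform_le[OF w_int]])
    show "AE \<omega> in M. norm (discount l (T m \<omega>) * cos_transform w (x + X (real_of_ereal (T m \<omega>)) \<omega>)) \<le> (\<integral>\<xi>. \<bar>w \<xi>\<bar> \<partial>lborel)" for m
      using discount_mult_bound[OF l T0 cos_transform_le[OF w_int]] by simp
  qed measurable
  moreover have "(\<lambda>m. \<integral>\<omega>. discount l (T m \<omega>) * cos_transform w (x + X (real_of_ereal (T m \<omega>)) \<omega>) \<partial>M) \<longlonglongrightarrow> R"
  proof (rule LIM_zero_cancel, rule Lim_null_comparison)
    show "\<forall>\<^sub>F m in sequentially. norm ((\<integral>\<omega>. discount l (T m \<omega>) * cos_transform w (x + X (real_of_ereal (T m \<omega>)) \<omega>) \<partial>M) - R) \<le> 2 * (h m * c)"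
      using close by simp
    have "h \<longlonglongrightarrow> 0" unfolding h_def using LIMSEQ_realpow_zero[of "1/2"] by (simp add: power_one_over)
    then show "(\<lambda>m. 2 * (h m * c)) \<longlonglongrightarrow> 0" by (intro tendsto_mult_right_zero tendsto_mult_left_zero)
  qed
  ultimately show ?thesis unfolding R_def by (rule LIMSEQ_unique)
qed

text \<open>The grid times decrease to the entrance time, so right-continuity at both ends of the
  increment carries \<open>increment_grid\<close> over. The test function
  \<open>min 1 \<bar>z\<bar>\<close> is bounded, continuous and zero only at 0.\<close>

lemma increment_open:
  fixes D :: "real set" and a x s :: real
  defines "S \<equiv> \<lambda>\<omega>. open_hit (\<lambda>t. x + X t \<omega>) D a" and "g \<equiv> \<lambda>z::real. min 1 \<bar>z\<bar>"
  assumes D[measurable]: "D \<in> sets borel" and a: "0 \<le> a" and s: "0 \<le> s"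
  shows "(\<integral>\<omega>. discount 1 (S \<omega>) * g (X (real_of_ereal (S \<omega>) + s) \<omega> - X (real_of_ereal (S \<omega>)) \<omega>) \<partial>M)
    \<le> (\<integral>\<omega>. g (X s \<omega>) \<partial>M)"
proof -
  have [measurable]: "g \<in> borel_measurable borel" unfolding g_def by measurable
  have g01: "0 \<le> g z" "g z \<le> 1" for z by (auto simp: g_def)
  define T where "T m \<omega> = grid_hit (\<lambda>t. x + X t \<omega>) D a m" for m \<omega>
  have [measurable]: "T m \<in> borel_measurable M" for m unfolding T_def[abs_def] by measurable
  have [measurable]: "S \<in> borel_measurable M" unfolding S_def by measurable
  have T0: "0 \<le> T m \<omega>" for m \<omega>
    using grid_hit_ge[of a "\<lambda>t. x + X t \<omega>" D m] a unfolding T_def by (meson ereal_less_eq(5) order_trans)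
  have S0: "0 \<le> S \<omega>" for \<omega>
    using open_hit_ge[of a "\<lambda>t. x + X t \<omega>" D] a unfolding S_def by (meson ereal_less_eq(5) order_trans)
  have TS: "(\<lambda>m. T m \<omega>) \<longlonglongrightarrow> S \<omega>" "S \<omega> \<le> T m \<omega>" for \<omega> m
    using grid_hit_tendsto[of "\<lambda>t. x + X t \<omega>" D a] by (auto simp: T_def S_def open_hit_def INF_lower)
  have "(\<lambda>m. \<integral>\<omega>. discount 1 (T m \<omega>) * g (X (real_of_ereal (T m \<omega>) + s) \<omega> - X (real_of_ereal (T m \<omega>)) \<omega>) \<partial>M)
    \<longlonglongrightarrow> (\<integral>\<omega>. discount 1 (S \<omega>) * g (X (real_of_ereal (S \<omega>) + s) \<omega> - X (real_of_ereal (S \<omega>)) \<omega>) \<partial>M)"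
  proof (rule integral_dominated_convergence[where w = "\<lambda>_. 1"])
    show "AE \<omega> in M. (\<lambda>m. discount 1 (T m \<omega>) * g (X (real_of_ereal (T m \<omega>) + s) \<omega> - X (real_of_ereal (T m \<omega>)) \<omega>))
       \<longlonglongrightarrow> discount 1 (S \<omega>) * g (X (real_of_ereal (S \<omega>) + s) \<omega> - X (real_of_ereal (S \<omega>)) \<omega>)"
    proof (intro AE_I2 tendsto_discount_mult[where C = 1] TS S0)
      fix \<omega> assume \<omega>: "\<omega> \<in> space M" and fin: "S \<omega> \<noteq> \<infinity>"
      have "(\<lambda>m. X (real_of_ereal (T m \<omega>) + s) \<omega>) \<longlonglongrightarrow> X (real_of_ereal (S \<omega>) + s) \<omega>"
        "(\<lambda>m. X (real_of_ereal (T m \<omega>) + 0) \<omega>) \<longlonglongrightarrow> X (real_of_ereal (S \<omega>) + 0) \<omega>"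
        by (rule tendsto_decreasing_compose[OF TS fin S0 X_right[OF \<omega>]])+
      then show "(\<lambda>m. g (X (real_of_ereal (T m \<omega>) + s) \<omega> - X (real_of_ereal (T m \<omega>)) \<omega>))
         \<longlonglongrightarrow> g (X (real_of_ereal (S \<omega>) + s) \<omega> - X (real_of_ereal (S \<omega>)) \<omega>)"
        unfolding g_def by (intro tendsto_min tendsto_const tendsto_rabs tendsto_diff) auto
    qed (use g01 in auto)
    show "AE \<omega> in M. norm (discount 1 (T m \<omega>) * g (X (real_of_ereal (T m \<omega>) + s) \<omega> - X (real_of_ereal (T m \<omega>)) \<omega>)) \<le> 1" for m
      unfolding real_norm_def using g01 by (intro AE_I2 discount_mult_bound T0) auto
  qed auto
  then show ?thesis
    by (rule LIMSEQ_le_const2)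
       (use increment_grid[where g = g and x = x, OF D a s _ g01] in \<open>auto simp: T_def\<close>)
qed

text \<open>A left limit along the hitting times is not jumped away from, since the increments after the
  stopping times have the law of the increments from \<open>0\<close>.\<close>

lemma quasi_left_continuous:
  fixes S :: "nat \<Rightarrow> 'a \<Rightarrow> ereal" and g :: "real \<Rightarrow> real"
  defines "g \<equiv> \<lambda>z. min 1 \<bar>z\<bar>"
  assumes [measurable]: "\<And>n. S n \<in> borel_measurable M"
    and inc: "\<And>\<omega>. incseq (\<lambda>n. S n \<omega>)" and ge: "\<And>n \<omega>. ereal a \<le> S n \<omega>" and a: "0 < a"
    and bound: "\<And>n s. 0 < s \<Longrightarrow>
      (\<integral>\<omega>. discount 1 (S n \<omega>) * g (X (real_of_ereal (S n \<omega>) + s) \<omega> - X (real_of_ereal (S n \<omega>)) \<omega>) \<partial>M)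
        \<le> (\<integral>\<omega>. g (X s \<omega>) \<partial>M)"
  shows "AE \<omega> in M. (SUP n. S n \<omega>) \<noteq> \<infinity> \<longrightarrow>
     (\<lambda>n. X (real_of_ereal (S n \<omega>)) \<omega>) \<longlonglongrightarrow> X (real_of_ereal (SUP n. S n \<omega>)) \<omega>"
proof -
  have [measurable]: "g \<in> borel_measurable borel" unfolding g_def by measurable
  have g01: "0 \<le> g z" "g z \<le> 1" for z by (auto simp: g_def)
  have S0: "0 \<le> S n \<omega>" for n \<omega> using ge[of n \<omega>] a by (meson ereal_less_eq(5) less_imp_le order_trans)
  define s where "s i = 1 / real (Suc i)" for i
  have s: "0 < s i" for i by (simp add: s_def)
  have s_lim: "s \<longlonglongrightarrow> 0" unfolding s_def using LIMSEQ_inverse_real_of_nat by (simp add: inverse_eq_divide)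
  \<comment> \<open>Discounted size of the increment over a time \<open>s i\<close> after
    \<open>S n\<close>. Its mean is at most \<open>b i\<close>, uniformly in \<open>n\<close>, and
    \<open>b i\<close> tends to 0 by right-continuity at time 0.\<close>
  define q where "q i n \<omega> = discount 1 (S n \<omega>) * g (X (real_of_ereal (S n \<omega>) + s i) \<omega> - X (real_of_ereal (S n \<omega>)) \<omega>)" for i n \<omega>
  have [measurable]: "q i n \<in> borel_measurable M" for i n unfolding q_def[abs_def] by measurable
  have q0: "0 \<le> q i n \<omega>" for i n \<omega> unfolding q_def using g01 discount_nonneg by simp
  have q1: "\<bar>q i n \<omega>\<bar> \<le> 1" for i n \<omega> unfolding q_def using g01 S0 by (intro discount_mult_bound) auto
  define b where "b i = (\<integral>\<omega>. g (X (s i) \<omega>) \<partial>M)" for i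
  have b_lim: "b \<longlonglongrightarrow> (\<integral>\<omega>. 0 \<partial>M)"
    unfolding b_def
  proof (rule integral_dominated_convergence[where w = "\<lambda>_. 1"])
    show "AE \<omega> in M. (\<lambda>i. g (X (s i) \<omega>)) \<longlonglongrightarrow> 0"
    proof (rule AE_I2)
      fix \<omega> assume \<omega>: "\<omega> \<in> space M"
      have "(\<lambda>i. X (s i) \<omega>) \<longlonglongrightarrow> X 0 \<omega>"
        by (rule tendsto_right_compose[OF X_right[OF \<omega>] s_lim]) (auto intro: always_eventually less_imp_le s)
      then have "(\<lambda>i. g (X (s i) \<omega>)) \<longlonglongrightarrow> min 1 \<bar>0\<bar>"
        unfolding g_def X_0[OF \<omega>] by (intro tendsto_min tendsto_const tendsto_rabs)
      then show "(\<lambda>i. g (X (s i) \<omega>)) \<longlonglongrightarrow> 0" by simp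
    qed
  qed (use g01 in auto)
  have nn: "(\<integral>\<^sup>+\<omega>. ennreal (q i n \<omega>) \<partial>M) \<le> ennreal (b i)" for i n
  proof -
    have "(\<integral>\<^sup>+\<omega>. ennreal (q i n \<omega>) \<partial>M) = ennreal (\<integral>\<omega>. q i n \<omega> \<partial>M)"
      by (rule nn_integral_eq_integral) (auto intro!: integrable_bounded[of _ 1] q1 q0)
    also have "\<dots> \<le> ennreal (b i)"
      unfolding q_def b_def by (intro ennreal_leI bound s)
    finally show ?thesis .
  qed
  \<comment> \<open>Fatou is applied twice, with \<open>n\<close> inside: for fixed \<open>i\<close>
    the span from \<open>S n\<close> to \<open>S n + s i\<close> eventually reaches beyond the limit
    time when this time is finite and not attained.\<close>
  have "(\<integral>\<^sup>+\<omega>. liminf (\<lambda>i. liminf (\<lambda>n. ennreal (q i n \<omega>))) \<partial>M) \<le> liminf (\<lambda>i. \<integral>\<^sup>+\<omega>. liminf (\<lambda>n. ennreal (q i n \<omega>)) \<partial>M)"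
    by (rule nn_integral_liminf) measurable
  also have "\<dots> \<le> liminf (\<lambda>i. ennreal (b i))"
  proof (rule Liminf_mono, rule always_eventually, rule allI)
    fix i
    have "(\<integral>\<^sup>+\<omega>. liminf (\<lambda>n. ennreal (q i n \<omega>)) \<partial>M) \<le> liminf (\<lambda>n. \<integral>\<^sup>+\<omega>. ennreal (q i n \<omega>) \<partial>M)"
      by (rule nn_integral_liminf) measurable
    also have "\<dots> \<le> liminf (\<lambda>n. ennreal (b i))" by (intro Liminf_mono always_eventually allI nn)
    finally show "(\<integral>\<^sup>+\<omega>. liminf (\<lambda>n. ennreal (q i n \<omega>)) \<partial>M) \<le> ennreal (b i)" by (simp add: Liminf_const)
  qed
  also have "(\<lambda>i. ennreal (b i)) \<longlonglongrightarrow> ennreal 0"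
    by (rule tendsto_ennrealI) (use b_lim in simp)
  then have "liminf (\<lambda>i. ennreal (b i)) = ennreal 0" by (rule lim_imp_Liminf[rotated]) simp
  finally have "(\<integral>\<^sup>+\<omega>. liminf (\<lambda>i. liminf (\<lambda>n. ennreal (q i n \<omega>))) \<partial>M) = 0" by simp
  then have "AE \<omega> in M. liminf (\<lambda>i. liminf (\<lambda>n. ennreal (q i n \<omega>))) = 0"
    by (subst (asm) nn_integral_0_iff_AE) measurable
  with AE_space show ?thesis
  proof eventually_elim
    case (elim \<omega>)
    note \<omega> = elim(1)
    define T where "T = (SUP n. S n \<omega>)"
    show ?case
    proof (intro impI, fold T_def)
      assume fin: "T \<noteq> \<infinity>"
      have ST: "(\<lambda>n. S n \<omega>) \<longlonglongrightarrow> T" unfolding T_def by (rule LIMSEQ_SUP[OF inc])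
      have le: "S n \<omega> \<le> T" for n unfolding T_def by (rule SUP_upper) simp
      have "ereal a \<le> T" using ge[of 0 \<omega>] le[of 0] by (rule order_trans)
      then obtain r where r: "T = ereal r" "a \<le> r" using fin by (cases T) auto
      define \<rho> where "\<rho> n = real_of_ereal (S n \<omega>)" for n
      have S\<rho>: "S n \<omega> = ereal (\<rho> n)" for n
        using le[of n] S0[of n \<omega>] by (cases "S n \<omega>") (auto simp: r \<rho>_def)
      have \<rho>_lim: "\<rho> \<longlonglongrightarrow> r" using ST by (simp add: S\<rho> r)
      have \<rho>_le: "\<rho> n \<le> r" for n using le[of n] by (simp add: S\<rho> r)
      have "(\<lambda>n. X (\<rho> n) \<omega>) \<longlonglongrightarrow> X r \<omega>"
      \<comment> \<open>If the limit time is attained, the sequence is eventually constant.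
        Otherwise it approaches strictly from the left, where a left limit \<open>L\<close> exists,
        and a jump has to be excluded.\<close>
      proof (cases "\<exists>n. \<rho> n = r")
        case True
        then obtain n where n: "\<rho> n = r" by blast
        have "\<rho> k = r" if "n \<le> k" for k
          using incseqD[OF inc[of \<omega>] that] \<rho>_le[of k] n by (simp add: S\<rho>)
        then have "\<forall>\<^sub>F k in sequentially. X (\<rho> k) \<omega> = X r \<omega>"
          by (auto simp: eventually_sequentially intro!: exI[of _ n])
        then show ?thesis by (rule tendsto_eventually)
      next
        case False
        then have lt: "\<rho> n < r" for n using \<rho>_le[of n] by (simp add: order_less_le)
        obtain L where L: "((\<lambda>t. X t \<omega>) \<longlongrightarrow> L) (at_left r)" using X_left[OF \<omega>, of r] a r by auto
        have "filterlim \<rho> (at_left r) sequentially"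
          using \<rho>_lim lt by (auto simp: filterlim_at intro!: always_eventually less_imp_neq)
        then have XL: "(\<lambda>n. X (\<rho> n) \<omega>) \<longlonglongrightarrow> L" by (rule filterlim_compose[OF L])
        have "L = X r \<omega>"
        proof (rule ccontr)
          assume ne: "L \<noteq> X r \<omega>"
          define d where "d = min 1 \<bar>X r \<omega> - L\<bar>"
          have d: "0 < d" "d \<le> 1" "d \<le> \<bar>X r \<omega> - L\<bar>" using ne by (auto simp: d_def)
          have "\<forall>\<^sub>F t in at_right r. dist (X t \<omega>) (X r \<omega>) < d / 4"
            by (rule tendstoD[OF X_right[OF \<omega>]]) (use d in simp)
          then obtain c where c: "r < c" "\<And>t. r < t \<Longrightarrow> t < c \<Longrightarrow> dist (X t \<omega>) (X r \<omega>) < d / 4"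
            by (auto simp: eventually_at_right_field)
          \<comment> \<open>If \<open>L\<close> and \<open>X r \<omega>\<close> are at least
            \<open>d\<close> apart, the increments across \<open>r\<close> have size at least
            \<open>d / 2\<close>, since each end contributes an error below \<open>d / 4\<close>;
            \<open>exp (- r)\<close> is the least discount factor up to time \<open>r\<close>. Such
            a lower bound contradicts the vanishing double limit inferior.\<close>
          define \<kappa> where "\<kappa> = exp (- r) * (d / 2)"
          have \<kappa>: "0 < \<kappa>" using d by (simp add: \<kappa>_def)
          have "\<forall>\<^sub>F i in sequentially. s i < c - r" by (rule order_tendstoD[OF s_lim]) (use c in simp)
          then have "\<forall>\<^sub>F i in sequentially. ennreal \<kappa> \<le> liminf (\<lambda>n. ennreal (q i n \<omega>))"
          proof eventually_elim
            case (elim i)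
            have "\<forall>\<^sub>F n in sequentially. r - s i < \<rho> n" by (rule order_tendstoD[OF \<rho>_lim]) (use s in simp)
            moreover have "\<forall>\<^sub>F n in sequentially. dist (X (\<rho> n) \<omega>) L < d / 4"
              by (rule tendstoD[OF XL]) (use d in simp)
            ultimately have "\<forall>\<^sub>F n in sequentially. ennreal \<kappa> \<le> ennreal (q i n \<omega>)"
            proof eventually_elim
              case (elim n)
              have "dist (X (\<rho> n + s i) \<omega>) (X r \<omega>) < d / 4"
                using elim(1) lt[of n] \<open>s i < c - r\<close> by (intro c(2)) auto
              then have "d / 2 \<le> \<bar>X (\<rho> n + s i) \<omega> - X (\<rho> n) \<omega>\<bar>"
                using elim(2) d(3) unfolding dist_real_def by linarith
              then have "d / 2 \<le> g (X (\<rho> n + s i) \<omega> - X (\<rho> n) \<omega>)" using d by (simp add: g_def)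
              moreover have "exp (- r) \<le> exp (- \<rho> n)" using \<rho>_le by simp
              ultimately have "\<kappa> \<le> exp (- \<rho> n) * g (X (\<rho> n + s i) \<omega> - X (\<rho> n) \<omega>)"
                unfolding \<kappa>_def using d by (intro mult_mono) auto
              then show ?case by (intro ennreal_leI) (simp add: q_def S\<rho> discount_def)
            qed
            then show ?case by (rule Liminf_bounded)
          qed
          then have "ennreal \<kappa> \<le> liminf (\<lambda>i. liminf (\<lambda>n. ennreal (q i n \<omega>)))" by (rule Liminf_bounded)
          then show False using elim(2) \<kappa> by simp
        qed
        then show ?thesis using XL by simp
      qed
      then show "(\<lambda>n. X (real_of_ereal (S n \<omega>)) \<omega>) \<longlonglongrightarrow> X (real_of_ereal T) \<omega>"
        by (simp add: \<rho>_def[symmetric] r)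
    qed
  qed
qed

section \<open>Closed sets, counted from a positive time on\<close>

definition near :: "real set \<Rightarrow> nat \<Rightarrow> real set" where
  "near B n = {y. infdist y B < 1 / real (Suc n)}"

definition hit_near :: "real set \<Rightarrow> real \<Rightarrow> real \<Rightarrow> nat \<Rightarrow> 'a \<Rightarrow> ereal" where
  "hit_near B x a n \<omega> = open_hit (\<lambda>t. x + X t \<omega>) (near B n) a"

text \<open>A supremum of entrance times into shrinking open neighbourhoods, measurable by
  construction. It never exceeds a time from \<open>a\<close> on at which the path is in
  \<open>B\<close>; for a positive start \<open>a\<close> and a nonempty closed \<open>B\<close>,
  \<open>AE_hit_from_mem\<close> shows that, if finite, it is almost surely such a time
  itself.\<close>

definition hit_from :: "real set \<Rightarrow> real \<Rightarrow> real \<Rightarrow> 'a \<Rightarrow> ereal" where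
  "hit_from B x a \<omega> = (SUP n. hit_near B x a n \<omega>)"

lemma open_near: "open (near B n)"
  unfolding near_def by (intro open_Collect_less continuous_intros)

lemma near_sets [measurable]: "near B n \<in> sets borel"
  using open_near by simp

lemma hit_near_measurable [measurable]: "hit_near B x a n \<in> borel_measurable M"
  unfolding hit_near_def[abs_def] by measurable

lemma hit_from_measurable [measurable]: "hit_from B x a \<in> borel_measurable M"
  unfolding hit_from_def[abs_def] by measurable

lemma open_hit_mono: "D \<subseteq> D' \<Longrightarrow> open_hit w D' a \<le> open_hit w D a"
  unfolding open_hit_def grid_hit_def by (intro INF_mono') auto

lemma hit_near_incseq: "incseq (\<lambda>n. hit_near B x a n \<omega>)"
  unfolding hit_near_def near_def
proof (intro incseq_SucI open_hit_mono Collect_mono impI)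
  fix n y assume "infdist y B < 1 / real (Suc (Suc n))"
  also have "\<dots> \<le> 1 / real (Suc n)" by (intro divide_left_mono) auto
  finally show "infdist y B < 1 / real (Suc n)" .
qed

lemma hit_near_ge: "ereal a \<le> hit_near B x a n \<omega>"
  unfolding hit_near_def by (rule open_hit_ge)

lemma hit_from_ge: "ereal a \<le> hit_from B x a \<omega>"
proof -
  have "ereal a \<le> hit_near B x a 0 \<omega>" by (rule hit_near_ge)
  also have "\<dots> \<le> hit_from B x a \<omega>" unfolding hit_from_def by (rule SUP_upper) simp
  finally show ?thesis .
qed

lemma hit_near_tendsto: "(\<lambda>n. hit_near B x a n \<omega>) \<longlonglongrightarrow> hit_from B x a \<omega>"
  unfolding hit_from_def by (rule LIMSEQ_SUP[OF hit_near_incseq])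

lemma hit_from_le:
  assumes "\<omega> \<in> space M" "x + X t \<omega> \<in> B" "a \<le> t"
  shows "hit_from B x a \<omega> \<le> ereal t"
  unfolding hit_from_def hit_near_def
proof (rule SUP_least, rule open_hit_le[OF _ open_near])
  show "((\<lambda>t. x + X t \<omega>) \<longlongrightarrow> x + X t \<omega>) (at_right t)" by (intro tendsto_intros X_right assms)
  show "x + X t \<omega> \<in> near B n" for n using assms by (simp add: near_def)
qed (use assms in auto)

lemma AE_hit_near_tendsto:
  assumes a: "0 < a"
  shows "AE \<omega> in M. hit_from B x a \<omega> \<noteq> \<infinity> \<longrightarrow>
     (\<lambda>n. X (real_of_ereal (hit_near B x a n \<omega>)) \<omega>) \<longlonglongrightarrow> X (real_of_ereal (hit_from B x a \<omega>)) \<omega>"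
  unfolding hit_from_def
  by (rule quasi_left_continuous[OF _ hit_near_incseq hit_near_ge a])
     (use increment_open[OF near_sets] a in \<open>auto simp: hit_near_def\<close>)

text \<open>At the approximating times the path is within \<open>1 / (n + 1)\<close> of
  \<open>B\<close>. Without quasi-left continuity only its left limit at the limiting time would be
  known to lie in \<open>B\<close>.\<close>

lemma AE_hit_from_mem:
  assumes a: "0 < a" and B: "closed B" "B \<noteq> {}"
  shows "AE \<omega> in M. hit_from B x a \<omega> \<noteq> \<infinity> \<longrightarrow> x + X (real_of_ereal (hit_from B x a \<omega>)) \<omega> \<in> B"
  using AE_hit_near_tendsto[OF a, of B x] AE_space
proof eventually_elim
  case (elim \<omega>)
  show ?case
  proof
    assume fin: "hit_from B x a \<omega> \<noteq> \<infinity>"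
    have le: "infdist (x + X (real_of_ereal (hit_near B x a n \<omega>)) \<omega>) B \<le> 1 / real (Suc n)" for n
      unfolding hit_near_def near_def
    proof (rule open_hit_infdist)
      show "((\<lambda>t. x + X t \<omega>) \<longlongrightarrow> x + X t \<omega>) (at_right t)" for t by (intro tendsto_intros X_right elim)
      have "hit_near B x a n \<omega> \<le> hit_from B x a \<omega>" unfolding hit_from_def by (rule SUP_upper) simp
      then show "open_hit (\<lambda>t. x + X t \<omega>) {y. infdist y B < 1 / real (Suc n)} a \<noteq> \<infinity>"
        using fin unfolding hit_near_def near_def by auto
    qed (use a in simp)
    have "(\<lambda>n. infdist (x + X (real_of_ereal (hit_near B x a n \<omega>)) \<omega>) B) \<longlonglongrightarrow> infdist (x + X (real_of_ereal (hit_from B x a \<omega>)) \<omega>) B"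
      using elim(1) fin by (intro tendsto_infdist tendsto_add tendsto_const) auto
    moreover have "(\<lambda>n. 1 / real (Suc n)) \<longlonglongrightarrow> 0" using LIMSEQ_inverse_real_of_nat by (simp add: inverse_eq_divide)
    ultimately have "infdist (x + X (real_of_ereal (hit_from B x a \<omega>)) \<omega>) B \<le> 0"
      by (rule LIMSEQ_le) (use le in auto)
    then have "infdist (x + X (real_of_ereal (hit_from B x a \<omega>)) \<omega>) B = 0"
      by (simp add: antisym infdist_nonneg)
    then show "x + X (real_of_ereal (hit_from B x a \<omega>)) \<omega> \<in> B"
      using in_closed_iff_infdist_zero[OF B] by simp
  qed
qed

text \<open>As the neighbourhoods shrink, \<open>fejer (e n * \<xi>)\<close> tends to 1 for positive
  \<open>\<xi>\<close>, and the damped weight tends to the resolvent weight in mean; the positions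
  at the approximating times converge by \<open>AE_hit_near_tendsto\<close>.\<close>

lemma optional_stopping_hit_from:
  assumes l: "0 < l" and a: "0 < a" and B: "0 \<in> B"
  shows "(\<integral>\<omega>. discount l (hit_from B x a \<omega>) * cos_transform (resolvent_density l) (x + X (real_of_ereal (hit_from B x a \<omega>)) \<omega>) \<partial>M)
    = exp (- l * a) * cos_transform (\<lambda>\<xi>. resolvent_density l \<xi> * exp (- a * \<psi> \<xi>)) x"
proof -
  let ?u = "resolvent_density l"
  let ?S = "\<lambda>n \<omega>. hit_near B x a n \<omega>"
  define e where "e n = 1 / real (Suc n)" for n
  have e: "0 < e n" for n by (simp add: e_def)
  have e_lim: "e \<longlonglongrightarrow> 0" unfolding e_def using LIMSEQ_inverse_real_of_nat by (simp add: inverse_eq_divide)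
  define w where "w n \<xi> = fejer (e n * \<xi>) * ?u \<xi>" for n \<xi>
  have u: "integrable lborel ?u" by (rule integrable_resolvent_density[OF l])
  have w: "integrable lborel (w n)" for n
    using integrable_times_bounded[OF u, of "\<lambda>\<xi>. fejer (e n * \<xi>)"] fejer_le_1 fejer_nonneg
    by (simp add: w_def[abs_def] mult.commute)
  have [measurable]: "w n \<in> borel_measurable borel" for n unfolding w_def[abs_def] by measurable
  define d where "d n \<xi> = (1 - fejer (e n * \<xi>)) * ?u \<xi>" for n \<xi>
  have wu: "\<bar>w n \<xi> - ?u \<xi>\<bar> \<le> d n \<xi>" for n \<xi>
  proof -
    have "\<bar>w n \<xi> - ?u \<xi>\<bar> = \<bar>(1 - fejer (e n * \<xi>)) * ?u \<xi>\<bar>"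
      by (subst abs_minus_commute) (simp add: w_def left_diff_distrib)
    then show ?thesis using fejer_le_1 resolvent_density_nonneg[OF l] by (simp add: d_def)
  qed
  have d: "integrable lborel (d n)" for n
    using Bochner_Integration.integrable_diff[OF u w[of n]] by (simp add: d_def[abs_def] w_def[abs_def] left_diff_distrib)
  define c where "c n = (\<integral>\<xi>. d n \<xi> \<partial>lborel)" for n
  have "c \<longlonglongrightarrow> (\<integral>\<xi>. 0 \<partial>(lborel :: real measure))"
    unfolding c_def
  proof (rule integral_dominated_convergence[OF _ _ u])
    show "AE \<xi> in lborel. (\<lambda>n. d n \<xi>) \<longlonglongrightarrow> 0"
    proof (rule AE_I2)
      fix \<xi> :: real
      show "(\<lambda>n. d n \<xi>) \<longlonglongrightarrow> 0"
      proof (cases "0 < \<xi>")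
        case True
        have "filterlim (\<lambda>n. e n * \<xi>) (at_right 0) sequentially"
          using tendsto_mult_left_zero[OF e_lim, of \<xi>] e True by (auto simp: filterlim_at less_imp_neq[OF e, symmetric])
        then have "(\<lambda>n. fejer (e n * \<xi>)) \<longlonglongrightarrow> 1" by (rule filterlim_compose[OF tendsto_fejer])
        then have "(\<lambda>n. d n \<xi>) \<longlonglongrightarrow> (1 - 1) * ?u \<xi>" unfolding d_def by (intro tendsto_intros)
        then show ?thesis by simp
      qed (simp add: d_def resolvent_density_def)
    qed
    show "AE \<xi> in lborel. norm (d n \<xi>) \<le> ?u \<xi>" for n
      using fejer_le_1 fejer_nonneg resolvent_density_nonneg[OF l]
      by (auto simp: d_def abs_mult intro!: mult_left_le_one_le)
  qed (use d in auto)
  then have c_lim: "c \<longlonglongrightarrow> 0" by simp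
  define R where "R = exp (- l * a) * cos_transform (\<lambda>\<xi>. ?u \<xi> * exp (- a * \<psi> \<xi>)) x"
  have S0: "0 \<le> ?S n \<omega>" for n \<omega>
    using hit_near_ge[of a B x n \<omega>] a by (meson ereal_less_eq(5) less_imp_le order_trans)
  have int: "integrable M (\<lambda>\<omega>. discount l (?S n \<omega>) * cos_transform v (x + X (real_of_ereal (?S n \<omega>)) \<omega>))"
    if "integrable lborel v" for v n
  proof -
    have [measurable]: "v \<in> borel_measurable borel" using that by auto
    show ?thesis
      by (rule integrable_bounded[OF _ discount_mult_bound[OF l S0 cos_transform_le[OF that]]]) measurable
  qed
  have close: "\<bar>(\<integral>\<omega>. discount l (?S n \<omega>) * cos_transform ?u (x + X (real_of_ereal (?S n \<omega>)) \<omega>) \<partial>M) - R\<bar> \<le> 2 * c n" for n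
  proof -
    have "\<bar>\<integral>\<omega>. discount l (?S n \<omega>) * (cos_transform (w n) (x + X (real_of_ereal (?S n \<omega>)) \<omega>)
          - cos_transform ?u (x + X (real_of_ereal (?S n \<omega>)) \<omega>)) \<partial>M\<bar> \<le> c n"
      unfolding c_def
      by (intro abs_expectation_le discount_mult_bound l S0 cos_transform_diff_le w u d wu) measurable
    then have 1: "\<bar>(\<integral>\<omega>. discount l (?S n \<omega>) * cos_transform (w n) (x + X (real_of_ereal (?S n \<omega>)) \<omega>) \<partial>M)
       - (\<integral>\<omega>. discount l (?S n \<omega>) * cos_transform ?u (x + X (real_of_ereal (?S n \<omega>)) \<omega>) \<partial>M)\<bar> \<le> c n"
      using int[OF w] int[OF u] by (simp add: right_diff_distrib)
    have eb: "\<bar>exp (- a * \<psi> \<xi>)\<bar> \<le> 1" for \<xi> using a by simp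
    have "\<bar>cos_transform (\<lambda>\<xi>. w n \<xi> * exp (- a * \<psi> \<xi>)) x - cos_transform (\<lambda>\<xi>. ?u \<xi> * exp (- a * \<psi> \<xi>)) x\<bar> \<le> c n"
      unfolding c_def
    proof (rule cos_transform_diff_le[OF integrable_times_bounded[OF w _ eb] integrable_times_bounded[OF u _ eb] d])
      show "\<bar>w n \<xi> * exp (- a * \<psi> \<xi>) - ?u \<xi> * exp (- a * \<psi> \<xi>)\<bar> \<le> d n \<xi>" for \<xi>
        using abs_mult_le(1)[OF wu[of n \<xi>] eb[of \<xi>]] by (simp add: left_diff_distrib)
    qed measurable
    then have "\<bar>exp (- l * a) * (cos_transform (\<lambda>\<xi>. w n \<xi> * exp (- a * \<psi> \<xi>)) x - cos_transform (\<lambda>\<xi>. ?u \<xi> * exp (- a * \<psi> \<xi>)) x)\<bar> \<le> c n"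
      using l a by (intro abs_mult_le(2)) auto
    then have "\<bar>exp (- l * a) * cos_transform (\<lambda>\<xi>. w n \<xi> * exp (- a * \<psi> \<xi>)) x - R\<bar> \<le> c n"
      by (simp add: R_def right_diff_distrib)
    moreover have "(\<integral>\<omega>. discount l (?S n \<omega>) * cos_transform (w n) (x + X (real_of_ereal (?S n \<omega>)) \<omega>) \<partial>M)
      = exp (- l * a) * cos_transform (\<lambda>\<xi>. w n \<xi> * exp (- a * \<psi> \<xi>)) x"
      using optional_stopping_fejer[OF l less_imp_le[OF a] e[of n] B, of x]
      by (simp add: hit_near_def near_def w_def[abs_def] e_def)
    ultimately show ?thesis using 1 by linarith
  qed
  have "(\<lambda>n. \<integral>\<omega>. discount l (?S n \<omega>) * cos_transform ?u (x + X (real_of_ereal (?S n \<omega>)) \<omega>) \<partial>M)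
     \<longlonglongrightarrow> (\<integral>\<omega>. discount l (hit_from B x a \<omega>) * cos_transform ?u (x + X (real_of_ereal (hit_from B x a \<omega>)) \<omega>) \<partial>M)"
  proof (rule integral_dominated_convergence[where w = "\<lambda>_. \<integral>\<xi>. \<bar>?u \<xi>\<bar> \<partial>lborel"])
    show "AE \<omega> in M. (\<lambda>n. discount l (?S n \<omega>) * cos_transform ?u (x + X (real_of_ereal (?S n \<omega>)) \<omega>))
       \<longlonglongrightarrow> discount l (hit_from B x a \<omega>) * cos_transform ?u (x + X (real_of_ereal (hit_from B x a \<omega>)) \<omega>)"
      using AE_hit_near_tendsto[OF a, of B x]
    proof eventually_elim
      case (elim \<omega>)
      have "0 \<le> hit_from B x a \<omega>" using hit_from_ge[of a B x \<omega>] a by (meson ereal_less_eq(5) less_imp_le order_trans)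
      then show ?case
        using elim by (intro tendsto_discount_mult[OF l hit_near_tendsto _ cos_transform_le[OF u]] tendsto_cos_transform u tendsto_add tendsto_const) auto
    qed
    show "AE \<omega> in M. norm (discount l (?S n \<omega>) * cos_transform ?u (x + X (real_of_ereal (?S n \<omega>)) \<omega>)) \<le> (\<integral>\<xi>. \<bar>?u \<xi>\<bar> \<partial>lborel)" for n
      using discount_mult_bound[OF l S0 cos_transform_le[OF u]] by simp
  qed measurable
  moreover have "(\<lambda>n. \<integral>\<omega>. discount l (?S n \<omega>) * cos_transform ?u (x + X (real_of_ereal (?S n \<omega>)) \<omega>) \<partial>M) \<longlonglongrightarrow> R"
  proof (rule LIM_zero_cancel, rule Lim_null_comparison)
    show "\<forall>\<^sub>F n in sequentially. norm ((\<integral>\<omega>. discount l (?S n \<omega>) * cos_transform ?u (x + X (real_of_ereal (?S n \<omega>)) \<omega>) \<partial>M) - R) \<le> 2 * c n"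
      using close by simp
    show "(\<lambda>n. 2 * c n) \<longlonglongrightarrow> 0" by (rule tendsto_mult_right_zero[OF c_lim])
  qed
  ultimately show ?thesis unfolding R_def by (rule LIMSEQ_unique)
qed

end

text \<open>The preimages of a set under \<open>f\<close> and \<open>g\<close> differ by part of a
  null set, which is measurable in the completion. The use is with a measurable version of the
  hitting time as the source of \<open>f\<close> and the true hitting time as that of
  \<open>g\<close>.\<close>

lemma measurable_completion_cong_AE:
  assumes f: "f \<in> M \<rightarrow>\<^sub>M N" and eq: "AE x in M. f x = g x" and g: "\<And>x. x \<in> space M \<Longrightarrow> g x \<in> space N"
  shows "g \<in> completion M \<rightarrow>\<^sub>M N"
proof (rule measurableI)
  fix S assume S: "S \<in> sets N"
  have 1: "Measurable.pred (completion M) (\<lambda>x. f x \<in> S)"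
    by (rule pred_sets2[OF S measurable_completion[OF f]])
  have 2: "Measurable.pred (completion M) (\<lambda>x. f x \<in> S \<and> g x \<notin> S)"
    by (rule sets_completion_AE) (use eq in eventually_elim, simp)
  have 3: "Measurable.pred (completion M) (\<lambda>x. g x \<in> S \<and> f x \<notin> S)"
    by (rule sets_completion_AE) (use eq in eventually_elim, simp)
  have "Measurable.pred (completion M) (\<lambda>x. (f x \<in> S \<and> \<not> (f x \<in> S \<and> g x \<notin> S)) \<or> (g x \<in> S \<and> f x \<notin> S))"
    using 1 2 3 by measurable
  also have "(\<lambda>x. (f x \<in> S \<and> \<not> (f x \<in> S \<and> g x \<notin> S)) \<or> (g x \<in> S \<and> f x \<notin> S)) = (\<lambda>x. g x \<in> S)" by auto
  finally show "g -` S \<inter> space (completion M) \<in> sets (completion M)"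
    by (simp add: pred_def vimage_def Int_def conj_commute)
qed (use g in simp)

section \<open>The hitting time over all positive times\<close>

context regular_levy_process
begin

text \<open>The hitting time counts all positive times, whereas quasi-left continuity works from a
  positive start on; the infimum over the starts \<open>1 / (j + 1)\<close> reconciles the two. An
  immediate return to \<open>B\<close> gives the value 0.\<close>

definition hit :: "real set \<Rightarrow> real \<Rightarrow> 'a \<Rightarrow> ereal" where
  "hit B x \<omega> = (INF j. hit_from B x (1 / real (Suc j)) \<omega>)"

lemma hit_measurable [measurable]: "hit B x \<in> borel_measurable M"
  unfolding hit_def[abs_def] by measurable

lemma hit_nonneg: "0 \<le> hit B x \<omega>"
  unfolding hit_def
proof (rule INF_greatest)
  fix j
  have "(0::ereal) \<le> ereal (1 / real (Suc j))" by simp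
  then show "0 \<le> hit_from B x (1 / real (Suc j)) \<omega>" using hit_from_ge by (rule order_trans)
qed

text \<open>The almost sure property isolated from the path arguments, which then become
  deterministic: every finite \<open>hit_from\<close> is an actual time of presence in
  \<open>B\<close>.\<close>

definition regular_hit :: "real set \<Rightarrow> real \<Rightarrow> 'a \<Rightarrow> bool" where
  "regular_hit B x \<omega> \<longleftrightarrow> \<omega> \<in> space M \<and> (\<forall>j. hit_from B x (1 / real (Suc j)) \<omega> \<noteq> \<infinity> \<longrightarrow>
     x + X (real_of_ereal (hit_from B x (1 / real (Suc j)) \<omega>)) \<omega> \<in> B)"

lemma AE_regular_hit:
  assumes "closed B" "B \<noteq> {}"
  shows "AE \<omega> in M. regular_hit B x \<omega>"
proof -
  have "AE \<omega> in M. \<forall>j. hit_from B x (1 / real (Suc j)) \<omega> \<noteq> \<infinity> \<longrightarrow>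
     x + X (real_of_ereal (hit_from B x (1 / real (Suc j)) \<omega>)) \<omega> \<in> B"
    unfolding AE_all_countable using assms by (intro allI AE_hit_from_mem) auto
  with AE_space show ?thesis unfolding regular_hit_def by eventually_elim simp
qed

text \<open>On such a path \<open>hit_from\<close> with start \<open>e j\<close> is the first time
  of presence from \<open>e j\<close> on, hence decreases with \<open>j\<close> to the infimum of
  all positive times of presence. As the limit is from above, right-continuity and closedness of
  \<open>B\<close> give the position at the hitting time, even when that time is 0.\<close>

lemma regular_hit_props:
  assumes reg: "regular_hit B x \<omega>" and B: "closed B"
  shows "(\<lambda>j. hit_from B x (1 / real (Suc j)) \<omega>) \<longlonglongrightarrow> hit B x \<omega>"
    and "hitting_time B (\<lambda>t. x + X t \<omega>) = hit B x \<omega>"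
    and "hit B x \<omega> \<noteq> \<infinity> \<Longrightarrow>
      (\<lambda>j. X (real_of_ereal (hit_from B x (1 / real (Suc j)) \<omega>)) \<omega>) \<longlonglongrightarrow> X (real_of_ereal (hit B x \<omega>)) \<omega>"
    and "hit B x \<omega> \<noteq> \<infinity> \<Longrightarrow> x + X (real_of_ereal (hit B x \<omega>)) \<omega> \<in> B"
proof -
  have \<omega>: "\<omega> \<in> space M" using reg by (simp add: regular_hit_def)
  define e where "e j = 1 / real (Suc j)" for j
  define h where "h j = hit_from B x (e j) \<omega>" for j
  have e: "0 < e j" for j by (simp add: e_def)
  have mem: "x + X r \<omega> \<in> B" "e j \<le> r" if "h j = ereal r" for j r
    using reg that hit_from_ge[of "e j" B x \<omega>] by (auto simp: regular_hit_def h_def e_def dest!: spec[of _ j])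
  have h_nn: "0 \<le> h j" for j
    using hit_from_ge[of "e j" B x \<omega>] e[of j] by (metis h_def ereal_less_eq(5) less_imp_le order_trans)
  have h_real: "\<exists>r. h j = ereal r" if "h j \<noteq> \<infinity>" for j using that h_nn[of j] by (cases "h j") auto
  have "decseq h"
  proof (rule decseq_SucI)
    fix j
    show "h (Suc j) \<le> h j"
    proof (cases "h j = \<infinity>")
      case False
      then obtain r where r: "h j = ereal r" using h_real by blast
      have "e (Suc j) \<le> e j" unfolding e_def by (intro divide_left_mono) auto
      then have "e (Suc j) \<le> r" using mem(2)[OF r] by simp
      then show ?thesis unfolding r using hit_from_le[OF \<omega> mem(1)[OF r]] by (simp add: h_def)
    qed simp
  qed
  then have lim: "h \<longlonglongrightarrow> hit B x \<omega>"
    unfolding hit_def e_def[symmetric] h_def[symmetric] by (rule LIMSEQ_INF)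
  then show "(\<lambda>j. hit_from B x (1 / real (Suc j)) \<omega>) \<longlonglongrightarrow> hit B x \<omega>"
    by (simp add: h_def[abs_def] e_def)
  have le: "hit B x \<omega> \<le> h j" for j
    unfolding hit_def e_def[symmetric] h_def[symmetric] by (rule INF_lower) simp
  show "hitting_time B (\<lambda>t. x + X t \<omega>) = hit B x \<omega>"
  proof (rule antisym)
    show "hitting_time B (\<lambda>t. x + X t \<omega>) \<le> hit B x \<omega>"
      unfolding hit_def e_def[symmetric] h_def[symmetric]
    proof (rule INF_greatest)
      fix j
      show "hitting_time B (\<lambda>t. x + X t \<omega>) \<le> h j"
      proof (cases "h j = \<infinity>")
        case False
        then obtain r where r: "h j = ereal r" using h_real by blast
        then have "0 < r" "x + X r \<omega> \<in> B" using mem[OF r] e[of j] by auto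
        then show ?thesis unfolding hitting_time_def r by (intro Inf_lower) auto
      qed simp
    qed
    show "hit B x \<omega> \<le> hitting_time B (\<lambda>t. x + X t \<omega>)"
      unfolding hitting_time_def
    proof (rule Inf_greatest)
      fix z assume "z \<in> {ereal t |t. 0 < t \<and> x + X t \<omega> \<in> B}"
      then obtain t where t: "z = ereal t" "0 < t" "x + X t \<omega> \<in> B" by auto
      obtain j where "1 / t < real (Suc j)" using reals_Archimedean2 by (metis less_Suc_eq of_nat_less_iff order_less_trans)
      then have "e j \<le> t" using t(2) by (simp add: e_def field_simps)
      then have "h j \<le> ereal t" unfolding h_def by (rule hit_from_le[OF \<omega> t(3)])
      then show "hit B x \<omega> \<le> z" using le[of j] t(1) by simp
    qed
  qed
  assume fin: "hit B x \<omega> \<noteq> \<infinity>"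
  have "(\<lambda>j. X (real_of_ereal (h j) + 0) \<omega>) \<longlonglongrightarrow> X (real_of_ereal (hit B x \<omega>) + 0) \<omega>"
    by (rule tendsto_decreasing_compose[OF lim le fin hit_nonneg X_right[OF \<omega>]])
  then have X_lim: "(\<lambda>j. X (real_of_ereal (h j)) \<omega>) \<longlonglongrightarrow> X (real_of_ereal (hit B x \<omega>)) \<omega>" by simp
  then show "(\<lambda>j. X (real_of_ereal (hit_from B x (1 / real (Suc j)) \<omega>)) \<omega>) \<longlonglongrightarrow> X (real_of_ereal (hit B x \<omega>)) \<omega>"
    by (simp add: h_def e_def)
  have "\<forall>\<^sub>F j in sequentially. h j < \<infinity>"
    by (rule order_tendstoD[OF lim]) (use fin in auto)
  then have "\<forall>\<^sub>F j in sequentially. x + X (real_of_ereal (h j)) \<omega> \<in> B"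
  proof eventually_elim
    case (elim j)
    then obtain r where "h j = ereal r" using h_real[of j] by auto
    then show ?case using mem(1) by simp
  qed
  then show "x + X (real_of_ereal (hit B x \<omega>)) \<omega> \<in> B"
    by (rule Lim_in_closed_set[OF B]) (auto intro: tendsto_intros X_lim)
qed

text \<open>The last limit, \<open>a\<close> to 0: on the right
  \<open>exp (- a * \<psi> \<xi>)\<close> tends to 1 under the dominating resolvent weight, and on
  the left the hitting times approach from above.\<close>

lemma optional_stopping_hit:
  assumes l: "0 < l" and B: "0 \<in> B" "closed B"
  shows "(\<integral>\<omega>. discount l (hit B x \<omega>) * cos_transform (resolvent_density l) (x + X (real_of_ereal (hit B x \<omega>)) \<omega>) \<partial>M)
    = cos_transform (resolvent_density l) x"
proof -
  let ?u = "resolvent_density l"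
  have reg: "AE \<omega> in M. regular_hit B x \<omega>" using B by (intro AE_regular_hit) auto
  define e where "e j = 1 / real (Suc j)" for j
  have e: "0 < e j" for j by (simp add: e_def)
  have e_lim: "e \<longlonglongrightarrow> 0" unfolding e_def using LIMSEQ_inverse_real_of_nat by (simp add: inverse_eq_divide)
  have u: "integrable lborel ?u" by (rule integrable_resolvent_density[OF l])
  have h0: "0 \<le> hit_from B x (e j) \<omega>" for j \<omega>
    using hit_from_ge[of "e j" B x \<omega>] e[of j] by (meson ereal_less_eq(5) less_imp_le order_trans)
  have "(\<lambda>j. \<integral>\<omega>. discount l (hit_from B x (e j) \<omega>) * cos_transform ?u (x + X (real_of_ereal (hit_from B x (e j) \<omega>)) \<omega>) \<partial>M)
     \<longlonglongrightarrow> (\<integral>\<omega>. discount l (hit B x \<omega>) * cos_transform ?u (x + X (real_of_ereal (hit B x \<omega>)) \<omega>) \<partial>M)"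
  proof (rule integral_dominated_convergence[where w = "\<lambda>_. \<integral>\<xi>. \<bar>?u \<xi>\<bar> \<partial>lborel"])
    show "AE \<omega> in M. (\<lambda>j. discount l (hit_from B x (e j) \<omega>) * cos_transform ?u (x + X (real_of_ereal (hit_from B x (e j) \<omega>)) \<omega>))
       \<longlonglongrightarrow> discount l (hit B x \<omega>) * cos_transform ?u (x + X (real_of_ereal (hit B x \<omega>)) \<omega>)"
      using reg
    proof eventually_elim
      case (elim \<omega>)
      show ?case
        using regular_hit_props[OF elim B(2)] unfolding e_def
        by (intro tendsto_discount_mult[OF l _ hit_nonneg cos_transform_le[OF u]] tendsto_cos_transform u tendsto_add tendsto_const) auto
    qed
    show "AE \<omega> in M. norm (discount l (hit_from B x (e j) \<omega>) * cos_transform ?u (x + X (real_of_ereal (hit_from B x (e j) \<omega>)) \<omega>)) \<le> (\<integral>\<xi>. \<bar>?u \<xi>\<bar> \<partial>lborel)" for j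
      using discount_mult_bound[OF l h0 cos_transform_le[OF u]] by simp
  qed measurable
  moreover have "(\<integral>\<omega>. discount l (hit_from B x (e j) \<omega>) * cos_transform ?u (x + X (real_of_ereal (hit_from B x (e j) \<omega>)) \<omega>) \<partial>M)
     = exp (- l * e j) * cos_transform (\<lambda>\<xi>. ?u \<xi> * exp (- e j * \<psi> \<xi>)) x" for j
    by (rule optional_stopping_hit_from[OF l e B(1)])
  moreover have "(\<lambda>j. exp (- l * e j) * cos_transform (\<lambda>\<xi>. ?u \<xi> * exp (- e j * \<psi> \<xi>)) x) \<longlonglongrightarrow> 1 * cos_transform ?u x"
  proof (rule tendsto_mult)
    have "(\<lambda>j. exp (- l * e j)) \<longlonglongrightarrow> exp (- l * 0)" by (intro tendsto_exp tendsto_mult tendsto_const e_lim)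
    then show "(\<lambda>j. exp (- l * e j)) \<longlonglongrightarrow> 1" by simp
    show "(\<lambda>j. cos_transform (\<lambda>\<xi>. ?u \<xi> * exp (- e j * \<psi> \<xi>)) x) \<longlonglongrightarrow> cos_transform ?u x"
      unfolding cos_transform_def
    proof (rule integral_dominated_convergence[where w = "\<lambda>\<xi>. \<bar>?u \<xi>\<bar>"])
      show "AE \<xi> in lborel. (\<lambda>j. ?u \<xi> * exp (- e j * \<psi> \<xi>) * cos (\<xi> * x)) \<longlonglongrightarrow> ?u \<xi> * cos (\<xi> * x)"
      proof (rule AE_I2)
        fix \<xi>
        have "(\<lambda>j. ?u \<xi> * exp (- e j * \<psi> \<xi>) * cos (\<xi> * x)) \<longlonglongrightarrow> ?u \<xi> * exp (- 0 * \<psi> \<xi>) * cos (\<xi> * x)"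
          by (intro tendsto_mult tendsto_const tendsto_exp tendsto_minus e_lim)
        then show "(\<lambda>j. ?u \<xi> * exp (- e j * \<psi> \<xi>) * cos (\<xi> * x)) \<longlonglongrightarrow> ?u \<xi> * cos (\<xi> * x)" by simp
      qed
      show "AE \<xi> in lborel. norm (?u \<xi> * exp (- e j * \<psi> \<xi>) * cos (\<xi> * x)) \<le> \<bar>?u \<xi>\<bar>" for j
        unfolding real_norm_def using e[of j] by (intro AE_I2 abs_mult_le(1)) (auto simp: mult_nonneg_nonneg)
    qed (use u in auto)
  qed
  ultimately show ?thesis using LIMSEQ_unique by fastforce
qed

lemma cos_transform_resolvent_density:
  assumes l: "0 < l"
  shows "cos_transform (resolvent_density l) y = resolvent l - (LBINT s:{0<..}. (1 - cos (y * s)) / (l + \<psi> s))"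
proof -
  have "(LBINT s:{0<..}. (1 - cos (y * s)) / (l + \<psi> s)) = (\<integral>s. resolvent_density l s - resolvent_density l s * cos (s * y) \<partial>lborel)"
    unfolding set_lebesgue_integral_def resolvent_density_def
    by (intro Bochner_Integration.integral_cong) (auto simp: algebra_simps diff_divide_distrib mult.commute)
  also have "\<dots> = (\<integral>s. resolvent_density l s \<partial>lborel) - cos_transform (resolvent_density l) y"
    unfolding cos_transform_def
    by (intro Bochner_Integration.integral_diff integrable_cos_transform integrable_resolvent_density l)
  also have "(\<integral>s. resolvent_density l s \<partial>lborel) = resolvent l"
    by (simp add: resolvent_def resolvent_density_def[abs_def] set_lebesgue_integral_def)
  finally show ?thesis by simp
qed

text \<open>The difference \<open>G\<^sub>l 0 - G\<^sub>l y\<close>. It stays below its finite limit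
  \<open>pi * K y\<close> as \<open>l\<close> decreases to 0, even where \<open>G\<^sub>l 0\<close>
  is unbounded.\<close>

definition kernel :: "real \<Rightarrow> real \<Rightarrow> real" where
  "kernel l y = (LBINT s:{0<..}. (1 - cos (y * s)) / (l + \<psi> s))"

lemma kernel_measurable [measurable]: "kernel l \<in> borel_measurable borel"
  unfolding kernel_def[abs_def] set_lebesgue_integral_def by measurable

lemma kernel_0: "kernel 0 y = pi * compensated_kernel \<psi> y"
  by (simp add: kernel_def compensated_kernel_def)

lemma kernel_integrand_le:
  assumes "0 < l" "0 < s"
  shows "0 \<le> (1 - cos (y * s)) / (l + \<psi> s)" "(1 - cos (y * s)) / (l + \<psi> s) \<le> (1 - cos (y * s)) / \<psi> s"
proof -
  have "0 < \<psi> s" using assms pos[of s] by simp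
  then show "(1 - cos (y * s)) / (l + \<psi> s) \<le> (1 - cos (y * s)) / \<psi> s"
    using assms by (intro divide_left_mono mult_pos_pos) auto
  show "0 \<le> (1 - cos (y * s)) / (l + \<psi> s)"
    using assms by (intro divide_nonneg_nonneg) auto
qed

lemma norm_kernel_integrand_le:
  assumes "0 < l" "0 < s"
  shows "norm ((1 - cos (y * s)) / (l + \<psi> s)) \<le> (1 - cos (y * s)) / \<psi> s"
  using kernel_integrand_le[OF assms, of y] unfolding real_norm_def by (simp only: abs_of_nonneg)

lemma kernel_bounds:
  assumes l: "0 < l"
  shows "0 \<le> kernel l y" "kernel l y \<le> kernel 0 y"
proof -
  have int: "set_integrable lborel {0<..} (\<lambda>s. (1 - cos (y * s)) / (l + \<psi> s))"
  proof (rule set_integrable_bound[OF integrable_kernel[of y]])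
    show "set_borel_measurable lborel {0<..} (\<lambda>s. (1 - cos (y * s)) / (l + \<psi> s))"
      unfolding set_borel_measurable_def by measurable
    show "AE s in lborel. s \<in> {0<..} \<longrightarrow> norm ((1 - cos (y * s)) / (l + \<psi> s)) \<le> norm ((1 - cos (y * s)) / \<psi> s)"
      using norm_kernel_integrand_le[OF l, of _ y] unfolding real_norm_def by (intro AE_I2 impI order_trans[OF _ abs_ge_self]) auto
  qed
  show "0 \<le> kernel l y"
    unfolding kernel_def set_lebesgue_integral_def
    by (rule Bochner_Integration.integral_nonneg) (use kernel_integrand_le[OF l] in \<open>auto simp: indicator_def\<close>)
  have "kernel l y \<le> (LBINT s:{0<..}. (1 - cos (y * s)) / \<psi> s)"
    unfolding kernel_def using kernel_integrand_le(2)[OF l]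
    by (intro set_integral_mono int integrable_kernel) auto
  then show "kernel l y \<le> kernel 0 y" by (simp add: kernel_def)
qed

lemma kernel_tendsto: "((\<lambda>l. kernel l y) \<longlongrightarrow> kernel 0 y) (at_right 0)"
  unfolding kernel_def set_lebesgue_integral_def
proof (rule dominated_convergence_at_right_0)
  show "integrable lborel (\<lambda>s. indicator {0<..} s *\<^sub>R ((1 - cos (y * s)) / \<psi> s))"
    using integrable_kernel[of y] by (simp add: set_integrable_def)
  show "AE s in lborel. ((\<lambda>l. indicator {0<..} s *\<^sub>R ((1 - cos (y * s)) / (l + \<psi> s))) \<longlongrightarrow>
      indicator {0<..} s *\<^sub>R ((1 - cos (y * s)) / (0 + \<psi> s))) (at_right 0)"
  proof (rule AE_I2)
    fix s :: real
    show "((\<lambda>l. indicator {0<..} s *\<^sub>R ((1 - cos (y * s)) / (l + \<psi> s))) \<longlongrightarrow>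
      indicator {0<..} s *\<^sub>R ((1 - cos (y * s)) / (0 + \<psi> s))) (at_right 0)"
    proof (cases "0 < s")
      case True
      then show ?thesis using pos[of s] by (intro tendsto_scaleR tendsto_divide tendsto_add tendsto_const tendsto_ident_at) auto
    qed simp
  qed
  show "\<forall>\<^sub>F l in at_right 0. AE s in lborel. norm (indicator {0<..} s *\<^sub>R ((1 - cos (y * s)) / (l + \<psi> s)))
      \<le> indicator {0<..} s *\<^sub>R ((1 - cos (y * s)) / \<psi> s)"
    using eventually_at_right_less[of "0::real"]
  proof eventually_elim
    case (elim l)
    show ?case
    proof (rule AE_I2)
      fix s :: real
      show "norm (indicator {0<..} s *\<^sub>R ((1 - cos (y * s)) / (l + \<psi> s))) \<le> indicator {0<..} s *\<^sub>R ((1 - cos (y * s)) / \<psi> s)"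
        using norm_kernel_integrand_le[OF elim, of s y] by (cases "0 < s") simp_all
    qed
  qed
qed measurable

definition mean_kernel_at_hit :: "real set \<Rightarrow> real \<Rightarrow> real" where
  "mean_kernel_at_hit B x =
     (\<integral>\<omega>. (if hit B x \<omega> < \<infinity> then compensated_kernel \<psi> (x + X (real_of_ereal (hit B x \<omega>)) \<omega>) else 0) \<partial>M)"

text \<open>In the stopped identity each \<open>G\<^sub>l\<close> is written as
  \<open>resolvent l\<close> minus a kernel, so that the possibly divergent part collects into one
  product. Compactness of \<open>B\<close> bounds the kernel at the hitting position uniformly in
  \<open>l\<close>, which justifies the passage to the limit.\<close>

lemma resolvent_mult_survival_tendsto:
  assumes B: "0 \<in> B" "compact B"
  shows "((\<lambda>l. resolvent l * (1 - (\<integral>\<omega>. discount l (hit B x \<omega>) \<partial>M))) \<longlongrightarrow>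
    pi * (compensated_kernel \<psi> x - mean_kernel_at_hit B x)) (at_right 0)"
proof -
  have cl: "closed B" using B(2) by (rule compact_imp_closed)
  obtain r where r: "\<And>y. y \<in> B \<Longrightarrow> \<bar>y\<bar> \<le> r"
    using compact_imp_bounded[OF B(2)] by (auto simp: bounded_iff)
  obtain C where C: "\<And>y. \<bar>y\<bar> \<le> r \<Longrightarrow> compensated_kernel \<psi> y \<le> C" using compensated_kernel_bound by blast
  have k0: "kernel 0 y \<le> pi * C" if "y \<in> B" for y unfolding kernel_0 using C[OF r[OF that]] by simp
  have C0: "0 \<le> pi * C" using k0[OF B(1)] compensated_kernel_nonneg[of 0] unfolding kernel_0
    by (meson mult_nonneg_nonneg order_trans pi_ge_zero)
  let ?Y = "\<lambda>\<omega>. x + X (real_of_ereal (hit B x \<omega>)) \<omega>"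
  have AE_reg: "AE \<omega> in M. regular_hit B x \<omega>" using cl B by (intro AE_regular_hit) auto
  have bound: "\<bar>discount l (hit B x \<omega>) * kernel l (?Y \<omega>)\<bar> \<le> pi * C" if l: "0 < l" and "regular_hit B x \<omega>" for l \<omega>
  proof (cases "hit B x \<omega> = \<infinity>")
    case False
    then have "?Y \<omega> \<in> B" using regular_hit_props(4)[OF that(2) cl] by simp
    then have "kernel l (?Y \<omega>) \<le> pi * C" using kernel_bounds(2)[OF l, of "?Y \<omega>"] k0 by fastforce
    then show ?thesis using kernel_bounds(1)[OF l, of "?Y \<omega>"] by (intro discount_mult_bound l hit_nonneg) simp
  qed (use C0 in \<open>simp add: discount_def\<close>)
  have eq: "resolvent l * (1 - (\<integral>\<omega>. discount l (hit B x \<omega>) \<partial>M))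
     = kernel l x - (\<integral>\<omega>. discount l (hit B x \<omega>) * kernel l (?Y \<omega>) \<partial>M)" if l: "0 < l" for l
  proof -
    have i1: "integrable M (\<lambda>\<omega>. discount l (hit B x \<omega>))"
      by (rule integrable_bounded[of _ 1]) (use discount_mult_bound[OF l hit_nonneg, of 1 1] in auto)
    have i2: "integrable M (\<lambda>\<omega>. discount l (hit B x \<omega>) * kernel l (?Y \<omega>))"
      by (rule integrable_const_bound[of _ "pi * C"]) (use AE_reg bound[OF l] in \<open>auto elim!: eventually_mono\<close>)
    have "resolvent l - kernel l x = (\<integral>\<omega>. discount l (hit B x \<omega>) * (resolvent l - kernel l (?Y \<omega>)) \<partial>M)"
      using optional_stopping_hit[OF l B(1) cl, of x] by (simp add: cos_transform_resolvent_density[OF l] kernel_def)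
    also have "\<dots> = (\<integral>\<omega>. resolvent l * discount l (hit B x \<omega>) - discount l (hit B x \<omega>) * kernel l (?Y \<omega>) \<partial>M)"
      by (intro Bochner_Integration.integral_cong) (auto simp: algebra_simps)
    also have "\<dots> = resolvent l * (\<integral>\<omega>. discount l (hit B x \<omega>) \<partial>M) - (\<integral>\<omega>. discount l (hit B x \<omega>) * kernel l (?Y \<omega>) \<partial>M)"
      using i1 i2 by (subst Bochner_Integration.integral_diff) auto
    finally show ?thesis by (simp add: algebra_simps)
  qed
  have "((\<lambda>l. \<integral>\<omega>. discount l (hit B x \<omega>) * kernel l (?Y \<omega>) \<partial>M) \<longlongrightarrow>
     (\<integral>\<omega>. pi * (if hit B x \<omega> < \<infinity> then compensated_kernel \<psi> (?Y \<omega>) else 0) \<partial>M)) (at_right 0)"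
  proof (rule dominated_convergence_at_right_0[where w = "\<lambda>_. pi * C"])
    show "AE \<omega> in M. ((\<lambda>l. discount l (hit B x \<omega>) * kernel l (?Y \<omega>)) \<longlongrightarrow>
       pi * (if hit B x \<omega> < \<infinity> then compensated_kernel \<psi> (?Y \<omega>) else 0)) (at_right 0)"
    proof (rule AE_I2)
      fix \<omega>
      show "((\<lambda>l. discount l (hit B x \<omega>) * kernel l (?Y \<omega>)) \<longlongrightarrow>
         pi * (if hit B x \<omega> < \<infinity> then compensated_kernel \<psi> (?Y \<omega>) else 0)) (at_right 0)"
      proof (cases "hit B x \<omega> = \<infinity>")
        case False
        have "((\<lambda>l. exp (- (l * real_of_ereal (hit B x \<omega>))) * kernel l (?Y \<omega>)) \<longlongrightarrow>
           exp (- (0 * real_of_ereal (hit B x \<omega>))) * kernel 0 (?Y \<omega>)) (at_right 0)"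
          by (intro tendsto_mult tendsto_exp tendsto_minus tendsto_const tendsto_ident_at kernel_tendsto)
        then show ?thesis using False by (simp add: discount_def kernel_0 less_top top_ereal_def)
      qed (simp add: discount_def)
    qed
    show "\<forall>\<^sub>F l in at_right 0. AE \<omega> in M. norm (discount l (hit B x \<omega>) * kernel l (?Y \<omega>)) \<le> pi * C"
      using eventually_at_right_less[of "0::real"]
      by eventually_elim (use AE_reg bound in \<open>auto elim!: eventually_mono\<close>)
  qed auto
  then have "((\<lambda>l. kernel l x - (\<integral>\<omega>. discount l (hit B x \<omega>) * kernel l (?Y \<omega>) \<partial>M)) \<longlongrightarrow>
     kernel 0 x - pi * mean_kernel_at_hit B x) (at_right 0)"
    unfolding mean_kernel_at_hit_def by (intro tendsto_diff kernel_tendsto) simp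
  then have "((\<lambda>l. kernel l x - (\<integral>\<omega>. discount l (hit B x \<omega>) * kernel l (?Y \<omega>) \<partial>M)) \<longlongrightarrow>
     pi * (compensated_kernel \<psi> x - mean_kernel_at_hit B x)) (at_right 0)"
    by (simp add: kernel_0 right_diff_distrib)
  then show ?thesis
    by (rule Lim_transform_eventually)
       (use eq in \<open>auto intro!: eventually_mono[OF eventually_at_right_less[of "0::real"]]\<close>)
qed

end

section \<open>Asymptotics of the hitting time distribution\<close>

lemma integral_exp_until:
  fixes l :: real and T :: ereal
  assumes l: "0 < l" and T: "0 \<le> T"
  shows "l * (\<integral>t. indicator {0<..} t * exp (- (l * t)) * (if ereal t < T then 1 else 0) \<partial>lborel) = 1 - discount l T"
proof -
  have base: "has_bochner_integral lborel (\<lambda>t. l * exp (- (l * t)) * indicator {c..} t) (exp (- (l * c)))" for c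
  proof (rule has_bochner_integral_nn_integral)
    show "(\<integral>\<^sup>+t. ennreal (l * exp (- (l * t)) * indicator {c..} t) \<partial>lborel) = ennreal (exp (- (l * c)))"
      using nn_integral_exp_atLeast[OF l, of c] l by (simp add: ennreal_mult' ennreal_indicator)
  qed (use l in auto)
  have ae: "AE t in lborel. t \<noteq> (0::real)" by (rule AE_lborel_singleton)
  have "l * (\<integral>t. indicator {0<..} t * exp (- (l * t)) * (if ereal t < T then 1 else 0) \<partial>lborel)
    = (\<integral>t. l * (indicator {0<..} t * exp (- (l * t)) * (if ereal t < T then 1 else 0)) \<partial>lborel)"
    by simp
  also have "\<dots> = 1 - discount l T"
  proof (cases T)
    case (real r)
    then have r: "0 \<le> r" using T by simp
    have "(\<integral>t. l * (indicator {0<..} t * exp (- (l * t)) * (if ereal t < T then 1 else 0)) \<partial>lborel)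
      = (\<integral>t. l * exp (- (l * t)) * indicator {0..} t - l * exp (- (l * t)) * indicator {r..} t \<partial>lborel)"
    proof (rule integral_cong_AE)
      show "AE t in lborel. l * (indicator {0<..} t * exp (- (l * t)) * (if ereal t < T then 1 else 0))
         = l * exp (- (l * t)) * indicator {0..} t - l * exp (- (l * t)) * indicator {r..} t"
        using ae by eventually_elim (use r in \<open>auto simp: real indicator_def\<close>)
    qed (auto simp: real)
    also have "\<dots> = exp (- (l * 0)) - exp (- (l * r))"
      using has_bochner_integral_diff[OF base[of 0] base[of r]] by (simp add: has_bochner_integral_iff)
    finally show ?thesis by (simp add: real discount_def)
  next
    case PInf
    have "(\<integral>t. l * (indicator {0<..} t * exp (- (l * t)) * (if ereal t < T then 1 else 0)) \<partial>lborel)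
      = (\<integral>t. l * exp (- (l * t)) * indicator {0..} t \<partial>lborel)"
    proof (rule integral_cong_AE)
      show "AE t in lborel. l * (indicator {0<..} t * exp (- (l * t)) * (if ereal t < T then 1 else 0)) = l * exp (- (l * t)) * indicator {0..} t"
        using ae by eventually_elim (auto simp: PInf indicator_def)
    qed (auto simp: PInf)
    also have "\<dots> = exp (- (l * 0))" using base[of 0] by (simp add: has_bochner_integral_iff)
    finally show ?thesis by (simp add: PInf discount_def)
  qed (use T in simp)
  finally show ?thesis .
qed

context regular_levy_process
begin

definition survival :: "real set \<Rightarrow> real \<Rightarrow> real \<Rightarrow> real" where
  "survival B x t = measure M {\<omega> \<in> space M. ereal t < hit B x \<omega>}"

lemma survival_eq: "survival B x t = (\<integral>\<omega>. (if ereal t < hit B x \<omega> then 1 else 0) \<partial>M)"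
proof -
  have "(\<integral>\<omega>. (if ereal t < hit B x \<omega> then 1 else 0 :: real) \<partial>M) = (\<integral>\<omega>. indicator {\<omega> \<in> space M. ereal t < hit B x \<omega>} \<omega> \<partial>M)"
    by (intro Bochner_Integration.integral_cong) auto
  then show ?thesis by (simp add: survival_def Int_absorb2)
qed

lemma survival_measurable [measurable]: "survival B x \<in> borel_measurable borel"
  unfolding survival_eq[abs_def] by measurable

text \<open>Fubini: the integral of \<open>l * exp (- (l * t))\<close> up to the hitting time is 1
  minus the discount factor, also for an infinite time.\<close>

lemma survival_laplace:
  assumes l: "0 < l"
  shows "l * (LBINT t:{0<..}. exp (- (l * t)) * survival B x t) = 1 - (\<integral>\<omega>. discount l (hit B x \<omega>) \<partial>M)"
proof -
  interpret P: pair_sigma_finite lborel M by standard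
  define w where "w t = indicator {0<..} t * exp (- (l * t))" for t
  define v where "v t \<omega> = (if ereal t < hit B x \<omega> then 1 else 0 :: real)" for t \<omega>
  have w: "integrable lborel w"
    using integrable_I0i_exp_mscale[OF l] by (simp add: set_integrable_def w_def[abs_def] mult.commute)
  have [measurable]: "w \<in> borel_measurable borel" using w by auto
  have [measurable]: "(\<lambda>p. v (fst p) (snd p)) \<in> borel_measurable (borel \<Otimes>\<^sub>M M)" unfolding v_def by measurable
  have [measurable]: "v t \<in> borel_measurable M" for t unfolding v_def[abs_def] by measurable
  have v1: "\<bar>v t \<omega>\<bar> \<le> 1" for t \<omega> by (simp add: v_def)
  have int1: "integrable M (\<lambda>\<omega>. w t * v t \<omega>)" for t
    by (intro integrable_bounded[of _ "\<bar>w t\<bar>"] abs_mult_le(1) v1) auto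
  have "integrable (lborel \<Otimes>\<^sub>M M) (\<lambda>(t, \<omega>). w t * v t \<omega>)"
  proof (rule P.Fubini_integrable)
    show "(\<lambda>(t, \<omega>). w t * v t \<omega>) \<in> borel_measurable (lborel \<Otimes>\<^sub>M M)"
      unfolding split_beta' by measurable
    show "integrable lborel (\<lambda>t. \<integral>\<omega>. norm (case (t, \<omega>) of (t, \<omega>) \<Rightarrow> w t * v t \<omega>) \<partial>M)"
    proof (rule Bochner_Integration.integrable_bound[OF w])
      show "(\<lambda>t. \<integral>\<omega>. norm (case (t, \<omega>) of (t, \<omega>) \<Rightarrow> w t * v t \<omega>) \<partial>M) \<in> borel_measurable lborel"
        unfolding v_def by measurable
      show "AE t in lborel. norm (\<integral>\<omega>. norm (case (t, \<omega>) of (t, \<omega>) \<Rightarrow> w t * v t \<omega>) \<partial>M) \<le> norm (w t)"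
      proof (rule AE_I2)
        fix t
        have "\<bar>\<integral>\<omega>. \<bar>w t * v t \<omega>\<bar> \<partial>M\<bar> \<le> \<bar>w t\<bar>"
          by (intro abs_expectation_le) (auto intro!: abs_mult_le(1) v1)
        then show "norm (\<integral>\<omega>. norm (case (t, \<omega>) of (t, \<omega>) \<Rightarrow> w t * v t \<omega>) \<partial>M) \<le> norm (w t)" by simp
      qed
    qed
  qed (use int1 in auto)
  from P.Fubini_integral[OF this]
  have fub: "(\<integral>\<omega>. (\<integral>t. w t * v t \<omega> \<partial>lborel) \<partial>M) = (\<integral>t. (\<integral>\<omega>. w t * v t \<omega> \<partial>M) \<partial>lborel)" by simp
  have "(LBINT t:{0<..}. exp (- (l * t)) * survival B x t) = (\<integral>t. (\<integral>\<omega>. w t * v t \<omega> \<partial>M) \<partial>lborel)"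
    unfolding set_lebesgue_integral_def survival_eq
    by (intro Bochner_Integration.integral_cong) (auto simp: w_def v_def)
  then have "l * (LBINT t:{0<..}. exp (- (l * t)) * survival B x t) = (\<integral>\<omega>. l * (\<integral>t. w t * v t \<omega> \<partial>lborel) \<partial>M)"
    by (simp add: fub)
  also have "\<dots> = (\<integral>\<omega>. 1 - discount l (hit B x \<omega>) \<partial>M)"
    using integral_exp_until[OF l hit_nonneg] by (simp add: w_def v_def)
  also have "\<dots> = 1 - (\<integral>\<omega>. discount l (hit B x \<omega>) \<partial>M)"
  proof -
    have "integrable M (\<lambda>\<omega>. discount l (hit B x \<omega>))"
      by (rule integrable_bounded[of _ 1]) (use discount_mult_bound[OF l hit_nonneg, of 1 1] in auto)
    then show ?thesis by (simp add: prob_space)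
  qed
  finally show ?thesis .
qed

text \<open>The resolvent itself serves as the norming function \<open>H\<close>. The Tauberian
  theorem then applies before its size is made explicit, and both cases of the result share this
  step.\<close>

lemma survival_tauberian:
  assumes B: "0 \<in> B" "compact B" and \<rho>: "0 < \<rho>" "\<rho> \<le> 1"
    and rv: "\<And>k::nat. (0::nat) < k \<Longrightarrow> ((\<lambda>l. resolvent (real k * l) / resolvent l) \<longlongrightarrow> real k powr (\<rho> - 1)) (at_right 0)"
  shows "((\<lambda>t. resolvent (1 / t) * survival B x t) \<longlongrightarrow>
     pi * (compensated_kernel \<psi> x - mean_kernel_at_hit B x) / Gamma \<rho>) at_top"
proof (rule laplace_tauberian_monotone[OF _ _ _ survival_measurable resolvent_pos \<rho> rv])
  show "survival B x t \<le> survival B x s" if "s \<le> t" for s t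
  proof -
    have "ereal s < hit B x \<omega>" if "ereal t < hit B x \<omega>" for \<omega>
      using \<open>s \<le> t\<close> that by (meson ereal_less_eq(3) le_less_trans)
    then show ?thesis unfolding survival_def by (intro finite_measure_mono) auto
  qed
  show "((\<lambda>l. resolvent l * (l * (LBINT t:{0<..}. exp (- (l * t)) * survival B x t))) \<longlongrightarrow>
     pi * (compensated_kernel \<psi> x - mean_kernel_at_hit B x)) (at_right 0)"
    by (rule Lim_transform_eventually[OF resolvent_mult_survival_tendsto[OF B]])
       (auto simp: survival_laplace intro!: eventually_mono[OF eventually_at_right_less[of "0::real"]])
qed (auto simp: survival_def)

lemma filterlim_one_over_at_right: "filterlim (\<lambda>t::real. 1 / t) (at_right 0) at_top"
  using filterlim_inverse_at_right_top by (simp add: inverse_eq_divide)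

theorem survival_asymptotics_gt_1:
  assumes B: "0 \<in> B" "compact B" and rv: "regularly_varying_at_0 \<psi> \<delta>" and \<delta>: "1 < \<delta>"
  shows "((\<lambda>t. t * inv_exponent \<psi> (1 / t) * survival B x t) \<longlongrightarrow>
     \<delta> * Gamma (1 - 1 / \<delta>) * (sin (pi / \<delta>))\<^sup>2 / pi * (compensated_kernel \<psi> x - mean_kernel_at_hit B x)) at_top"
proof -
  define D where "D = compensated_kernel \<psi> x - mean_kernel_at_hit B x"
  \<comment> \<open>The value of the integral of \<open>1 / (1 + u powr \<delta>)\<close> over the
    half-line, which is the limiting ratio of \<open>resolvent l\<close> to
    \<open>inv_exponent \<psi> l / l\<close>.\<close>
  define c where "c = pi / (\<delta> * sin (pi / \<delta>))"
  have "pi / \<delta> < pi" using \<delta> by (simp add: field_simps)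
  then have sin: "0 < sin (pi / \<delta>)" using \<delta> by (intro sin_gt_zero) auto
  then have c: "0 < c" using \<delta> by (simp add: c_def)
  have as: "((\<lambda>l. l / inv_exponent \<psi> l * resolvent (k * l)) \<longlongrightarrow> c * k powr (1 / \<delta> - 1)) (at_right 0)" if "0 < k" for k
    unfolding c_def by (rule resolvent_asymptotics[OF rv \<delta> that])
  have rv': "((\<lambda>l. resolvent (k * l) / resolvent l) \<longlongrightarrow> k powr (1 / \<delta> - 1)) (at_right 0)" if k: "0 < k" for k
  proof -
    have "((\<lambda>l. (l / inv_exponent \<psi> l * resolvent (k * l)) / (l / inv_exponent \<psi> l * resolvent (1 * l))) \<longlongrightarrow>
        (c * k powr (1 / \<delta> - 1)) / (c * 1 powr (1 / \<delta> - 1))) (at_right 0)"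
      using c k by (intro tendsto_divide as) auto
    then have "((\<lambda>l. (l / inv_exponent \<psi> l * resolvent (k * l)) / (l / inv_exponent \<psi> l * resolvent (1 * l))) \<longlongrightarrow>
        k powr (1 / \<delta> - 1)) (at_right 0)" using c by simp
    then show ?thesis
    proof (rule Lim_transform_eventually)
      show "\<forall>\<^sub>F l in at_right 0. (l / inv_exponent \<psi> l * resolvent (k * l)) / (l / inv_exponent \<psi> l * resolvent (1 * l)) = resolvent (k * l) / resolvent l"
        using eventually_at_right_less[of "0::real"]
      proof eventually_elim
        case (elim l)
        then show ?case using inv_exponent(1)[OF elim] by simp
      qed
    qed
  qed
  have \<rho>: "0 < 1 / \<delta>" "1 / \<delta> \<le> 1" using \<delta> by auto
  have "((\<lambda>t. resolvent (1 / t) * survival B x t) \<longlongrightarrow> pi * D / Gamma (1 / \<delta>)) at_top"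
    unfolding D_def by (rule survival_tauberian[OF B \<rho>]) (rule rv', simp)
  moreover have "((\<lambda>t. (1 / t) / inv_exponent \<psi> (1 / t) * resolvent (1 * (1 / t))) \<longlongrightarrow> c * 1 powr (1 / \<delta> - 1)) at_top"
    by (rule filterlim_compose[OF as filterlim_one_over_at_right]) simp
  ultimately have "((\<lambda>t. (resolvent (1 / t) * survival B x t) / ((1 / t) / inv_exponent \<psi> (1 / t) * resolvent (1 * (1 / t)))) \<longlongrightarrow>
      (pi * D / Gamma (1 / \<delta>)) / (c * 1 powr (1 / \<delta> - 1))) at_top"
    using c by (intro tendsto_divide) auto
  moreover have "\<forall>\<^sub>F t in at_top. (resolvent (1 / t) * survival B x t) / ((1 / t) / inv_exponent \<psi> (1 / t) * resolvent (1 * (1 / t)))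
      = t * inv_exponent \<psi> (1 / t) * survival B x t"
    using eventually_gt_at_top[of "0::real"]
  proof eventually_elim
    case (elim t)
    have "resolvent (1 / t) \<noteq> 0" using resolvent_pos[of "1 / t"] elim by simp
    then show ?case using elim by simp
  qed
  ultimately have lim: "((\<lambda>t. t * inv_exponent \<psi> (1 / t) * survival B x t) \<longlongrightarrow>
      (pi * D / Gamma (1 / \<delta>)) / (c * 1 powr (1 / \<delta> - 1))) at_top"
    by (rule Lim_transform_eventually)
  \<comment> \<open>The reflection formula trades \<open>1 / Gamma (1 / \<delta>)\<close> for
    \<open>Gamma (1 - 1 / \<delta>) * sin (pi / \<delta>) / pi\<close>; together with the sine in
    \<open>1 / c\<close> this produces the squared sine.\<close>
  have "(pi * D / Gamma (1 / \<delta>)) / (c * 1 powr (1 / \<delta> - 1)) = \<delta> * Gamma (1 - 1 / \<delta>) * (sin (pi / \<delta>))\<^sup>2 / pi * D"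
  proof -
    have G: "0 < Gamma (1 / \<delta>)" using \<delta> by (intro Gamma_real_pos) simp
    have "Gamma (1 / \<delta>) * Gamma (1 - 1 / \<delta>) = pi / sin (pi / \<delta>)"
      using Gamma_reflection_real[of "1 / \<delta>"] by simp
    then have "Gamma (1 - 1 / \<delta>) = pi / (sin (pi / \<delta>) * Gamma (1 / \<delta>))"
      using G sin by (simp add: field_simps)
    then show ?thesis using G sin \<delta> by (simp add: c_def power2_eq_square)
  qed
  then show ?thesis using lim by (simp only: D_def)
qed

text \<open>Here \<open>\<rho> = 1\<close>: the Gamma factor is 1 and slow variation of the
  resolvent is what the Tauberian theorem asks for. Dividing the tail by \<open>pi\<close> cancels
  the \<open>pi\<close> in front of the kernel.\<close>

theorem survival_asymptotics_eq_1:
  assumes B: "0 \<in> B" "compact B" and rv: "regularly_varying_at_0 \<psi> 1"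
  shows "((\<lambda>t. tail (inv_exponent \<psi> (1 / t)) / pi * survival B x t) \<longlongrightarrow>
     compensated_kernel \<psi> x - mean_kernel_at_hit B x) at_top"
proof -
  define D where "D = compensated_kernel \<psi> x - mean_kernel_at_hit B x"
  have "((\<lambda>t. resolvent (1 / t) * survival B x t) \<longlongrightarrow> pi * D / Gamma 1) at_top"
    unfolding D_def
  proof (rule survival_tauberian[OF B])
    fix k :: nat assume "0 < k"
    then show "((\<lambda>l. resolvent (real k * l) / resolvent l) \<longlongrightarrow> real k powr (1 - 1)) (at_right 0)"
      using resolvent_slowly_varying[OF rv, of "real k"] by simp
  qed auto
  moreover have "((\<lambda>t. resolvent (1 * (1 / t)) / tail (inv_exponent \<psi> (1 / t))) \<longlongrightarrow> 1) at_top"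
    by (rule filterlim_compose[OF resolvent_over_tail[OF rv order_refl] filterlim_one_over_at_right])
  ultimately have "((\<lambda>t. resolvent (1 / t) * survival B x t / (resolvent (1 * (1 / t)) / tail (inv_exponent \<psi> (1 / t))) / pi) \<longlongrightarrow> pi * D / Gamma 1 / 1 / pi) at_top"
    by (intro tendsto_divide tendsto_const) auto
  then have "((\<lambda>t. resolvent (1 / t) * survival B x t / (resolvent (1 * (1 / t)) / tail (inv_exponent \<psi> (1 / t))) / pi) \<longlongrightarrow> D) at_top"
    by simp
  then show ?thesis unfolding D_def
  proof (rule Lim_transform_eventually)
    show "\<forall>\<^sub>F t in at_top. resolvent (1 / t) * survival B x t / (resolvent (1 * (1 / t)) / tail (inv_exponent \<psi> (1 / t))) / pi
       = tail (inv_exponent \<psi> (1 / t)) / pi * survival B x t"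
      using eventually_gt_at_top[of "0::real"]
    proof eventually_elim
      case (elim t)
      have "resolvent (1 / t) \<noteq> 0" using resolvent_pos[of "1 / t"] elim by simp
      then show ?case by simp
    qed
  qed
qed

end

section \<open>Transfer to the given process\<close>

context symmetric_levy_process
begin

text \<open>Hitting times look at positive times only, and there the paths of \<open>X\<close> and
  \<open>X'\<close> agree almost surely. The hitting time of \<open>X\<close> is thus almost surely
  equal to a measurable variable, which makes the event and the integrand measurable in the
  completion and identifies their values.\<close>

lemma functionals_of_modification:
  assumes reg: "regular_levy_process M \<psi> X'" and eq: "AE \<omega> in M. \<forall>t\<ge>0. X' t \<omega> = X t \<omega>"
    and B: "0 \<in> B" "closed B"
  shows "prob_hitting_time_gt M X B x t = regular_levy_process.survival M X' B x t"
    and "expectation_at_hitting M X B (compensated_kernel \<psi>) x = regular_levy_process.mean_kernel_at_hit M \<psi> X' B x"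
proof -
  interpret R: regular_levy_process M \<psi> X' by (rule reg)
  let ?T = "\<lambda>\<omega>. hitting_time B (\<lambda>s. x + X s \<omega>)"
  have "AE \<omega> in M. R.regular_hit B x \<omega>" using B by (intro R.AE_regular_hit) auto
  then have AE_T: "AE \<omega> in M. (\<forall>t\<ge>0. X' t \<omega> = X t \<omega>) \<and> R.hit B x \<omega> = ?T \<omega>"
    using eq
  proof eventually_elim
    case (elim \<omega>)
    have "?T \<omega> = hitting_time B (\<lambda>s. x + X' s \<omega>)"
      unfolding hitting_time_def using elim(2) by (intro arg_cong[where f = Inf]) auto
    then show ?case using R.regular_hit_props(2)[OF elim(1) B(2)] elim(2) by simp
  qed
  have "AE \<omega> in M. (ereal t < R.hit B x \<omega>) = (ereal t < ?T \<omega>)" using AE_T by eventually_elim simp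
  then have "Measurable.pred (completion M) (\<lambda>\<omega>. ereal t < ?T \<omega>)"
    by (rule measurable_completion_cong_AE[rotated]) auto
  then have "{\<omega> \<in> space M. ereal t < ?T \<omega>} \<in> sets (completion M)" by (simp add: pred_def)
  moreover have "{\<omega> \<in> space M. ereal t < R.hit B x \<omega>} \<in> sets M" by measurable
  moreover have "AE \<omega> in completion M. \<omega> \<in> {\<omega> \<in> space M. ereal t < ?T \<omega>} \<longleftrightarrow> \<omega> \<in> {\<omega> \<in> space M. ereal t < R.hit B x \<omega>}"
    using AE_completion[OF AE_T] by eventually_elim simp
  ultimately have "measure (completion M) {\<omega> \<in> space M. ereal t < ?T \<omega>} = measure (completion M) {\<omega> \<in> space M. ereal t < R.hit B x \<omega>}"
    by (intro measure_eq_AE) auto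
  then show "prob_hitting_time_gt M X B x t = R.survival B x t"
    by (simp add: prob_hitting_time_gt_def R.survival_def)
  define f where "f \<omega> = (if R.hit B x \<omega> < \<infinity> then compensated_kernel \<psi> (x + X' (real_of_ereal (R.hit B x \<omega>)) \<omega>) else 0)" for \<omega>
  define g where "g \<omega> = (let T = ?T \<omega> in if T < \<infinity> then compensated_kernel \<psi> (x + X (real_of_ereal T) \<omega>) else 0)" for \<omega>
  have f[measurable]: "f \<in> borel_measurable M" unfolding f_def[abs_def] by measurable
  have fg: "AE \<omega> in M. f \<omega> = g \<omega>"
    using AE_T
  proof eventually_elim
    case (elim \<omega>)
    have "0 \<le> real_of_ereal (R.hit B x \<omega>)" by (rule real_of_ereal_pos[OF R.hit_nonneg])
    then show ?case using elim by (auto simp: f_def g_def)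
  qed
  have "g \<in> borel_measurable (completion M)" by (rule measurable_completion_cong_AE[OF f fg]) simp
  then have "(\<integral>\<omega>. g \<omega> \<partial>completion M) = (\<integral>\<omega>. f \<omega> \<partial>completion M)"
    using AE_completion[OF fg] measurable_completion[OF f] by (intro integral_cong_AE) (auto elim!: eventually_mono)
  also have "\<dots> = (\<integral>\<omega>. f \<omega> \<partial>M)" by (rule integral_completion[OF f])
  finally show "expectation_at_hitting M X B (compensated_kernel \<psi>) x = R.mean_kernel_at_hit B x"
    by (simp add: expectation_at_hitting_def R.mean_kernel_at_hit_def f_def g_def)
qed

end

theorem proposition3p7:
  fixes M :: "'a measure" and X :: "real \<Rightarrow> 'a \<Rightarrow> real"
    and \<sigma> :: real and \<nu> :: "real measure" and \<psi> :: "real \<Rightarrow> real" and B :: "real set"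
  assumes "symmetric_levy_process M X \<sigma> \<nu> \<psi>"
    and "set_integrable lborel {0<..} (\<lambda>x. 1 / (1 + \<psi> x))"
    and "compact B" and "0 \<in> B"
  shows "(\<forall>\<delta>. 1 < \<delta> \<and> \<delta> \<le> 2 \<and> regularly_varying_at_0 \<psi> \<delta> \<longrightarrow>
            (\<forall>x. ((\<lambda>t. t * inv_exponent \<psi> (1 / t) * prob_hitting_time_gt M X B x t) \<longlongrightarrow>
                   \<delta> * Gamma (1 - 1 / \<delta>) * (sin (pi / \<delta>))\<^sup>2 / pi *
                   (compensated_kernel \<psi> x
                     - expectation_at_hitting M X B (compensated_kernel \<psi>) x)) at_top)) \<and>
         (regularly_varying_at_0 \<psi> 1 \<longrightarrow>
            (\<exists>L :: real \<Rightarrow> real.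
               (\<forall>u>0. L u = 1 / pi * (LBINT r:{inv_exponent \<psi> u<..}. 1 / \<psi> r)) \<and>
               slowly_varying_at_0 L \<and>
               (\<forall>x. ((\<lambda>t. L (1 / t) * prob_hitting_time_gt M X B x t) \<longlongrightarrow>
                      compensated_kernel \<psi> x
                        - expectation_at_hitting M X B (compensated_kernel \<psi>) x) at_top)))"
proof -
  interpret L: symmetric_levy_process M X \<sigma> \<nu> \<psi> by (rule assms(1))
  obtain X' where X': "regular_levy_process M \<psi> X'" "AE \<omega> in M. \<forall>t\<ge>0. X' t \<omega> = X t \<omega>"
    using L.regular_modification[OF assms(2)] by blast
  interpret R: regular_levy_process M \<psi> X' by (rule X'(1))
  note eq = L.functionals_of_modification[OF X' assms(4) compact_imp_closed[OF assms(3)]]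
  define L where "L u = R.tail (inv_exponent \<psi> u) / pi" for u
  have "slowly_varying_at_0 L" if "regularly_varying_at_0 \<psi> 1"
    using R.tail_slowly_varying[OF that] by (simp add: regularly_varying_at_0_def L_def)
  moreover have "L u = 1 / pi * (LBINT r:{inv_exponent \<psi> u<..}. 1 / \<psi> r)" for u
    by (simp add: L_def R.tail_def)
  moreover have "((\<lambda>t. L (1 / t) * prob_hitting_time_gt M X B x t) \<longlongrightarrow>
       compensated_kernel \<psi> x - expectation_at_hitting M X B (compensated_kernel \<psi>) x) at_top"
    if "regularly_varying_at_0 \<psi> 1" for x
    unfolding eq L_def by (rule R.survival_asymptotics_eq_1[OF assms(4,3) that])
  moreover have "((\<lambda>t. t * inv_exponent \<psi> (1 / t) * prob_hitting_time_gt M X B x t) \<longlongrightarrow>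
       \<delta> * Gamma (1 - 1 / \<delta>) * (sin (pi / \<delta>))\<^sup>2 / pi *
         (compensated_kernel \<psi> x - expectation_at_hitting M X B (compensated_kernel \<psi>) x)) at_top"
    if "1 < \<delta>" "regularly_varying_at_0 \<psi> \<delta>" for \<delta> x
    unfolding eq by (rule R.survival_asymptotics_gt_1[OF assms(4,3) that(2,1)])
  ultimately show ?thesis by blast
qed

end
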